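(* For $\delta>0$ let $\mathcal{V}_\delta(x)=\inf_{\alpha\in\mathcal{A}}\int_0^{+\infty}e^{-\delta t}\,l(y_x(t,\alpha),\alpha(t))\,dt$. Assume that each $\mathcal{V}_\delta$, $\delta>0$, is bounded. Then $$\lim_{\delta\to0^+}\mathcal{V}_\delta(x)=V^r(x)\qquad\forall x\in\mathbb{R}^n.$$
   Context: Notation. $\mathbb{R}_+=[0,+\infty)$; $\overline{B(0,1)}$ is the closed unit ball of $\mathbb{R}^m$. Data (standing assumptions). $A\subset\mathbb{R}^m$ is either compact or an (unbounded) convex, closed, nontrivial cone containing the origin. $f:\mathbb{R}^n\times A\to\mathbb{R}^n$ and $l:\mathbb{R}^n\times A\to\mathbb{R}$ are continuous; there are integers $q\ge p\ge 1$, $M>0$ and, for every $R>0$, constants $L_R,M_R,\bar L_R>0$ such that, for all $a\in A$ and all $|x|,|x_1|,|x_2|\le R$, $|f(x_1,a)-f(x_2,a)|\le L_R(1+|a|^p)|x_1-x_2|$, $|l(x_1,a)-l(x_2,a)|\le\bar L_R(1+|a|^q)|x_1-x_2|$, $0\le l(x,a)\le M_R(1+|a|^q)$; and $|f(x,a)|\le M(1+|a|^p)(1+|x|)$ for all $(x,a)$. If $A$ is unbounded, moreover: there are $C_1\ge0$, $C_2>0$ with $l(x,a)\ge C_2|a|^q-C_1$ for all $(x,a)\in\mathbb{R}^n\times A$ (same $q$), and for $\Phi\in\{f,l\}$ there is a continuous function $\Phi^\infty$ with $\lim_{\rho\to0^+}\rho^q\Phi(x,\rho^{-1}a)=\Phi^\infty(x,a)$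 uniformly on compact subsets of $\mathbb{R}^n\times A$. Controls. $\mathcal{A}$ is the set of Borel measurable $\alpha:\mathbb{R}_+\to A$ belonging to $L^q_{loc}(\mathbb{R}_+,A)$ (all Borel $\alpha$ if $A$ is compact); $y_x(\cdot,\alpha)$ is the solution of $\dot y=f(y,\alpha)$, $y(0)=x$. Relaxed infinite horizon problem, $A$ compact. $A^r=\mathcal{P}(A)$ is the set of Radon probability measures on $A$ with the weak$^*$ topology, $\mathcal{A}^r=L^\infty(\mathbb{R}_+,\mathcal{P}(A))$; $f^r(x,\mu)=\int_A f(x,a)\,d\mu$, $l^r(x,\mu)=\int_A l(x,a)\,d\mu$; $y^r_x(\cdot,\mu)$ solves $\dot y^r=f^r(y^r,\mu)$, $y^r(0)=x$; $V^r(x)=\inf_{\mu\in\mathcal{A}^r}\int_0^{+\infty} l^r(y^r_x(\tau,\mu),\mu(\tau))\,d\tau\in[0,+\infty]$. Relaxed infinite horizon problem, $A$ unbounded. For $\Phi\in\{f,l\}$, $\overline{\Phi}(x,w_0,w)=w_0^q\Phi(x,w_0^{-1}w)$ if $w_0\ne0$ and $\overline\Phi(x,0,w)=\Phi^\infty(x,w)$, for $(x,w_0,w)\in\mathbb{R}^n\times\mathbb{R}_+\times A$. $A^r=\mathcal{P}(\overline{B(0,1)}\cap A)$ is the set of Radon probability measures on $\overline{B(0,1)}\cap A$ with the weak$^*$ topology, $\Gamma^r=L^\infty(\mathbb{R}_+,A^r)$; for $\psi\in\{\overline f,\overline l\}$, $\psi^r(x,\mu)=\int_{\overline{B(0,1)}\cap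 A}\psi(x,(1-|w|^q)^{1/q},w)\,d\mu$; $\xi^r_x(\cdot,\mu)$ solves $\dot\xi^r=\overline f^r(\xi^r,\mu)$, $\xi^r(0)=x$; $V^r(x)=\inf_{\mu\in\Gamma^r}\int_0^{+\infty}\overline l^r(\xi^r_x(s,\mu),\mu(s))\,ds\in[0,+\infty]$. *)

theory Defs
  imports "HOL-Probability.Probability"
begin

text \<open>
  Throughout, functions of the time \<open>t \<in> [0,\<infinity>)\<close> are total functions on \<^typ>\<open>real\<close> of which only the
  values on \<open>{0..}\<close> matter; likewise the data are total functions of which only the values on the
  control set \<open>A\<close> matter.
\<close>

subsection \<open>Solutions of ordinary differential equations\<close>

text \<open>
  \<open>y\<close> is a (global, forward) Caratheodory solution of \<open>y' = F t y\<close>, \<open>y 0 = x\<close>. The integral equation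
  makes \<open>y\<close> locally absolutely continuous.
\<close>

definition solves :: "(real \<Rightarrow> ('x::euclidean_space) \<Rightarrow> 'x) \<Rightarrow> 'x \<Rightarrow> (real \<Rightarrow> 'x) \<Rightarrow> bool"
  where "solves F x y \<longleftrightarrow>
    (\<forall>t\<ge>0. set_integrable lebesgue {0..t} (\<lambda>s. F s (y s)) \<and>
           y t = x + (LINT s:{0..t}|lebesgue. F s (y s)))"

text \<open>
  The solution: for the vector fields below it exists and is unique on \<open>{0..}\<close>, so that the choice
  only concerns its irrelevant values at negative times.
\<close>

definition trajectory :: "(real \<Rightarrow> ('x::euclidean_space) \<Rightarrow> 'x) \<Rightarrow> 'x \<Rightarrow> real \<Rightarrow> 'x"
  where "trajectory F x = (SOME y. solves F x y)"

subsection \<open>The discounted problem\<close>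

text \<open>For compact \<open>A\<close> the integrability condition holds automatically.\<close>

definition controls :: "nat \<Rightarrow> ('a::euclidean_space) set \<Rightarrow> (real \<Rightarrow> 'a) set"
  where "controls q A =
    {\<alpha>. \<alpha> \<in> borel_measurable (restrict_space borel {0..}) \<and> (\<forall>t\<ge>0. \<alpha> t \<in> A) \<and>
        (\<forall>T\<ge>0. set_integrable lebesgue {0..T} (\<lambda>t. norm (\<alpha> t) ^ q))}"

definition discounted_value ::
    "nat \<Rightarrow> ('a::euclidean_space) set \<Rightarrow> (('x::euclidean_space) \<Rightarrow> 'a \<Rightarrow> 'x) \<Rightarrow>
     ('x \<Rightarrow> 'a \<Rightarrow> real) \<Rightarrow> real \<Rightarrow> 'x \<Rightarrow> ennreal"
  where "discounted_value q A f l \<delta> x =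
    (INF \<alpha>\<in>controls q A.
       \<integral>\<^sup>+t\<in>{0..}. ennreal (exp (- \<delta> * t) * l (trajectory (\<lambda>s z. f z (\<alpha> s)) x t) (\<alpha> t)) \<partial>lebesgue)"

subsection \<open>Relaxed controls\<close>

text \<open>
  Used only for compact \<open>K\<close>, where every Borel probability measure is Radon.
\<close>

definition radon_prob :: "('a::euclidean_space) set \<Rightarrow> 'a measure set"
  where "radon_prob K = {\<mu>. prob_space \<mu> \<and> sets \<mu> = sets (restrict_space borel K)}"

definition weak_star :: "('a::euclidean_space) set \<Rightarrow> 'a measure topology"
  where "weak_star K = topology_generated_by
    {{\<mu> \<in> radon_prob K. (LINT a|\<mu>. \<phi> a) \<in> U} | (\<phi> :: 'a \<Rightarrow> real) U. continuous_on K \<phi> \<and> open U}"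

lemma topspace_weak_star: "topspace (weak_star K) = radon_prob K"
proof -
  let ?S = "{{\<mu> \<in> radon_prob K. (LINT a|\<mu>. \<phi> a) \<in> U} |
             (\<phi> :: 'a \<Rightarrow> real) U. continuous_on K \<phi> \<and> open U}"
  have "radon_prob K \<in> ?S"
    by (rule CollectI, rule exI[of _ "\<lambda>_. 0"], rule exI[of _ UNIV]) auto
  moreover have "\<Union>?S \<subseteq> radon_prob K"
    by auto
  ultimately have "\<Union>?S = radon_prob K"
    by blast
  then show ?thesis
    unfolding weak_star_def topology_generated_by_topspace by simp
qed

text \<open>
  The Lebesgue measurable maps from \<open>{0..}\<close> to \<open>radon_prob K\<close> with the Borel sets of the weak-star
  topology. These represent the elements of \<open>L\<^sup>\<infinity>(\<real>\<^sub>+, P(K))\<close>: essential boundedness is automatic, and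
  trajectories and costs do not change on null sets of times.
\<close>

definition relaxed_controls :: "('a::euclidean_space) set \<Rightarrow> (real \<Rightarrow> 'a measure) set"
  where "relaxed_controls K =
    measurable (lebesgue_on {0..}) (sigma (radon_prob K) {U. openin (weak_star K) U})"

definition relax :: "('x \<Rightarrow> 'a \<Rightarrow> 'b) \<Rightarrow> 'x \<Rightarrow> 'a measure \<Rightarrow> 'b :: euclidean_space"
  where "relax \<psi> x \<mu> = (LINT a|\<mu>. \<psi> x a)"

definition relaxed_value ::
    "('a::euclidean_space) set \<Rightarrow> (('x::euclidean_space) \<Rightarrow> 'a \<Rightarrow> 'x) \<Rightarrow> ('x \<Rightarrow> 'a \<Rightarrow> real) \<Rightarrow> 'x \<Rightarrow> ennreal"
  where "relaxed_value K f l x =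
    (INF \<mu>\<in>relaxed_controls K.
       \<integral>\<^sup>+t\<in>{0..}. ennreal (relax l (trajectory (\<lambda>s z. relax f z (\<mu> s)) x t) (\<mu> t)) \<partial>lebesgue)"

subsection \<open>Compactification of an unbounded control set\<close>

text \<open>\<open>\<Phi>_inf\<close> stands for the recession function of \<open>\<Phi>\<close> (see \<open>recession\<close> below).\<close>

definition extended ::
    "nat \<Rightarrow> ('x \<Rightarrow> 'a \<Rightarrow> 'b) \<Rightarrow> ('x \<Rightarrow> 'a \<Rightarrow> 'b) \<Rightarrow> 'x \<Rightarrow> real \<Rightarrow> 'a :: euclidean_space \<Rightarrow> 'b :: euclidean_space"
  where "extended q \<Phi> \<Phi>_inf x w\<^sub>0 w =
    (if w\<^sub>0 \<noteq> 0 then w\<^sub>0 ^ q *\<^sub>R \<Phi> x (inverse w\<^sub>0 *\<^sub>R w) else \<Phi>_inf x w)"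

definition compactified ::
    "nat \<Rightarrow> ('x \<Rightarrow> 'a \<Rightarrow> 'b) \<Rightarrow> ('x \<Rightarrow> 'a \<Rightarrow> 'b) \<Rightarrow> 'x \<Rightarrow> 'a :: euclidean_space \<Rightarrow> 'b :: euclidean_space"
  where "compactified q \<Phi> \<Phi>_inf x w = extended q \<Phi> \<Phi>_inf x (root q (1 - norm w ^ q)) w"

text \<open>
  \<open>V\<^sup>r\<close>. The recession functions are irrelevant when \<open>A\<close> is bounded.
\<close>

definition relaxed_infinite_horizon_value ::
    "nat \<Rightarrow> ('a::euclidean_space) set \<Rightarrow> (('x::euclidean_space) \<Rightarrow> 'a \<Rightarrow> 'x) \<Rightarrow> ('x \<Rightarrow> 'a \<Rightarrow> real) \<Rightarrow>
     ('x \<Rightarrow> 'a \<Rightarrow> 'x) \<Rightarrow> ('x \<Rightarrow> 'a \<Rightarrow> real) \<Rightarrow> 'x \<Rightarrow> ennreal"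
  where "relaxed_infinite_horizon_value q A f l f_inf l_inf x =
    (if bounded A then relaxed_value A f l x
     else relaxed_value (cball 0 1 \<inter> A) (compactified q f f_inf) (compactified q l l_inf) x)"

subsection \<open>Hypotheses on the data\<close>

definition recession ::
    "nat \<Rightarrow> ('a::euclidean_space) set \<Rightarrow>
     (('x::euclidean_space) \<Rightarrow> 'a \<Rightarrow> ('b::euclidean_space)) \<Rightarrow> ('x \<Rightarrow> 'a \<Rightarrow> 'b) \<Rightarrow> bool"
  where "recession q A \<Phi> \<Phi>_inf \<longleftrightarrow>
    continuous_on (UNIV \<times> A) (\<lambda>(x, a). \<Phi>_inf x a) \<and>
    (\<forall>C. compact C \<and> C \<subseteq> UNIV \<times> A \<longrightarrow>
       uniform_limit C (\<lambda>\<rho> (x, a). \<rho> ^ q *\<^sub>R \<Phi> x (inverse \<rho> *\<^sub>R a)) (\<lambda>(x, a). \<Phi>_inf x a) (at_right 0))"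

end

theory Submission
  imports Defs "HOL-Complex_Analysis.Great_Picard"
begin

text \<open>
  A change of time turns the unbounded problem into one with a compact control set, in which the
  original time is a clock \<open>t(s) = \<integral> \<tau>(w) ds\<close> and the discount factor is \<open>exp (- \<delta> t(s))\<close>; compact control
  sets are the case \<open>\<tau> = 1\<close>. For \<open>\<V>\<^sub>\<delta> \<le> V\<^sup>r\<close>, a relaxed control of finite cost is approximated by
  an ordinary one on a long interval and continued by a nearly optimal discounted control, whose
  contribution is small since \<open>\<V>\<^sub>\<delta>\<close> is bounded. For \<open>V\<^sup>r \<le> liminf \<V>\<^sub>\<delta>\<close>, nearly optimal discounted
  controls have a subsequence whose trajectories converge, and Mazur's lemma together with a measurable
  selection produces a relaxed control steering the limit trajectory at no larger cost.
\<close>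

section \<open>Caratheodory differential equations\<close>

text \<open>Where the representing value \<open>w\<close> lies on the unit sphere, the state moves
  while the original time stands still. Relaxation cannot exclude this; coercivity does: after
  compactification it reads \<open>L \<ge> C\<^sub>2 - (C\<^sub>1 + C\<^sub>2) * \<tau>\<close>, so
  new time that does not advance the clock is paid for at the rate \<open>C\<^sub>2\<close>. The
  lower bound needs only that the clock never exceeds the new time: on a bounded interval of new
  time the discount factors tend to 1, whatever the clocks do in the limit.

  Measures are not passed to the limit. Only the pair of velocity and running cost is; its limit is
  a point of a convex hull in dimension n + 1, from which a measure with at most n + 2 atoms is
  rebuilt at each time.

  Compactification also settles well-posedness. Along an unbounded control in L^q_loc the field is
  Lipschitz only with a constant that varies integrably in time, whereas the compactified field is
  Lipschitz uniformly in time. Existence and uniqueness are proved for the latter and carried over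
  by the change of time.\<close>

lemma absolutely_integrable_bounded:
  fixes f :: "real \<Rightarrow> 'b::euclidean_space"
  assumes "f \<in> borel_measurable (lebesgue_on {0..})" "0 \<le> a"
    and "\<And>s. s \<in> {a..b} \<Longrightarrow> norm (f s) \<le> B"
  shows "f absolutely_integrable_on {a..b}"
proof (rule measurable_bounded_by_integrable_imp_absolutely_integrable)
  show "f \<in> borel_measurable (lebesgue_on {a..b})"
    using assms by (intro measurable_restrict_mono[OF assms(1)]) auto
  show "(\<lambda>_. B) integrable_on {a..b}"
    by (rule integrable_const_ivl)
qed (use assms in auto)

text \<open>Below, the integral equation is used with gauge integrals over intervals, which are easy
  to split, shift and alter on null sets.\<close>

lemma solves_alt:
  "solves F x y \<longleftrightarrow> (\<forall>t\<ge>0. (\<lambda>s. F s (y s)) absolutely_integrable_on {0..t} \<and>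
      y t = x + integral {0..t} (\<lambda>s. F s (y s)))"
  unfolding solves_def by (auto simp: set_lebesgue_integral_eq_integral(2))

lemma borel_measurable_lebesgue_on_continuous:
  fixes y :: "real \<Rightarrow> 'b::euclidean_space"
  assumes "continuous_on {0..} y"
  shows "y \<in> borel_measurable (lebesgue_on {0..})"
  by (rule continuous_imp_measurable_on_sets_lebesgue[OF assms]) auto

text \<open>For a simple function \<open>u i\<close> the composition is a finite gluing of
  measurable sections; continuity in the state carries measurability over to the pointwise limit
  \<open>y\<close>.\<close>

lemma borel_measurable_caratheodory:
  fixes g :: "'s \<Rightarrow> 'x::euclidean_space \<Rightarrow> 'b::euclidean_space"
  assumes g: "\<And>z. (\<lambda>s. g s z) \<in> borel_measurable M"
    and cont: "\<And>s. s \<in> space M \<Longrightarrow> continuous_on UNIV (g s)"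
    and y: "y \<in> borel_measurable M"
  shows "(\<lambda>s. g s (y s)) \<in> borel_measurable M"
proof -
  obtain u where u: "\<And>i. simple_function M (u i)"
    "\<And>s. s \<in> space M \<Longrightarrow> (\<lambda>i. u i s) \<longlonglongrightarrow> y s"
    using borel_measurable_implies_sequence_metric[OF y, of 0] by blast
  have m: "(\<lambda>s. g s (u i s)) \<in> borel_measurable M" for i
  proof (rule measurable_compose_countable'[where f="\<lambda>z s. g s z" and g="u i" and I="u i ` space M"])
    show "u i \<in> measurable M (count_space (u i ` space M))"
      using u(1) unfolding simple_function_def by (subst measurable_count_space_eq2) auto
    show "countable (u i ` space M)"
      using u(1) unfolding simple_function_def by (intro countable_finite) auto
  qed (rule g)
  show ?thesis
  proof (rule borel_measurable_LIMSEQ_metric[OF m])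
    fix s assume "s \<in> space M"
    then show "(\<lambda>i. g s (u i s)) \<longlonglongrightarrow> g s (y s)"
      by (intro continuous_on_tendsto_compose[OF cont u(2)]) auto
  qed
qed

text \<open>The right-hand side \<open>v\<close> of the inequality has derivative
  \<open>C * u \<le> C * v\<close>, so \<open>exp (- C * t) * v t\<close> never exceeds its initial
  value \<open>c\<close>.\<close>

lemma gronwall:
  fixes u :: "real \<Rightarrow> real"
  assumes u: "continuous_on {0..T} u" and C: "C \<ge> 0"
    and le: "\<And>t. t \<in> {0..T} \<Longrightarrow> u t \<le> c + C * integral {0..t} u"
    and t: "t \<in> {0..T}"
  shows "u t \<le> c * exp (C * t)"
proof -
  define v where "v s = c + C * integral {0..s} u" for s
  have v': "(v has_real_derivative C * u s) (at s within {0..T})" if "s \<in> {0..T}" for s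
    unfolding v_def using integral_has_real_derivative[OF u that]
    by (auto intro!: derivative_eq_intros)
  have cv: "continuous_on {0..T} v"
    using v' by (meson DERIV_continuous_on)
  have "exp (- C * t) * v t \<le> exp (- C * 0) * v 0"
  proof (rule DERIV_nonpos_imp_decreasing_open[where f="\<lambda>s. exp (- C * s) * v s"])
    fix s assume s: "0 < s" "s < t"
    then have "(v has_real_derivative C * u s) (at s)"
      using v'[of s] t at_within_Icc_at[of 0 s T] by auto
    then have "((\<lambda>s. exp (- C * s) * v s) has_real_derivative
        exp (- C * s) * (- C) * v s + exp (- C * s) * (C * u s)) (at s)"
      by (auto intro!: derivative_eq_intros)
    then have "((\<lambda>s. exp (- C * s) * v s) has_real_derivative exp (- C * s) * (C * (u s - v s))) (at s)"
      by (simp add: algebra_simps)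
    moreover have "exp (- C * s) * (C * (u s - v s)) \<le> 0"
      using le[of s] s t C by (intro mult_nonneg_nonpos) (auto simp: v_def)
    ultimately show "\<exists>d. ((\<lambda>s. exp (- C * s) * v s) has_real_derivative d) (at s) \<and> d \<le> 0"
      by blast
  next
    show "continuous_on {0..t} (\<lambda>s. exp (- C * s) * v s)"
      using t by (intro continuous_intros continuous_on_subset[OF cv]) auto
  qed (use t in auto)
  then have "v t \<le> c * exp (C * t)"
    by (simp add: v_def exp_minus field_simps)
  then show ?thesis
    using le[OF t] by (simp add: v_def)
qed

lemma continuous_on_primitive:
  fixes h :: "real \<Rightarrow> 'x::euclidean_space"
  assumes "0 \<le> T" "\<And>t. t \<in> {0..T} \<Longrightarrow> h absolutely_integrable_on {0..t} \<and> y t = x + integral {0..t} h"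
  shows "continuous_on {0..T} y"
proof -
  have "h integrable_on {0..T}"
    using assms(2)[of T] assms(1) set_lebesgue_integral_eq_integral(1) by auto
  then have "continuous_on {0..T} (\<lambda>t. x + integral {0..t} h)"
    by (intro continuous_intros indefinite_integral_continuous_1)
  then show ?thesis
    by (rule continuous_on_eq) (use assms in auto)
qed

text \<open>Gronwall's inequality for \<open>1 + norm (y t)\<close>. The velocity is an arbitrary
  integrand \<open>h\<close> instead of a field along \<open>y\<close>, because the estimate is also
  applied to a truncated field before the truncation is known to be inactive.\<close>

lemma linear_growth_bound:
  fixes h :: "real \<Rightarrow> 'x::euclidean_space"
  assumes h: "\<And>t. t \<in> {0..T} \<Longrightarrow> h absolutely_integrable_on {0..t} \<and> y t = x + integral {0..t} h"
    and le: "\<And>s. s \<in> {0..T} \<Longrightarrow> norm (h s) \<le> B * (1 + norm (y s))"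
    and B: "B \<ge> 0" and t: "t \<in> {0..T}"
  shows "1 + norm (y t) \<le> (1 + norm x) * exp (B * t)"
proof -
  have cy: "continuous_on {0..T} y"
    using continuous_on_primitive[of T h y x] h t by auto
  show ?thesis
  proof (rule gronwall[where u="\<lambda>s. 1 + norm (y s)" and T=T])
    show cu: "continuous_on {0..T} (\<lambda>s. 1 + norm (y s))"
      by (intro continuous_intros cy)
    fix t assume t: "t \<in> {0..T}"
    have "norm (integral {0..t} h) \<le> integral {0..t} (\<lambda>s. B * (1 + norm (y s)))"
    proof (rule integral_norm_bound_integral)
      show "h integrable_on {0..t}"
        using h[OF t] set_lebesgue_integral_eq_integral(1) by blast
      show "(\<lambda>s. B * (1 + norm (y s))) integrable_on {0..t}"
        using t by (intro integrable_continuous_interval continuous_intros continuous_on_subset[OF cy]) auto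
    qed (use le t in auto)
    moreover have "norm (y t) \<le> norm x + norm (integral {0..t} h)"
      using h[OF t] norm_triangle_ineq by auto
    ultimately show "1 + norm (y t) \<le> 1 + norm x + B * integral {0..t} (\<lambda>s. 1 + norm (y s))"
      by simp
  qed (use B t in auto)
qed

text \<open>A concatenated control agrees with its first piece only up to the switching time, so
  uniqueness must be available on bounded intervals.\<close>

definition solves_upto :: "real \<Rightarrow> (real \<Rightarrow> 'x::euclidean_space \<Rightarrow> 'x) \<Rightarrow> 'x \<Rightarrow> (real \<Rightarrow> 'x) \<Rightarrow> bool"
  where "solves_upto T F x y \<longleftrightarrow> (\<forall>t\<in>{0..T}. (\<lambda>s. F s (y s)) absolutely_integrable_on {0..t} \<and>
      y t = x + integral {0..t} (\<lambda>s. F s (y s)))"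

lemma solves_uptoD:
  assumes "solves_upto T F x y" "t \<in> {0..T}"
  shows "(\<lambda>s. F s (y s)) absolutely_integrable_on {0..t}" "(\<lambda>s. F s (y s)) integrable_on {0..t}"
    "y t = x + integral {0..t} (\<lambda>s. F s (y s))"
  using assms set_lebesgue_integral_eq_integral(1) unfolding solves_upto_def by blast+

lemma solves_iff_upto: "solves F x y \<longleftrightarrow> (\<forall>T. solves_upto T F x y)"
  unfolding solves_alt solves_upto_def by (meson atLeastAtMost_iff order_refl)

lemma solves_upto_continuous: "solves_upto T F x y \<Longrightarrow> continuous_on {0..T} y"
  by (cases "0 \<le> T")
     (auto simp: solves_upto_def intro: continuous_on_primitive[of T "\<lambda>s. F s (y s)" y x])

lemma continuous_on_half_line:
  fixes y :: "real \<Rightarrow> 'x::topological_space"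
  assumes "\<And>T. 0 \<le> T \<Longrightarrow> continuous_on {0..T} y"
  shows "continuous_on {0..} y"
proof (rule continuous_on_eq_continuous_within[THEN iffD2], rule ballI)
  fix s :: real assume s: "s \<in> {0..}"
  have "at s within {0..} = at s within {0..s+1}"
    by (rule at_within_nhd[of s "{..<s+1}"]) (use s in auto)
  then show "continuous (at s within {0..}) y"
    using assms[of "s+1"] s by (auto simp: continuous_on_eq_continuous_within)
qed

lemma solves_continuous: "solves F x y \<Longrightarrow> continuous_on {0..} y"
  by (rule continuous_on_half_line) (auto simp: solves_iff_upto intro: solves_upto_continuous)

text \<open>What ordinary and relaxed controls with values in a compact set have in common: growth
  and local Lipschitz constants that are uniform in time. The original dynamics along an unbounded
  control need not be of this kind.\<close>

locale lipschitz_field =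
  fixes G :: "real \<Rightarrow> 'x::euclidean_space \<Rightarrow> 'x" and B :: real
  assumes measurable_field: "(\<lambda>s. G s z) \<in> borel_measurable (lebesgue_on {0..})"
    and growth: "0 \<le> s \<Longrightarrow> norm (G s z) \<le> B * (1 + norm z)"
    and lipschitz: "\<And>R. R > 0 \<Longrightarrow> \<exists>C\<ge>0. \<forall>s\<ge>0. \<forall>x y. norm x \<le> R \<longrightarrow> norm y \<le> R \<longrightarrow>
      norm (G s x - G s y) \<le> C * norm (x - y)"
    and B_pos: "B > 0"
begin

lemma continuous_field:
  assumes "0 \<le> s"
  shows "continuous_on UNIV (G s)"
proof -
  have "continuous_on (ball 0 R) (G s)" if R: "R > 0" for R
  proof -
    obtain C where C: "C \<ge> 0" "\<forall>s\<ge>0. \<forall>x y. norm x \<le> R \<longrightarrow> norm y \<le> R \<longrightarrow>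
      norm (G s x - G s y) \<le> C * norm (x - y)"
      using lipschitz[OF R] by blast
    have "C-lipschitz_on (ball 0 R) (G s)"
      using C assms by (intro lipschitz_onI) (auto simp: dist_norm)
    then show ?thesis
      by (rule lipschitz_on_continuous_on)
  qed
  then have "continuous_on (\<Union>R\<in>{0<..}. ball 0 R) (G s)"
    by (intro continuous_on_open_UN) auto
  moreover have "x \<in> (\<Union>R\<in>{0<..}. ball 0 R)" for x :: 'x
    by (auto intro!: bexI[of _ "norm x + 1"] simp: add_nonneg_pos)
  then have "(\<Union>R\<in>{0<..}. ball 0 R) = (UNIV :: 'x set)"
    by blast
  ultimately show ?thesis by simp
qed

lemma measurable_along:
  assumes "continuous_on {0..T} y"
  shows "(\<lambda>s. G s (y s)) \<in> borel_measurable (lebesgue_on {0..T})"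
proof (rule borel_measurable_caratheodory[where g=G and y=y])
  show "(\<lambda>s. G s z) \<in> borel_measurable (lebesgue_on {0..T})" for z
    by (rule measurable_restrict_mono[OF measurable_field]) auto
  show "y \<in> borel_measurable (lebesgue_on {0..T})"
    by (rule continuous_imp_measurable_on_sets_lebesgue[OF assms]) auto
qed (auto intro: continuous_field)

lemma integrable_along:
  assumes y: "continuous_on {0..T} y" and t: "a \<ge> 0" "t \<le> T"
  shows "(\<lambda>s. G s (y s)) absolutely_integrable_on {a..t}"
proof (rule measurable_bounded_by_integrable_imp_absolutely_integrable)
  show "(\<lambda>s. G s (y s)) \<in> borel_measurable (lebesgue_on {a..t})"
    by (rule measurable_restrict_mono[OF measurable_along[OF y]]) (use t in auto)
  show "(\<lambda>s. B * (1 + norm (y s))) integrable_on {a..t}"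
    using t by (intro integrable_continuous_interval continuous_intros continuous_on_subset[OF y]) auto
qed (use growth t in auto)

text \<open>The number \<epsilon> bounds the defect of \<open>z\<close> in the integral equation,
  that is, after integration in time. A rapidly oscillating control makes this defect small although
  its velocities stay far from the averaged ones. Gronwall's inequality for the distance of the two
  paths does the rest.\<close>

lemma stability:
  assumes y: "solves_upto T G x y" and z: "continuous_on {0..T} z"
    and eps: "\<And>t. t \<in> {0..T} \<Longrightarrow> norm (z t - x - integral {0..t} (\<lambda>s. G s (z s))) \<le> \<epsilon>"
    and R: "\<And>t. t \<in> {0..T} \<Longrightarrow> norm (y t) \<le> R" "\<And>t. t \<in> {0..T} \<Longrightarrow> norm (z t) \<le> R"
    and C: "C \<ge> 0" "\<And>s x y. s \<ge> 0 \<Longrightarrow> norm x \<le> R \<Longrightarrow> norm y \<le> R \<Longrightarrow>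
        norm (G s x - G s y) \<le> C * norm (x - y)"
    and t: "t \<in> {0..T}"
  shows "norm (y t - z t) \<le> \<epsilon> * exp (C * t)"
proof (rule gronwall[where T=T])
  note cy = solves_upto_continuous[OF y]
  show "continuous_on {0..T} (\<lambda>t. norm (y t - z t))"
    by (intro continuous_intros cy z)
  fix t assume t: "t \<in> {0..T}"
  let ?I = "integral {0..t}"
  have i: "(\<lambda>s. G s (y s)) integrable_on {0..t}" "(\<lambda>s. G s (z s)) integrable_on {0..t}"
    using integrable_along[of T _ 0 t] cy z t set_lebesgue_integral_eq_integral(1) by auto
  have "y t - z t = ?I (\<lambda>s. G s (y s) - G s (z s)) - (z t - x - ?I (\<lambda>s. G s (z s)))"
    using solves_uptoD(3)[OF y t] i by (simp add: integral_diff)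
  then have "norm (y t - z t) \<le> norm (?I (\<lambda>s. G s (y s) - G s (z s))) + \<epsilon>"
    by (simp only:) (rule order_trans[OF norm_triangle_ineq4 add_left_mono[OF eps[OF t]]])
  also have "norm (?I (\<lambda>s. G s (y s) - G s (z s))) \<le> ?I (\<lambda>s. C * norm (y s - z s))"
  proof (rule integral_norm_bound_integral)
    show "(\<lambda>s. C * norm (y s - z s)) integrable_on {0..t}"
      using t by (intro integrable_continuous_interval continuous_intros
          continuous_on_subset[OF cy] continuous_on_subset[OF z]) auto
  qed (use i R C t in \<open>auto intro!: integrable_diff\<close>)
  finally show "norm (y t - z t) \<le> \<epsilon> + C * ?I (\<lambda>s. norm (y s - z s))"
    by simp
qed (use C t in auto)

text \<open>Changing the field on a null set of times alters no integral, so \<open>z\<close> solves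
  the equation of \<open>G\<close> as well, and \<open>stability\<close> applies with zero
  defect.\<close>

lemma solves_upto_unique:
  assumes y: "solves_upto T G x y" and z: "solves_upto T G' x z"
    and N: "negligible N" and eq: "\<And>s. s \<in> {0..T} - N \<Longrightarrow> G' s = G s" and t: "t \<in> {0..T}"
  shows "z t = y t"
proof -
  have z': "solves_upto T G x z"
  proof -
    have "(\<lambda>s. G s (z s)) absolutely_integrable_on {0..t}"
        "integral {0..t} (\<lambda>s. G' s (z s)) = integral {0..t} (\<lambda>s. G s (z s))" if t: "t \<in> {0..T}" for t
    proof -
      have *: "G s (z s) = G' s (z s)" if "s \<in> {0..t} - N" for s
        using eq[of s] that t by auto
      show "(\<lambda>s. G s (z s)) absolutely_integrable_on {0..t}"
        by (rule absolutely_integrable_spike[OF solves_uptoD(1)[OF z t] N]) (rule *)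
      show "integral {0..t} (\<lambda>s. G' s (z s)) = integral {0..t} (\<lambda>s. G s (z s))"
        by (rule integral_spike[OF N]) (rule *)
    qed
    then show ?thesis
      using z by (simp add: solves_upto_def)
  qed
  note c = solves_upto_continuous[OF y] solves_upto_continuous[OF z']
  have "compact (y ` {0..T} \<union> z ` {0..T})"
    by (intro compact_Un compact_continuous_image c) auto
  then obtain R where R: "R > 0" "\<And>v. v \<in> y ` {0..T} \<union> z ` {0..T} \<Longrightarrow> norm v \<le> R"
    by (meson bounded_pos compact_imp_bounded)
  obtain C where C: "C \<ge> 0" "\<forall>s\<ge>0. \<forall>x y. norm x \<le> R \<longrightarrow> norm y \<le> R \<longrightarrow>
      norm (G s x - G s y) \<le> C * norm (x - y)"
    using lipschitz[OF R(1)] by blast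
  have "norm (y t - z t) \<le> 0 * exp (C * t)"
    by (rule stability[OF y c(2) _ _ _ C(1) _ t, where R=R])
       (use R C solves_uptoD(3)[OF z'] in auto)
  then show ?thesis by simp
qed

lemma solves_upto_bound:
  assumes "solves_upto T G x y" "t \<in> {0..T}"
  shows "1 + norm (y t) \<le> (1 + norm x) * exp (B * t)"
  by (rule linear_growth_bound[of T "\<lambda>s. G s (y s)"])
     (use assms growth B_pos in \<open>auto simp: solves_upto_def\<close>)

end

section \<open>Global existence, uniqueness and a priori bounds of trajectories\<close>

lemma picard_global:
  fixes H :: "real \<Rightarrow> 'x::euclidean_space \<Rightarrow> 'x"
  assumes meas: "\<And>z. (\<lambda>s. H s z) \<in> borel_measurable (lebesgue_on {0..})"
    and bound: "\<And>T. \<exists>b. \<forall>s\<in>{0..T}. \<forall>z. norm (H s z) \<le> b"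
    and lip: "\<And>T. \<exists>C>0. \<forall>s\<in>{0..T}. \<forall>z1 z2. norm (H s z1 - H s z2) \<le> C * norm (z1 - z2)"
  shows "\<exists>y. solves H x y"
proof -
  have cont: "continuous_on UNIV (H s)" if "s \<ge> 0" for s
  proof -
    obtain C where C: "C > 0" "\<forall>s\<in>{0..s}. \<forall>z1 z2. norm (H s z1 - H s z2) \<le> C * norm (z1 - z2)"
      using lip by blast
    have "C-lipschitz_on UNIV (H s)"
      using C that by (intro lipschitz_onI) (auto simp: dist_norm)
    then show ?thesis
      by (rule lipschitz_on_continuous_on)
  qed
  have along: "(\<lambda>s. H s (u s)) \<in> borel_measurable (lebesgue_on {0..})"
    if "u \<in> borel_measurable (lebesgue_on {0..})" for u
    by (rule borel_measurable_caratheodory[where g=H and y=u]) (use that meas cont in auto)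
  have int: "(\<lambda>s. H s (u s)) absolutely_integrable_on {0..t}"
    if u: "u \<in> borel_measurable (lebesgue_on {0..})" for u t
  proof -
    obtain b where "\<forall>s\<in>{0..t}. \<forall>z. norm (H s z) \<le> b"
      using bound by blast
    then show ?thesis
      by (intro absolutely_integrable_bounded[OF along[OF u], of 0 t b]) auto
  qed
  define P where "P u t = x + integral {0..t} (\<lambda>s. H s (u s))" for u t
  define Y where "Y n = (P ^^ n) (\<lambda>_. x)" for n
  have Y_Suc: "Y (Suc n) = P (Y n)" and Y_0: "Y 0 = (\<lambda>_. x)" for n
    by (simp_all add: Y_def)
  have Ym: "Y n \<in> borel_measurable (lebesgue_on {0..})" for n
  proof (induction n)
    case (Suc n)
    have "continuous_on {0..} (P (Y n))"
      unfolding P_def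
      by (intro continuous_on_half_line continuous_intros indefinite_integral_continuous_1
          set_lebesgue_integral_eq_integral(1) int Suc)
    then show ?case
      unfolding Y_Suc by (rule borel_measurable_lebesgue_on_continuous)
  qed (simp add: Y_0)
  have lim: "\<exists>v. (\<lambda>n. Y n t) \<longlonglongrightarrow> v" if t: "t \<ge> 0" for t
  proof -
    obtain b where b: "\<forall>s\<in>{0..t}. \<forall>z. norm (H s z) \<le> b"
      using bound by blast
    obtain C where C: "C > 0" "\<forall>s\<in>{0..t}. \<forall>z1 z2. norm (H s z1 - H s z2) \<le> C * norm (z1 - z2)"
      using lip by blast
    have b0: "b \<ge> 0"
      using b t norm_ge_zero[of "H 0 0"] by (meson atLeastAtMost_iff order_refl order_trans)
    \<comment> \<open>The first increment is at most \<open>b * r = D * (2 * C * r)\<close>, hence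
      at most \<open>D * exp (2 * C * r)\<close>; this starts the induction.\<close>
    define D where "D = b / (2 * C)"
    \<comment> \<open>The Picard operator halves distances weighted by \<open>exp (2 * C * r)\<close>.\<close>
    have step: "norm (Y (Suc n) r - Y n r) \<le> D * (1/2) ^ n * exp (2 * C * r)" if "r \<in> {0..t}" for n r
      using that
    proof (induction n arbitrary: r)
      case 0
      have "norm (integral {0..r} (\<lambda>s. H s x)) \<le> integral {0..r} (\<lambda>s. b)"
        using 0 b set_lebesgue_integral_eq_integral(1)[OF int[of "\<lambda>_. x" r]]
        by (intro integral_norm_bound_integral) auto
      also have "\<dots> = D * (2 * C * r)"
        using 0 C by (simp add: D_def)
      also have "\<dots> \<le> D * exp (2 * C * r)"
      proof (rule mult_left_mono)
        show "2 * C * r \<le> exp (2 * C * r)"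
          using exp_ge_add_one_self[of "2 * C * r"] by linarith
      qed (use b0 C in \<open>auto simp: D_def\<close>)
      finally show ?case
        using 0 by (simp add: Y_Suc Y_0 P_def)
    next
      case (Suc n)
      have i: "(\<lambda>s. H s (Y n s)) integrable_on {0..r}" for n
        by (intro set_lebesgue_integral_eq_integral(1) int Ym)
      have e: "((\<lambda>s. exp (2 * C * s)) has_integral (exp (2 * C * r) / (2 * C) - exp (2 * C * 0) / (2 * C))) {0..r}"
        using Suc.prems C
        by (intro fundamental_theorem_of_calculus)
           (auto intro!: derivative_eq_intros simp: has_real_derivative_iff_has_vector_derivative[symmetric])
      have "norm (Y (Suc (Suc n)) r - Y (Suc n) r) = norm (integral {0..r} (\<lambda>s. H s (Y (Suc n) s) - H s (Y n s)))"
      proof -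
        have "Y (Suc m) r = x + integral {0..r} (\<lambda>s. H s (Y m s))" for m
          by (simp add: Y_Suc P_def)
        then show ?thesis
          using integral_diff[OF i[of "Suc n"] i[of n]] by simp
      qed
      also have "\<dots> \<le> integral {0..r} (\<lambda>s. C * (D * (1/2) ^ n * exp (2 * C * s)))"
      proof (rule integral_norm_bound_integral)
        show "(\<lambda>s. C * (D * (1/2) ^ n * exp (2 * C * s))) integrable_on {0..r}"
          by (intro integrable_continuous_interval continuous_intros)
        fix s assume s: "s \<in> {0..r}"
        have "norm (H s (Y (Suc n) s) - H s (Y n s)) \<le> C * norm (Y (Suc n) s - Y n s)"
          using C(2) s Suc.prems by auto
        also have "\<dots> \<le> C * (D * (1/2) ^ n * exp (2 * C * s))"
          using C(1) Suc.IH[of s] s Suc.prems by (intro mult_left_mono) auto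
        finally show "norm (H s (Y (Suc n) s) - H s (Y n s)) \<le> C * (D * (1/2) ^ n * exp (2 * C * s))" .
      qed (use i in \<open>auto intro!: integrable_diff\<close>)
      also have "\<dots> = C * D * (1/2) ^ n * ((exp (2 * C * r) - 1) / (2 * C))"
        using integral_unique[OF e] by (simp add: diff_divide_distrib)
      also have "\<dots> = D * (1/2) ^ Suc n * (exp (2 * C * r) - 1)"
        using C by simp
      also have "\<dots> \<le> D * (1/2) ^ Suc n * exp (2 * C * r)"
        using b0 C by (intro mult_left_mono) (auto simp: D_def)
      finally show ?case .
    qed
    have "summable (\<lambda>n. Y (Suc n) t - Y n t)"
    proof (rule summable_comparison_test)
      show "\<exists>N. \<forall>n\<ge>N. norm (Y (Suc n) t - Y n t) \<le> D * exp (2 * C * t) * (1/2) ^ n"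
        using step[of t] t by (auto simp: mult_ac)
    qed (auto intro!: summable_mult summable_geometric)
    then have "(\<lambda>n. \<Sum>i<n. Y (Suc i) t - Y i t) \<longlonglongrightarrow> (\<Sum>n. Y (Suc n) t - Y n t)"
      by (rule summable_LIMSEQ)
    moreover have "(\<Sum>i<n. Y (Suc i) t - Y i t) = Y n t - Y 0 t" for n
      by (rule sum_lessThan_telescope)
    ultimately have "(\<lambda>n. Y n t - Y 0 t) \<longlonglongrightarrow> (\<Sum>n. Y (Suc n) t - Y n t)"
      by simp
    from tendsto_add[OF this tendsto_const[of "Y 0 t"]] show ?thesis
      by auto
  qed
  then obtain y where y: "\<And>t. t \<ge> 0 \<Longrightarrow> (\<lambda>n. Y n t) \<longlonglongrightarrow> y t"
    by metis
  have ym: "y \<in> borel_measurable (lebesgue_on {0..})"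
    by (rule borel_measurable_LIMSEQ_metric[OF Ym]) (use y in auto)
  have "y t = P y t" if t: "t \<ge> 0" for t
  proof -
    obtain b where b: "\<forall>s\<in>{0..t}. \<forall>z. norm (H s z) \<le> b"
      using bound by blast
    have "(\<lambda>n. integral {0..t} (\<lambda>s. H s (Y n s))) \<longlonglongrightarrow> integral {0..t} (\<lambda>s. H s (y s))"
    proof (rule dominated_convergence(2))
      show "(\<lambda>s. H s (Y n s)) integrable_on {0..t}" for n
        by (intro set_lebesgue_integral_eq_integral(1) int Ym)
      show "(\<lambda>_. b) integrable_on {0..t}"
        by (rule integrable_const_ivl)
      fix s assume s: "s \<in> {0..t}"
      show "(\<lambda>n. H s (Y n s)) \<longlonglongrightarrow> H s (y s)"
        by (rule continuous_on_tendsto_compose[OF cont y]) (use s in auto)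
    qed (use b in auto)
    then have "(\<lambda>n. Y (Suc n) t) \<longlonglongrightarrow> P y t"
      unfolding Y_Suc P_def by (intro tendsto_intros)
    then show ?thesis
      using y[OF t] LIMSEQ_unique LIMSEQ_Suc by blast
  qed
  then have "solves H x y"
    using int[OF ym] by (auto simp: solves_alt P_def)
  then show ?thesis by blast
qed

context lipschitz_field
begin

text \<open>The state is truncated at the radius \<open>R s\<close> given by the a priori growth bound: the truncated field is
  globally Lipschitz on bounded times, and its solution never feels the truncation.\<close>

lemma solution_exists: "\<exists>y. solves G x y"
proof -
  define R where "R s = (1 + norm x) * exp (B * s)" for s
  have R_pos: "R s > 0" for s
    by (simp add: R_def add_pos_nonneg)
  have R_mono: "R s \<le> R t" if "s \<le> t" for s t
    using that B_pos by (simp add: R_def add_pos_nonneg)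
  have cR: "continuous_on S R" for S
    unfolding R_def by (intro continuous_intros)
  \<comment> \<open>\<open>P s\<close> projects onto the ball of radius \<open>R s\<close>. Writing
    it as a rescaled projection onto the unit ball makes its dependence on \<open>s\<close> visibly
    continuous, so that the truncated field is measurable in time.\<close>
  define c where "c z = closest_point (cball 0 1) (z :: 'x)" for z
  define P where "P s z = R s *\<^sub>R c (inverse (R s) *\<^sub>R z)" for s z
  have c_in: "norm (c z) \<le> 1" for z
    using closest_point_in_set[of "cball 0 1 :: 'x set" z] by (auto simp: c_def)
  have c_lip: "norm (c z1 - c z2) \<le> norm (z1 - z2)" for z1 z2
    using closest_point_lipschitz[of "cball 0 1 :: 'x set" z1 z2] by (auto simp: c_def dist_norm)
  have c_cont: "continuous_on UNIV c"
    unfolding c_def[abs_def] by (intro continuous_on_closest_point) auto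
  have P_norm: "norm (P s z) \<le> R s" for s z
    using mult_left_le[OF c_in, of "R s"] R_pos[of s] by (simp add: P_def less_imp_le)
  have P_lip: "norm (P s z1 - P s z2) \<le> norm (z1 - z2)" for s z1 z2
  proof -
    have "norm (P s z1 - P s z2) = R s * norm (c (inverse (R s) *\<^sub>R z1) - c (inverse (R s) *\<^sub>R z2))"
      using R_pos[of s] by (simp add: P_def scaleR_diff_right[symmetric])
    also have "\<dots> \<le> R s * norm (inverse (R s) *\<^sub>R z1 - inverse (R s) *\<^sub>R z2)"
      using R_pos[of s] by (intro mult_left_mono c_lip) auto
    also have "\<dots> = norm (z1 - z2)"
      using R_pos[of s] by (simp add: scaleR_diff_right[symmetric])
    finally show ?thesis .
  qed
  \<comment> \<open>Truncation does not lengthen vectors, so the truncated field inherits the linear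
    growth bound; this is what keeps its solution within the radius \<open>R\<close>.\<close>
  have P_le: "norm (P s z) \<le> norm z" for s z
  proof -
    have "c 0 = 0"
      unfolding c_def by (rule closest_point_self) auto
    then show ?thesis
      using P_lip[of s z 0] by (simp add: P_def)
  qed
  have P_id: "P s z = z" if "norm z \<le> R s" for s z
  proof -
    have "c (inverse (R s) *\<^sub>R z) = inverse (R s) *\<^sub>R z"
      unfolding c_def using that R_pos[of s] by (intro closest_point_self) (auto simp: field_simps)
    then show ?thesis
      using R_pos[of s] by (simp add: P_def)
  qed
  have "\<exists>y. solves (\<lambda>s z. G s (P s z)) x y"
  proof (rule picard_global)
    fix z
    have "continuous_on {0..} (\<lambda>s. P s z)"
      unfolding P_def using R_pos
      by (intro continuous_intros cR continuous_on_compose2[OF c_cont]) (auto simp: less_imp_neq[symmetric])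
    then show "(\<lambda>s. G s (P s z)) \<in> borel_measurable (lebesgue_on {0..})"
      by (intro borel_measurable_caratheodory[where g=G and y="\<lambda>s. P s z"] measurable_field
          borel_measurable_lebesgue_on_continuous continuous_field) auto
  next
    fix T
    have "norm (G s (P s z)) \<le> B * (1 + R T)" if "s \<in> {0..T}" for s z
    proof -
      have "norm (G s (P s z)) \<le> B * (1 + norm (P s z))"
        using growth that by auto
      also have "\<dots> \<le> B * (1 + R T)"
        using B_pos P_norm[of s z] R_mono[of s T] that by (intro mult_left_mono) auto
      finally show ?thesis .
    qed
    then show "\<exists>b. \<forall>s\<in>{0..T}. \<forall>z. norm (G s (P s z)) \<le> b" by blast
  next
    fix T
    obtain C where C: "C \<ge> 0" "\<forall>s\<ge>0. \<forall>x y. norm x \<le> R T \<longrightarrow> norm y \<le> R T \<longrightarrow>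
      norm (G s x - G s y) \<le> C * norm (x - y)"
      using lipschitz[OF R_pos] by blast
    \<comment> \<open>\<open>C\<close> may vanish, while \<open>picard_global\<close> divides by its
      constant; hence \<open>C + 1\<close>.\<close>
    have "norm (G s (P s z1) - G s (P s z2)) \<le> (C + 1) * norm (z1 - z2)" if s: "s \<in> {0..T}" for s z1 z2
    proof -
      have "norm (G s (P s z1) - G s (P s z2)) \<le> C * norm (P s z1 - P s z2)"
        using C(2) s P_norm R_mono[of s T] by (meson atLeastAtMost_iff order_trans)
      also have "\<dots> \<le> (C + 1) * norm (z1 - z2)"
        using C(1) P_lip[of s z1 z2] by (intro mult_mono) auto
      finally show ?thesis .
    qed
    then show "\<exists>C>0. \<forall>s\<in>{0..T}. \<forall>z1 z2. norm (G s (P s z1) - G s (P s z2)) \<le> C * norm (z1 - z2)"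
      using C(1) by (intro exI[of _ "C+1"]) auto
  qed
  then obtain y where y: "solves (\<lambda>s z. G s (P s z)) x y" ..
  have "norm (y t) \<le> R t" if t: "t \<ge> 0" for t
  proof -
    have "1 + norm (y t) \<le> (1 + norm x) * exp (B * t)"
    proof (rule linear_growth_bound[of t "\<lambda>s. G s (P s (y s))"])
      fix s assume s: "s \<in> {0..t}"
      have "norm (G s (P s (y s))) \<le> B * (1 + norm (P s (y s)))"
        using growth s by auto
      also have "\<dots> \<le> B * (1 + norm (y s))"
        using B_pos P_le by (intro mult_left_mono) auto
      finally show "norm (G s (P s (y s))) \<le> B * (1 + norm (y s))" .
    qed (use y B_pos t in \<open>auto simp: solves_alt\<close>)
    then show ?thesis
      by (simp add: R_def)
  qed
  then have *: "G s (P s (y s)) = G s (y s)" if "s \<ge> 0" for s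
    using P_id that by simp
  have "solves G x y"
    unfolding solves_alt
  proof (intro allI impI)
    fix t :: real assume t: "t \<ge> 0"
    have "set_integrable lebesgue {0..t} (\<lambda>s. G s (P s (y s))) = set_integrable lebesgue {0..t} (\<lambda>s. G s (y s))"
      by (rule set_integrable_cong) (use * in auto)
    moreover have "integral {0..t} (\<lambda>s. G s (P s (y s))) = integral {0..t} (\<lambda>s. G s (y s))"
      by (rule integral_cong) (use * in auto)
    ultimately show "(\<lambda>s. G s (y s)) absolutely_integrable_on {0..t} \<and> y t = x + integral {0..t} (\<lambda>s. G s (y s))"
      using y t by (simp add: solves_alt)
  qed
  then show ?thesis by blast
qed

lemma trajectory_solves: "solves G x (trajectory G x)"
  unfolding trajectory_def using solution_exists by (rule someI_ex)

lemma trajectory_unique: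
  assumes "solves G x y" "0 \<le> t"
  shows "trajectory G x t = y t"
  using solves_upto_unique[of t x y G "trajectory G x" "{}" t] assms trajectory_solves[of x]
  by (simp add: solves_iff_upto)

lemma trajectory_continuous: "continuous_on {0..} (trajectory G x)"
  using trajectory_solves by (rule solves_continuous)

lemma trajectory_bound: "0 \<le> t \<Longrightarrow> norm (trajectory G x t) \<le> (1 + norm x) * exp (B * t)"
  using solves_upto_bound[of t x "trajectory G x" t] trajectory_solves[of x]
  by (simp add: solves_iff_upto)

lemma trajectory_eq:
  assumes "0 \<le> t"
  shows "trajectory G x t = x + integral {0..t} (\<lambda>s. G s (trajectory G x s))"
  using trajectory_solves assms by (simp add: solves_alt)

text \<open>The constant depends on the control only through \<open>B\<close>, which makes the
  trajectories of any sequence of controls equi-Lipschitz on bounded intervals.\<close>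

lemma trajectory_lipschitz:
  assumes "0 \<le> r" "r \<le> s" "s \<le> T"
  shows "norm (trajectory G x s - trajectory G x r) \<le> B * (1 + (1 + norm x) * exp (B * T)) * (s - r)"
proof -
  let ?g = "\<lambda>s. G s (trajectory G x s)"
  have i: "?g integrable_on {0..s}"
    by (rule set_lebesgue_integral_eq_integral(1))
       (use trajectory_solves[of x] assms in \<open>auto simp: solves_alt\<close>)
  have "trajectory G x s - trajectory G x r = integral {r..s} ?g"
    using trajectory_eq[of r x] trajectory_eq[of s x] assms
      Henstock_Kurzweil_Integration.integral_combine[of 0 r s ?g] i
    by (simp add: algebra_simps)
  moreover have "norm (integral {r..s} ?g) \<le> integral {r..s} (\<lambda>_. B * (1 + (1 + norm x) * exp (B * T)))"
  proof (rule integral_norm_bound_integral)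
    show "?g integrable_on {r..s}"
      by (rule integrable_subinterval_real[OF i]) (use assms in auto)
    fix u assume u: "u \<in> {r..s}"
    have "norm (?g u) \<le> B * (1 + norm (trajectory G x u))"
      using growth u assms by auto
    also have "norm (trajectory G x u) \<le> (1 + norm x) * exp (B * u)"
      using trajectory_bound u assms by auto
    also have "(1 + norm x) * exp (B * u) \<le> (1 + norm x) * exp (B * T)"
      using u assms B_pos by (intro mult_left_mono) auto
    finally show "norm (?g u) \<le> B * (1 + (1 + norm x) * exp (B * T))"
      using B_pos by simp
  qed (rule integrable_const_ivl)
  ultimately show ?thesis
    using assms by (simp add: mult_ac)
qed

end

section \<open>Almost everywhere convergent convex combinations\<close>

text \<open>Dyadic convex combinations of the tail of \<open>g\<close> from \<open>N\<close> on.
  Generating them by midpoints reduces the transfer of measurability, convex constraints and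
  integral bounds to two cases, with no weights to handle.\<close>

inductive_set midpoint_hull :: "(nat \<Rightarrow> 's \<Rightarrow> 'e::real_vector) \<Rightarrow> nat \<Rightarrow> ('s \<Rightarrow> 'e) set" for g N where
  base: "N \<le> k \<Longrightarrow> g k \<in> midpoint_hull g N"
| mid: "u \<in> midpoint_hull g N \<Longrightarrow> v \<in> midpoint_hull g N \<Longrightarrow>
    (\<lambda>s. (1/2) *\<^sub>R (u s + v s)) \<in> midpoint_hull g N"

lemma midpoint_hull_antimono:
  assumes "N \<le> M" "u \<in> midpoint_hull g M"
  shows "u \<in> midpoint_hull g N"
  using assms(2) by induction (use assms(1) in \<open>auto intro: midpoint_hull.intros\<close>)

lemma midpoint_hull_convex:
  assumes "u \<in> midpoint_hull g N" "convex C" "\<And>k. N \<le> k \<Longrightarrow> g k s \<in> C"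
  shows "u s \<in> C"
  using assms(1)
proof induction
  case (mid u v)
  then have "(1/2) *\<^sub>R u s + (1/2) *\<^sub>R v s \<in> C"
    by (intro convexD[OF assms(2)]) auto
  then show ?case by (simp add: scaleR_add_right)
qed (use assms(3) in auto)

lemma midpoint_hull_measurable:
  fixes g :: "nat \<Rightarrow> 's \<Rightarrow> 'e::euclidean_space"
  assumes "u \<in> midpoint_hull g N" "\<And>k. g k \<in> borel_measurable M"
  shows "u \<in> borel_measurable M"
  using assms(1)
proof induction
  case (mid u v)
  then show ?case by measurable
qed (use assms(2) in auto)

lemma parallelogram:
  fixes u v :: "'e::real_inner"
  shows "norm (u - v) ^ 2 = 2 * norm u ^ 2 + 2 * norm v ^ 2 - 4 * norm ((1/2) *\<^sub>R (u + v)) ^ 2"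
  by (simp add: power2_norm_eq_inner inner_simps inner_commute algebra_simps)

text \<open>Mazur's lemma without weak compactness: near-minimizers of a weighted \<open>L\<^sup>2\<close> norm over the decreasing
  tail hulls are a Cauchy sequence by the parallelogram law, for which midpoints are enough.\<close>

lemma mazur_AE:
  fixes g :: "nat \<Rightarrow> 's \<Rightarrow> 'e::euclidean_space"
  assumes M: "sigma_finite_measure M"
    and g [measurable]: "\<And>n. g n \<in> borel_measurable M"
    and bdd: "\<And>s. s \<in> space M \<Longrightarrow> \<exists>b. \<forall>n. norm (g n s) \<le> b"
  obtains h where "\<And>n. h n \<in> midpoint_hull g n" "AE s in M. convergent (\<lambda>n. h n s)"
proof -
  interpret sigma_finite_measure M by (rule M)
  obtain f :: "'s \<Rightarrow> real" where f [measurable]: "f \<in> borel_measurable M" and f01: "\<And>x. 0 < f x" "\<And>x. f x \<le> 1"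
    and f_int: "integrable M f"
    using obtain_positive_integrable_function by blast
  define S where "S s = (SUP n. norm (g n s))" for s
  have bddS: "bdd_above (range (\<lambda>n. norm (g n s)))" if "s \<in> space M" for s
    using bdd[OF that] by (auto simp: bdd_above_def)
  have S [measurable]: "S \<in> borel_measurable M"
    unfolding S_def by (rule borel_measurable_cSUP) (use bddS in auto)
  have gS: "norm (g n s) \<le> S s" if "s \<in> space M" for n s
    unfolding S_def by (rule cSUP_upper[OF _ bddS[OF that]]) auto
  \<comment> \<open>The positive integrable \<open>f\<close> deals with the infinite measure, the
    denominator with the pointwise bound \<open>S\<close>, which may be unbounded in
    \<open>s\<close>. Together they give \<open>\<omega> * norm u ^ 2 \<le> f\<close> for every
    combination \<open>u\<close>.\<close>
  define \<omega> where "\<omega> s = f s / (1 + (S s)\<^sup>2)" for s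
  have \<omega> [measurable]: "\<omega> \<in> borel_measurable M"
    unfolding \<omega>_def by measurable
  have den: "1 + (S s)\<^sup>2 > 0" for s
    by (simp add: add_pos_nonneg)
  have \<omega>_pos: "\<omega> s > 0" for s
    using f01 den by (simp add: \<omega>_def)
  have hull_meas: "u \<in> borel_measurable M" if "u \<in> midpoint_hull g n" for u n
    using that g by (rule midpoint_hull_measurable)
  have hull_le: "norm (u s) \<le> S s" if "u \<in> midpoint_hull g n" "s \<in> space M" for u n s
    using midpoint_hull_convex[OF that(1) convex_cball[of 0 "S s"]] gS that(2) by auto
  have \<omega>_le: "\<omega> s * norm v ^ 2 \<le> f s" if "norm v \<le> S s" for v :: 'e and s
  proof -
    have "\<omega> s * norm v ^ 2 \<le> \<omega> s * (1 + (S s)\<^sup>2)"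
      using power_mono[OF that norm_ge_zero, of 2] \<omega>_pos[of s] by (intro mult_left_mono) auto
    also have "\<dots> = f s"
      using den[of s] by (simp add: \<omega>_def)
    finally show ?thesis .
  qed
  have int: "integrable M (\<lambda>s. \<omega> s * norm (u s) ^ 2)" if u: "u \<in> midpoint_hull g n" for u n
  proof (rule Bochner_Integration.integrable_bound[OF f_int])
    have [measurable]: "u \<in> borel_measurable M"
      using u by (rule hull_meas)
    show "(\<lambda>s. \<omega> s * norm (u s) ^ 2) \<in> borel_measurable M"
      by measurable
    show "AE s in M. norm (\<omega> s * norm (u s) ^ 2) \<le> norm (f s)"
      using \<omega>_le[OF hull_le[OF u]] \<omega>_pos f01 by (auto simp: less_imp_le)
  qed
  define I where "I u = (\<integral>s. \<omega> s * norm (u s) ^ 2 \<partial>M)" for u :: "'s \<Rightarrow> 'e"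
  have I_nonneg: "I u \<ge> 0" for u
    unfolding I_def using \<omega>_pos by (intro Bochner_Integration.integral_nonneg) (simp add: less_imp_le)
  define d where "d N = Inf (I ` midpoint_hull g N)" for N
  have bdd_below: "bdd_below (I ` midpoint_hull g N)" for N
    using I_nonneg by (auto intro!: bdd_belowI[of _ 0])
  have ne: "I ` midpoint_hull g N \<noteq> {}" for N
    using midpoint_hull.base[of N N g] by auto
  have d_le: "d N \<le> I u" if "u \<in> midpoint_hull g N" for u N
    unfolding d_def using that bdd_below by (intro cInf_lower) auto
  have d_mono: "d N \<le> d N'" if "N \<le> N'" for N N'
    unfolding d_def using that
    by (intro cInf_superset_mono[OF ne bdd_below]) (auto intro: midpoint_hull_antimono)
  have d_bdd: "d N \<le> integral\<^sup>L M f" for N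
  proof -
    have u: "g N \<in> midpoint_hull g N" by (rule midpoint_hull.base) simp
    have "I (g N) \<le> integral\<^sup>L M f"
      unfolding I_def by (intro integral_mono int[OF u] f_int \<omega>_le gS)
    then show ?thesis
      using d_le[OF u] by simp
  qed
  obtain L where L: "d \<longlonglongrightarrow> L" and dL: "\<And>N. d N \<le> L"
  proof (rule incseq_convergent[of d "integral\<^sup>L M f"])
    show "incseq d" using d_mono by (auto simp: incseq_def)
  qed (use d_bdd in auto)
  have "\<exists>u. u \<in> midpoint_hull g N \<and> I u \<le> d N + 1 / Suc N" for N
  proof -
    have "\<exists>v\<in>I ` midpoint_hull g N. v < d N + 1 / Suc N"
      unfolding d_def by (rule cInf_lessD[OF ne]) simp
    then show ?thesis by force
  qed
  then obtain h0 where h0: "\<And>N. h0 N \<in> midpoint_hull g N" "\<And>N. I (h0 N) \<le> d N + 1 / Suc N"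
    by metis
  \<comment> \<open>For \<open>N \<le> N'\<close> the midpoint of \<open>h0 N\<close> and
    \<open>h0 N'\<close> lies in the hull of index \<open>N\<close>, so the parallelogram law bounds
    their squared distance by
    \<open>2 * (d N + 1 / Suc N) + 2 * (d N' + 1 / Suc N') - 4 * d N\<close>. Using
    \<open>d N' \<le> L\<close> gives \<open>\<eta> N\<close>.\<close>
  define \<eta> where "\<eta> N = 2 * (L - d N) + 4 * (1 / Suc N)" for N
  have diff_int: "integrable M (\<lambda>s. \<omega> s * norm (h0 N s - h0 N' s) ^ 2)"
    and diff_le: "N \<le> N' \<Longrightarrow> (\<integral>s. \<omega> s * norm (h0 N s - h0 N' s) ^ 2 \<partial>M) \<le> \<eta> N" for N N'
  proof -
    let ?m = "\<lambda>s. (1/2) *\<^sub>R (h0 N s + h0 N' s)"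
    have m: "?m \<in> midpoint_hull g (min N N')"
      by (intro midpoint_hull.mid midpoint_hull_antimono[OF _ h0(1)]) auto
    have eq: "\<omega> s * norm (h0 N s - h0 N' s) ^ 2 =
        2 * (\<omega> s * norm (h0 N s) ^ 2) + 2 * (\<omega> s * norm (h0 N' s) ^ 2) - 4 * (\<omega> s * norm (?m s) ^ 2)" for s
      unfolding parallelogram[of "h0 N s" "h0 N' s"] by (simp add: algebra_simps)
    note i = int[OF h0(1)[of N]] int[OF h0(1)[of N']] int[OF m]
    show "integrable M (\<lambda>s. \<omega> s * norm (h0 N s - h0 N' s) ^ 2)"
      unfolding eq using i
      by (intro Bochner_Integration.integrable_diff Bochner_Integration.integrable_add integrable_mult_right) auto
    assume le: "N \<le> N'"
    have "(\<integral>s. \<omega> s * norm (h0 N s - h0 N' s) ^ 2 \<partial>M) = 2 * I (h0 N) + 2 * I (h0 N') - 4 * I ?m"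
      unfolding eq I_def using i by simp
    moreover have "d N \<le> I ?m"
      using d_le[OF m] le by (simp add: min_def)
    moreover have "1 / real (Suc N') \<le> 1 / real (Suc N)"
      using le by (intro divide_left_mono) auto
    ultimately show "(\<integral>s. \<omega> s * norm (h0 N s - h0 N' s) ^ 2 \<partial>M) \<le> \<eta> N"
      using h0(2)[of N] h0(2)[of N'] dL[of N'] by (simp add: \<eta>_def)
  qed
  have "\<eta> \<longlonglongrightarrow> 2 * (L - L) + 4 * 0"
    unfolding \<eta>_def by (intro tendsto_intros L LIMSEQ_Suc[OF lim_const_over_n])
  then have "\<exists>n. \<forall>N\<ge>n. \<eta> N < (1/4) ^ j" for j :: nat
    using order_tendstoD(2)[of \<eta> 0 sequentially "(1/4) ^ j"] by (simp add: eventually_sequentially)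
  then obtain \<rho> where \<rho>: "\<And>j N. \<rho> j \<le> N \<Longrightarrow> \<eta> N < (1/4) ^ j"
    by metis
  \<comment> \<open>Summing makes the indices monotone and at least \<open>\<rho> j\<close>; the
    summand \<open>j\<close> makes \<open>r j \<ge> j\<close>, so that \<open>h j\<close> belongs to
    the hull of index \<open>j\<close>.\<close>
  define r where "r j = j + (\<Sum>i\<le>j. \<rho> i)" for j
  have r: "\<rho> j \<le> r j" "j \<le> r j" "r j \<le> r (Suc j)" for j
    using member_le_sum[of j "{..j}" \<rho>] by (auto simp: r_def)
  define h where "h j = h0 (r j)" for j
  have hm [measurable]: "h j \<in> borel_measurable M" for j
    unfolding h_def using h0(1) by (rule hull_meas)
  \<comment> \<open>The factor \<open>2 ^ j\<close> is paid for by the bound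
    \<open>(1/4) ^ j\<close> on the integrals. Where the series is finite, the increments of
    \<open>h\<close> are dominated by a geometric sequence of ratio
    \<open>sqrt (1/2)\<close>.\<close>
  let ?a = "\<lambda>j s. 2 ^ j * (\<omega> s * norm (h j s - h (Suc j) s) ^ 2)"
  have "(\<integral>\<^sup>+s. (\<Sum>j. ennreal (?a j s)) \<partial>M) = (\<Sum>j. \<integral>\<^sup>+s. ennreal (?a j s) \<partial>M)"
    by (rule nn_integral_suminf) measurable
  also have "\<dots> \<le> (\<Sum>j. ennreal ((1/2) ^ j))"
  proof (rule suminf_le)
    fix j
    have "(\<integral>\<^sup>+s. ennreal (?a j s) \<partial>M) = ennreal (\<integral>s. ?a j s \<partial>M)"
      unfolding h_def using diff_int \<omega>_pos
      by (intro nn_integral_eq_integral integrable_mult_right AE_I2) (auto simp: less_imp_le)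
    also have "(\<integral>s. ?a j s \<partial>M) = 2 ^ j * (\<integral>s. \<omega> s * norm (h j s - h (Suc j) s) ^ 2 \<partial>M)"
      by simp
    also have "\<dots> \<le> 2 ^ j * (1/4) ^ j"
      using diff_le[OF r(3)[of j]] \<rho>[OF r(1)[of j]] by (intro mult_left_mono) (auto simp: h_def)
    also have "\<dots> = (1/2) ^ j"
      by (simp add: power_mult_distrib[symmetric])
    finally show "(\<integral>\<^sup>+s. ennreal (?a j s) \<partial>M) \<le> ennreal ((1/2) ^ j)"
      by (simp add: ennreal_leI)
  qed auto
  also have "\<dots> < \<infinity>"
    by (subst suminf_ennreal2) (auto simp: summable_geometric)
  finally have "AE s in M. (\<Sum>j. ennreal (?a j s)) \<noteq> \<infinity>"
    by (intro nn_integral_noteq_infinite) auto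
  then have "AE s in M. convergent (\<lambda>n. h n s)"
  proof (rule AE_mp, intro AE_I2 impI)
    fix s assume s: "s \<in> space M" and fin: "(\<Sum>j. ennreal (?a j s)) \<noteq> \<infinity>"
    define c where "c = enn2real (\<Sum>j. ennreal (?a j s))"
    have ac: "?a j s \<le> c" for j
    proof -
      have "ennreal (?a j s) \<le> (\<Sum>j. ennreal (?a j s))"
        using sum_le_suminf[of "\<lambda>j. ennreal (?a j s)" "{j}"] by auto
      also have "\<dots> = ennreal c"
        using fin by (simp add: c_def less_top)
      finally show ?thesis
        by (subst (asm) ennreal_le_iff) (simp_all add: c_def)
    qed
    have bound: "norm (h (Suc j) s - h j s) \<le> sqrt (c / \<omega> s) * sqrt (1/2) ^ j" for j
    proof -
      have "norm (h (Suc j) s - h j s) ^ 2 \<le> c / \<omega> s * (1/2) ^ j"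
        using ac[of j] \<omega>_pos[of s] by (simp add: field_simps norm_minus_commute power_one_over)
      then have "sqrt (norm (h (Suc j) s - h j s) ^ 2) \<le> sqrt (c / \<omega> s * (1/2) ^ j)"
        by (rule real_sqrt_le_mono)
      then show ?thesis
        by (simp add: real_sqrt_mult[symmetric] real_sqrt_power[symmetric])
    qed
    have "summable (\<lambda>j. h (Suc j) s - h j s)"
    proof (rule summable_comparison_test)
      show "\<exists>N. \<forall>n\<ge>N. norm (h (Suc n) s - h n s) \<le> sqrt (c / \<omega> s) * sqrt (1/2) ^ n"
        using bound by blast
      show "summable (\<lambda>n. sqrt (c / \<omega> s) * sqrt (1/2) ^ n)"
        by (intro summable_mult summable_geometric) (simp add: real_sqrt_divide)
    qed
    then have "(\<lambda>n. \<Sum>i<n. h (Suc i) s - h i s) \<longlonglongrightarrow> (\<Sum>j. h (Suc j) s - h j s)"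
      by (rule summable_LIMSEQ)
    moreover have "(\<Sum>i<n. h (Suc i) s - h i s) = h n s - h 0 s" for n
      by (rule sum_lessThan_telescope)
    ultimately have "(\<lambda>n. h n s - h 0 s) \<longlonglongrightarrow> (\<Sum>j. h (Suc j) s - h j s)"
      by simp
    from tendsto_add[OF this tendsto_const[of "h 0 s"]] show "convergent (\<lambda>n. h n s)"
      by (auto simp: convergent_def)
  qed
  moreover have "h n \<in> midpoint_hull g n" for n
    unfolding h_def by (rule midpoint_hull_antimono[OF r(2) h0(1)])
  ultimately show ?thesis
    using that by blast
qed

section \<open>Measurable selection of relaxed controls\<close>

text \<open>\<open>c s\<close> is the least \<open>b\<close>-coordinate on the compact zero set of
  \<open>\<Psi> s\<close>. It is at most \<open>y\<close> exactly when the infimum of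
  \<open>\<Psi> s\<close> over the compact slice of \<open>Z\<close> below \<open>y\<close> is zero,
  and by continuity a countable dense subset of the slice detects this.\<close>

lemma measurable_argmin_coordinate:
  fixes \<Psi> :: "'s \<Rightarrow> 'z::euclidean_space \<Rightarrow> real"
  assumes Z: "compact Z"
    and meas: "\<And>z. z \<in> Z \<Longrightarrow> (\<lambda>s. \<Psi> s z) \<in> borel_measurable M"
    and cont: "\<And>s. s \<in> space M \<Longrightarrow> continuous_on Z (\<Psi> s)"
    and nonneg: "\<And>s z. s \<in> space M \<Longrightarrow> z \<in> Z \<Longrightarrow> 0 \<le> \<Psi> s z"
    and zero: "\<And>s. s \<in> space M \<Longrightarrow> \<exists>z\<in>Z. \<Psi> s z = 0"
  obtains c :: "'s \<Rightarrow> real" where "c \<in> borel_measurable M"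
    "\<And>s. s \<in> space M \<Longrightarrow> \<exists>z\<in>Z. \<Psi> s z = 0 \<and> z \<bullet> b = c s"
proof -
  define N where "N s = {z \<in> Z. \<Psi> s z = 0}" for s
  have N: "compact (N s)" "N s \<noteq> {}" if "s \<in> space M" for s
  proof -
    have "closed (Z \<inter> \<Psi> s -` {0})"
      using that by (intro continuous_closed_preimage cont compact_imp_closed Z) auto
    moreover have "N s = Z \<inter> (Z \<inter> \<Psi> s -` {0})"
      by (auto simp: N_def)
    ultimately show "compact (N s)"
      using Z compact_Int_closed by metis
    show "N s \<noteq> {}"
      using zero[OF that] by (auto simp: N_def)
  qed
  have "\<exists>z\<in>N s. \<forall>z'\<in>N s. z \<bullet> b \<le> z' \<bullet> b" if "s \<in> space M" for s
    using N[OF that] by (intro continuous_attains_inf continuous_intros) auto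
  then obtain m where m: "\<And>s. s \<in> space M \<Longrightarrow> m s \<in> N s"
    "\<And>s z'. s \<in> space M \<Longrightarrow> z' \<in> N s \<Longrightarrow> m s \<bullet> b \<le> z' \<bullet> b"
    by metis
  have "(\<lambda>s. m s \<bullet> b) \<in> borel_measurable M"
  proof (rule borel_measurableI_le)
    fix y
    define Y where "Y = Z \<inter> {z. z \<bullet> b \<le> y}"
    have Y: "compact Y"
      unfolding Y_def by (intro compact_Int_closed Z closed_Collect_le continuous_intros)
    obtain D where D: "countable D" "D \<subseteq> Y" "Y \<subseteq> closure D"
      using separable by blast
    have "m s \<bullet> b \<le> y \<longleftrightarrow> (\<forall>k::nat. \<exists>d\<in>D. \<Psi> s d < 1 / Suc k)" if s: "s \<in> space M" for s
    proof
      assume "m s \<bullet> b \<le> y"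
      then have mY: "m s \<in> Y" "\<Psi> s (m s) = 0"
        using m(1)[OF s] by (auto simp: N_def Y_def)
      then have "m s \<in> closure D"
        using D(3) by blast
      then obtain d where d: "\<And>n::nat. d n \<in> D" "d \<longlonglongrightarrow> m s"
        unfolding closure_sequential by blast
      have dZ: "d n \<in> Z" for n
        using d(1) D(2) by (auto simp: Y_def)
      have "(\<lambda>n. \<Psi> s (d n)) \<longlonglongrightarrow> \<Psi> s (m s)"
        by (rule continuous_on_tendsto_compose[OF cont[OF s] d(2)])
           (use mY dZ in \<open>auto simp: Y_def\<close>)
      then have "\<forall>\<^sub>F n in sequentially. \<Psi> s (d n) < 1 / Suc k" for k :: nat
        using mY by (intro order_tendstoD(2)) auto
      then show "\<forall>k::nat. \<exists>d\<in>D. \<Psi> s d < 1 / Suc k"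
        using d(1) eventually_happens'[OF sequentially_bot] by blast
    next
      assume *: "\<forall>k::nat. \<exists>d\<in>D. \<Psi> s d < 1 / Suc k"
      then have "Y \<noteq> {}"
        using D(2) by blast
      moreover have cY: "continuous_on Y (\<Psi> s)"
        using cont[OF s] by (rule continuous_on_subset) (auto simp: Y_def)
      ultimately obtain z where z: "z \<in> Y" "\<And>z'. z' \<in> Y \<Longrightarrow> \<Psi> s z \<le> \<Psi> s z'"
        using continuous_attains_inf[OF Y, of "\<Psi> s"] by blast
      have "\<Psi> s z \<le> 1 / Suc k" for k
        using * D(2) z(2) by (meson less_imp_le order_trans subsetD)
      then have "\<Psi> s z \<le> 0"
        using LIMSEQ_le_const[OF LIMSEQ_Suc[OF lim_const_over_n[of 1]], of "\<Psi> s z"] by auto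
      then have "z \<in> N s"
        using z(1) nonneg[OF s, of z] by (auto simp: N_def Y_def)
      then show "m s \<bullet> b \<le> y"
        using m(2)[OF s] z(1) by (fastforce simp: Y_def)
    qed
    then have "{s \<in> space M. m s \<bullet> b \<le> y} = {s \<in> space M. \<forall>k::nat. \<exists>d\<in>D. \<Psi> s d < 1 / Suc k}"
      by blast
    also have "\<dots> \<in> sets M"
    proof -
      have "(\<lambda>s. \<Psi> s d) \<in> borel_measurable M" if "d \<in> D" for d
        using meas D(2) that by (auto simp: Y_def)
      then show ?thesis
        using D(1) by (intro sets.sets_Collect_countable_All sets.sets_Collect_countable_Bex) auto
    qed
    finally show "{s \<in> space M. m s \<bullet> b \<le> y} \<in> sets M" .
  qed
  then show ?thesis
    using m(1) by (intro that[of "\<lambda>s. m s \<bullet> b"]) (auto simp: N_def)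
qed

text \<open>The selection is the lexicographically least zero, computed one coordinate at a time.\<close>

lemma measurable_selection:
  fixes \<Psi> :: "'s \<Rightarrow> 'z::euclidean_space \<Rightarrow> real"
  assumes Z: "compact Z"
    and meas: "\<And>z. z \<in> Z \<Longrightarrow> (\<lambda>s. \<Psi> s z) \<in> borel_measurable M"
    and cont: "\<And>s. s \<in> space M \<Longrightarrow> continuous_on Z (\<Psi> s)"
    and nonneg: "\<And>s z. s \<in> space M \<Longrightarrow> z \<in> Z \<Longrightarrow> 0 \<le> \<Psi> s z"
    and zero: "\<And>s. s \<in> space M \<Longrightarrow> \<exists>z\<in>Z. \<Psi> s z = 0"
  obtains \<zeta> where "\<zeta> \<in> borel_measurable M"
    "\<And>s. s \<in> space M \<Longrightarrow> \<zeta> s \<in> Z \<and> \<Psi> s (\<zeta> s) = 0"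
proof -
  have "\<exists>c. (\<forall>b\<in>B. c b \<in> borel_measurable M) \<and>
      (\<forall>s\<in>space M. \<exists>z\<in>Z. \<Psi> s z = 0 \<and> (\<forall>b\<in>B. z \<bullet> b = c b s))"
    if "finite B" for B :: "'z set"
    using that
  proof induction
    case empty
    then show ?case using zero by auto
  next
    case (insert b B)
    then obtain c where c: "\<And>b. b \<in> B \<Longrightarrow> c b \<in> borel_measurable M"
      "\<And>s. s \<in> space M \<Longrightarrow> \<exists>z\<in>Z. \<Psi> s z = 0 \<and> (\<forall>b\<in>B. z \<bullet> b = c b s)"
      by blast
    \<comment> \<open>The penalty pins the coordinates chosen so far. Since \<Theta> is again
      nonnegative, measurable in \<open>s\<close> and continuous in \<open>z\<close>, with zeros at
      all times, the next coordinate can be minimized over its zeros.\<close>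
    define \<Theta> where "\<Theta> s z = \<Psi> s z + (\<Sum>b\<in>B. \<bar>z \<bullet> b - c b s\<bar>)" for s z
    have iff: "\<Theta> s z = 0 \<longleftrightarrow> \<Psi> s z = 0 \<and> (\<forall>b\<in>B. z \<bullet> b = c b s)"
      if "s \<in> space M" "z \<in> Z" for s z
    proof -
      have "(\<Sum>b\<in>B. \<bar>z \<bullet> b - c b s\<bar>) \<ge> 0"
        by (intro sum_nonneg) auto
      then have "\<Theta> s z = 0 \<longleftrightarrow> \<Psi> s z = 0 \<and> (\<Sum>b\<in>B. \<bar>z \<bullet> b - c b s\<bar>) = 0"
        unfolding \<Theta>_def using nonneg[OF that] by (intro add_nonneg_eq_0_iff)
      then show ?thesis
        using insert.hyps by (simp add: sum_nonneg_eq_0_iff)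
    qed
    have "\<exists>z\<in>Z. \<Theta> s z = 0" if "s \<in> space M" for s
      using c(2)[OF that] iff[OF that] by blast
    moreover have "(\<lambda>s. \<Theta> s z) \<in> borel_measurable M" if "z \<in> Z" for z
      unfolding \<Theta>_def using c(1) meas[OF that] by measurable
    moreover have "continuous_on Z (\<Theta> s)" if "s \<in> space M" for s
      unfolding \<Theta>_def using cont[OF that] by (intro continuous_intros)
    moreover have "\<Theta> s z \<ge> 0" if "s \<in> space M" "z \<in> Z" for s z
      unfolding \<Theta>_def using nonneg[OF that] by (intro add_nonneg_nonneg sum_nonneg) auto
    ultimately obtain c' where c': "c' \<in> borel_measurable M"
      "\<And>s. s \<in> space M \<Longrightarrow> \<exists>z\<in>Z. \<Theta> s z = 0 \<and> z \<bullet> b = c' s"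
      using measurable_argmin_coordinate[OF Z, of \<Theta> M b] by blast
    show ?case
    proof (intro exI[of _ "c(b := c')"] conjI ballI)
      fix s assume s: "s \<in> space M"
      then obtain z where z: "z \<in> Z" "\<Theta> s z = 0" "z \<bullet> b = c' s"
        using c'(2) by blast
      then show "\<exists>z\<in>Z. \<Psi> s z = 0 \<and> (\<forall>ba\<in>insert b B. z \<bullet> ba = (c(b := c')) ba s)"
        using iff[OF s z(1)] insert.hyps by (intro bexI[of _ z]) auto
    qed (use c(1) c'(1) in auto)
  qed
  from this[OF finite_Basis] obtain c where c: "\<And>b. b \<in> Basis \<Longrightarrow> c b \<in> borel_measurable M"
    "\<And>s. s \<in> space M \<Longrightarrow> \<exists>z\<in>Z. \<Psi> s z = 0 \<and> (\<forall>b\<in>Basis. z \<bullet> b = c b s)"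
    by blast
  show ?thesis
  proof (rule that[of "\<lambda>s. \<Sum>b\<in>Basis. c b s *\<^sub>R b"])
    show "(\<lambda>s. \<Sum>b\<in>Basis. c b s *\<^sub>R b) \<in> borel_measurable M"
      using c(1) by (intro borel_measurable_sum borel_measurable_scaleR) auto
    fix s assume "s \<in> space M"
    then obtain z where z: "z \<in> Z" "\<Psi> s z = 0" "\<forall>b\<in>Basis. z \<bullet> b = c b s"
      using c(2) by blast
    have "(\<Sum>b\<in>Basis. c b s *\<^sub>R b) = (\<Sum>b\<in>Basis. (z \<bullet> b) *\<^sub>R b)"
      using z(3) by (intro sum.cong) auto
    then have "(\<Sum>b\<in>Basis. c b s *\<^sub>R b) = z"
      by (simp add: euclidean_representation)
    then show "(\<Sum>b\<in>Basis. c b s *\<^sub>R b) \<in> Z \<and> \<Psi> s (\<Sum>b\<in>Basis. c b s *\<^sub>R b) = 0"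
      using z by simp
  qed
qed

text \<open>A hyperplane strictly separating the mean from \<open>C\<close> would, after
  integration, separate the mean from itself.\<close>

lemma mean_in_closed_convex:
  fixes X :: "'s \<Rightarrow> 'b::euclidean_space"
  assumes "prob_space M" "integrable M X" "closed C" "convex C"
    and mem: "\<And>s. s \<in> space M \<Longrightarrow> X s \<in> C"
  shows "(LINT s|M. X s) \<in> C"
proof (rule ccontr)
  interpret prob_space M by fact
  assume "(LINT s|M. X s) \<notin> C"
  then obtain a b where ab: "a \<bullet> (LINT s|M. X s) < b" "\<And>x. x \<in> C \<Longrightarrow> b < a \<bullet> x"
    using separating_hyperplane_closed_point[OF assms(4,3)] by blast
  have "b = (LINT s|M. b)"
    by (simp add: prob_space)
  also have "\<dots> \<le> (LINT s|M. a \<bullet> X s)"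
    using assms(2) ab(2) mem by (intro integral_mono integrable_inner_right) (auto simp: less_imp_le)
  also have "\<dots> = a \<bullet> (LINT s|M. X s)"
    using assms(2) by (intro integral_inner_right) auto
  finally show False
    using ab(1) by simp
qed

section \<open>Integrals against relaxed controls and finitely supported measures\<close>

lemma radon_prob_integrable:
  fixes \<phi> :: "'a::euclidean_space \<Rightarrow> 'b::euclidean_space"
  assumes \<mu>: "\<mu> \<in> radon_prob K" and K: "compact K" and \<phi>: "continuous_on K \<phi>"
  shows "integrable \<mu> \<phi>"
proof -
  interpret prob_space \<mu> using \<mu> by (simp add: radon_prob_def)
  have sets: "sets \<mu> = sets (restrict_space borel K)"
    using \<mu> by (simp add: radon_prob_def)
  have space: "space \<mu> = K"
    using sets_eq_imp_space_eq[OF sets] by (simp add: space_restrict_space)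
  obtain b where "\<And>a. a \<in> K \<Longrightarrow> norm (\<phi> a) \<le> b"
    using compact_imp_bounded[OF compact_continuous_image[OF \<phi> K]] by (auto simp: bounded_iff)
  moreover have "\<phi> \<in> borel_measurable \<mu>"
    using borel_measurable_continuous_on_restrict[OF \<phi>] measurable_cong_sets[OF sets refl] by blast
  ultimately show ?thesis
    by (intro integrable_const_bound[of _ b]) (auto simp: space)
qed

lemma space_radon_prob: "\<mu> \<in> radon_prob K \<Longrightarrow> space \<mu> = K"
  using sets_eq_imp_space_eq[of \<mu> "restrict_space borel K"] by (simp add: radon_prob_def space_restrict_space)

lemma radon_prob_mean:
  fixes \<phi> :: "'a::euclidean_space \<Rightarrow> 'b::euclidean_space"
  assumes "\<mu> \<in> radon_prob K" "compact K" "continuous_on K \<phi>"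
  shows "(LINT a|\<mu>. \<phi> a) \<in> convex hull (\<phi> ` K)"
proof (rule mean_in_closed_convex)
  show "closed (convex hull (\<phi> ` K))"
    using assms by (intro compact_imp_closed compact_convex_hull compact_continuous_image)
  show "prob_space \<mu>"
    using assms(1) by (simp add: radon_prob_def)
  show "\<phi> a \<in> convex hull (\<phi> ` K)" if "a \<in> space \<mu>" for a
    using that space_radon_prob[OF assms(1)] by (auto intro: hull_inc)
qed (use assms radon_prob_integrable in auto)

lemma relaxed_controls_radon:
  assumes "\<mu> \<in> relaxed_controls K" "0 \<le> s"
  shows "\<mu> s \<in> radon_prob K"
proof -
  have "{U. openin (weak_star K) U} \<subseteq> Pow (radon_prob K)"
    using openin_subset topspace_weak_star by blast
  then have "space (sigma (radon_prob K) {U. openin (weak_star K) U}) = radon_prob K"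
    by simp
  then show ?thesis
    using measurable_space[OF assms(1)[unfolded relaxed_controls_def], of s] assms(2) by simp
qed

text \<open>The sets defined by a real test function are open in the weak-star topology, which gives
  measurability of the integrals; vector-valued functions are treated coordinatewise. Apart from
  membership in \<open>radon_prob K\<close>, this is all that is used of a given relaxed
  control.\<close>

lemma relaxed_controls_measurable:
  fixes \<phi> :: "'a::euclidean_space \<Rightarrow> 'b::euclidean_space"
  assumes \<mu>: "\<mu> \<in> relaxed_controls K" and K: "compact K" and \<phi>: "continuous_on K \<phi>"
  shows "(\<lambda>s. LINT a|\<mu> s. \<phi> a) \<in> borel_measurable (lebesgue_on {0..})"
proof -
  have sub: "{U. openin (weak_star K) U} \<subseteq> Pow (radon_prob K)"
    using openin_subset topspace_weak_star by blast
  have real: "(\<lambda>s. LINT a|\<mu> s. \<psi> a) \<in> borel_measurable (lebesgue_on {0..})"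
    if \<psi>: "continuous_on K \<psi>" for \<psi> :: "'a \<Rightarrow> real"
  proof (rule borel_measurableI)
    fix V :: "real set" assume "open V"
    then have "openin (weak_star K) {\<mu> \<in> radon_prob K. (LINT a|\<mu>. \<psi> a) \<in> V}"
      unfolding weak_star_def using \<psi> by (intro topology_generated_by_Basis) blast
    then have "{\<mu> \<in> radon_prob K. (LINT a|\<mu>. \<psi> a) \<in> V} \<in> sets (sigma (radon_prob K) {U. openin (weak_star K) U})"
      using sub by (auto intro: sigma_sets.Basic)
    from measurable_sets[OF \<mu>[unfolded relaxed_controls_def] this]
    have "\<mu> -` {\<mu> \<in> radon_prob K. (LINT a|\<mu>. \<psi> a) \<in> V} \<inter> space (lebesgue_on {0..}) \<in> sets (lebesgue_on {0..})" .
    also have "\<mu> -` {\<mu> \<in> radon_prob K. (LINT a|\<mu>. \<psi> a) \<in> V} \<inter> space (lebesgue_on {0..}) =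
        (\<lambda>s. LINT a|\<mu> s. \<psi> a) -` V \<inter> space (lebesgue_on {0..})"
      using relaxed_controls_radon[OF \<mu>] by auto
    finally show "(\<lambda>s. LINT a|\<mu> s. \<psi> a) -` V \<inter> space (lebesgue_on {0..}) \<in> sets (lebesgue_on {0..})" .
  qed
  show ?thesis
  proof (rule borel_measurable_euclidean_space[THEN iffD2], rule ballI)
    fix b :: 'b assume "b \<in> Basis"
    have "(\<lambda>s. LINT a|\<mu> s. \<phi> a \<bullet> b) \<in> borel_measurable (lebesgue_on {0..})"
      by (intro real continuous_intros \<phi>)
    moreover have "(LINT a|\<mu> s. \<phi> a \<bullet> b) = (LINT a|\<mu> s. \<phi> a) \<bullet> b" if "0 \<le> s" for s
      using radon_prob_integrable[OF relaxed_controls_radon[OF \<mu> that] K \<phi>]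
      by (intro integral_inner_left) auto
    ultimately show "(\<lambda>s. (LINT a|\<mu> s. \<phi> a) \<bullet> b) \<in> borel_measurable (lebesgue_on {0..})"
      by (subst measurable_cong[where g="\<lambda>s. LINT a|\<mu> s. \<phi> a \<bullet> b"]) auto
  qed
qed

text \<open>The entry \<open>z $ i\<close> is a weight together with its atom. Indexing by a finite
  type places the tuples in a Euclidean space, where selection is available; several indices may
  carry the same atom, and their weights then add up.\<close>

definition atomic_measure :: "'a::euclidean_space set \<Rightarrow> (real \<times> 'a) ^ 'i::finite \<Rightarrow> 'a measure"
  where "atomic_measure K z =
    distr (point_measure UNIV (\<lambda>i. ennreal (fst (z $ i)))) (restrict_space borel K) (\<lambda>i. snd (z $ i))"

definition weighted_tuples :: "'a::euclidean_space set \<Rightarrow> ((real \<times> 'a) ^ 'i::finite) set"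
  where "weighted_tuples K = {z. (\<forall>i. 0 \<le> fst (z $ i) \<and> snd (z $ i) \<in> K) \<and> (\<Sum>i\<in>UNIV. fst (z $ i)) = 1}"

lemma compact_weighted_tuples:
  assumes K: "compact K"
  shows "compact (weighted_tuples K :: ((real \<times> 'a::euclidean_space) ^ 'i::finite) set)"
proof -
  obtain b where b: "\<And>a. a \<in> K \<Longrightarrow> norm a \<le> b"
    using compact_imp_bounded[OF K] by (auto simp: bounded_iff)
  have "norm z \<le> (\<Sum>i\<in>(UNIV::'i set). 1 + b)" if z: "z \<in> weighted_tuples K" for z :: "(real \<times> 'a) ^ 'i"
  proof -
    have "norm z \<le> (\<Sum>i\<in>UNIV. norm (z $ i))"
      unfolding norm_vec_def by (rule L2_set_le_sum) auto
    also have "\<dots> \<le> (\<Sum>i\<in>(UNIV::'i set). 1 + b)"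
    proof (rule sum_mono)
      fix i
      have "fst (z $ i) \<le> (\<Sum>i\<in>UNIV. fst (z $ i))"
        using z by (intro member_le_sum) (auto simp: weighted_tuples_def)
      then have "norm (fst (z $ i)) \<le> 1"
        using z by (auto simp: weighted_tuples_def)
      moreover have "norm (snd (z $ i)) \<le> b"
        using z b by (auto simp: weighted_tuples_def)
      moreover have "norm (z $ i) \<le> norm (fst (z $ i)) + norm (snd (z $ i))"
        using norm_Pair_le[of "fst (z $ i)" "snd (z $ i)"] by simp
      ultimately show "norm (z $ i) \<le> 1 + b"
        by linarith
    qed
    finally show ?thesis .
  qed
  then have "bounded (weighted_tuples K :: ((real \<times> 'a) ^ 'i) set)"
    unfolding bounded_iff by blast
  moreover have "closed (weighted_tuples K :: ((real \<times> 'a) ^ 'i) set)"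
  proof -
    have "closed ((\<lambda>z :: (real \<times> 'a) ^ 'i. snd (z $ i)) -` K)" for i
      using K by (intro closed_vimage compact_imp_closed continuous_intros)
    moreover have "(weighted_tuples K :: ((real \<times> 'a) ^ 'i) set) =
        (\<Inter>i. {z. 0 \<le> fst (z $ i)} \<inter> ((\<lambda>z. snd (z $ i)) -` K)) \<inter> {z. (\<Sum>i\<in>UNIV. fst (z $ i)) = 1}"
      by (auto simp: weighted_tuples_def)
    ultimately show ?thesis
      using compact_imp_closed[OF K]
      by (auto intro!: closed_Int closed_INT closed_Collect_le closed_Collect_eq continuous_intros)
  qed
  ultimately show ?thesis
    by (simp add: compact_eq_bounded_closed)
qed

lemma atomic_measure_radon:
  fixes z :: "(real \<times> 'a::euclidean_space) ^ 'i::finite"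
  assumes "z \<in> weighted_tuples K"
  shows "atomic_measure K z \<in> radon_prob K"
proof -
  have "prob_space (point_measure UNIV (\<lambda>i. ennreal (fst (z $ i))))"
    using assms by (intro prob_space_point_measure)
       (auto simp: weighted_tuples_def sum_ennreal)
  moreover have "(\<lambda>i. snd (z $ i)) \<in> measurable (point_measure UNIV (\<lambda>i. ennreal (fst (z $ i)))) (restrict_space borel K)"
    using assms by (auto simp: weighted_tuples_def space_restrict_space)
  ultimately show ?thesis
    unfolding radon_prob_def atomic_measure_def by (auto intro: prob_space.prob_space_distr)
qed

lemma integral_atomic_measure:
  fixes \<phi> :: "'a::euclidean_space \<Rightarrow> 'b::euclidean_space" and z :: "(real \<times> 'a) ^ 'i::finite"
  assumes z: "z \<in> weighted_tuples K" and \<phi>: "continuous_on K \<phi>"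
  shows "(LINT a|atomic_measure K z. \<phi> a) = (\<Sum>i\<in>UNIV. fst (z $ i) *\<^sub>R \<phi> (snd (z $ i)))"
proof -
  have "(LINT a|atomic_measure K z. \<phi> a) = (LINT i|point_measure UNIV (\<lambda>i. ennreal (fst (z $ i))). \<phi> (snd (z $ i)))"
    unfolding atomic_measure_def using z
    by (intro integral_distr borel_measurable_continuous_on_restrict[OF \<phi>])
       (auto simp: weighted_tuples_def space_restrict_space)
  also have "\<dots> = (\<Sum>i\<in>UNIV. fst (z $ i) *\<^sub>R \<phi> (snd (z $ i)))"
    using z by (subst lebesgue_integral_point_measure_finite) (auto simp: weighted_tuples_def)
  finally show ?thesis .
qed

text \<open>On the generating sets of the topology, preimages are preimages under the continuous
  finite sum of \<open>integral_atomic_measure\<close>. As every weak-star open set is thus pulled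
  back to a relatively open one, a measurable map into tuples yields a relaxed control.\<close>

lemma continuous_map_atomic_measure:
  "continuous_map (top_of_set (weighted_tuples K :: ((real \<times> 'a::euclidean_space) ^ 'i::finite) set))
     (weak_star K) (atomic_measure K)"
  unfolding weak_star_def
proof (rule continuous_on_generated_topo)
  let ?Z = "weighted_tuples K :: ((real \<times> 'a) ^ 'i) set"
  let ?S = "{{\<mu> \<in> radon_prob K. (LINT a|\<mu>. \<phi> a) \<in> U} | (\<phi> :: 'a \<Rightarrow> real) U. continuous_on K \<phi> \<and> open U}"
  have "\<Union>?S = radon_prob K"
    using topspace_weak_star[of K] unfolding weak_star_def topology_generated_by_topspace .
  then show "atomic_measure K ` topspace (top_of_set ?Z) \<subseteq> \<Union>?S"
    using atomic_measure_radon by auto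
  fix W assume "W \<in> ?S"
  then obtain \<phi> :: "'a \<Rightarrow> real" and U where W: "W = {\<mu> \<in> radon_prob K. (LINT a|\<mu>. \<phi> a) \<in> U}"
    and \<phi>: "continuous_on K \<phi>" and U: "open U"
    by blast
  have "continuous_on ?Z (\<lambda>z. \<Sum>i\<in>UNIV. fst (z $ i) *\<^sub>R \<phi> (snd (z $ i)))"
    by (intro continuous_intros continuous_on_compose2[OF \<phi>]) (auto simp: weighted_tuples_def)
  then have "openin (top_of_set ?Z) (?Z \<inter> (\<lambda>z. \<Sum>i\<in>UNIV. fst (z $ i) *\<^sub>R \<phi> (snd (z $ i))) -` U)"
    using U by (rule continuous_openin_preimage_gen)
  moreover have "?Z \<inter> (\<lambda>z. \<Sum>i\<in>UNIV. fst (z $ i) *\<^sub>R \<phi> (snd (z $ i))) -` U =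
      atomic_measure K -` W \<inter> topspace (top_of_set ?Z)"
    using atomic_measure_radon[where 'i='i] integral_atomic_measure[where 'i='i, OF _ \<phi>]
    by (auto simp: W)
  ultimately show "openin (top_of_set ?Z) (atomic_measure K -` W \<inter> topspace (top_of_set ?Z))"
    by simp
qed

text \<open>Caratheodory's theorem needs at most \<open>DIM('e) + 1\<close> points, which inject
  into \<open>'i\<close>; the surplus indices get weight zero at an arbitrary point
  \<open>a0\<close> of \<open>K\<close>.\<close>

lemma convex_hull_weighted_tuple:
  fixes g :: "'a::euclidean_space \<Rightarrow> 'e::euclidean_space"
  assumes card: "DIM('e) < CARD('i::finite)" and v: "v \<in> convex hull (g ` K)"
  shows "\<exists>z\<in>(weighted_tuples K :: ((real \<times> 'a) ^ 'i) set).
    (\<Sum>i\<in>UNIV. fst (z $ i) *\<^sub>R g (snd (z $ i))) = v"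
proof -
  obtain S u where S: "finite S" "S \<subseteq> g ` K" "card S \<le> DIM('e) + 1"
    and u: "\<forall>x\<in>S. 0 \<le> u x" "sum u S = 1" "(\<Sum>x\<in>S. u x *\<^sub>R x) = v"
    using v unfolding convex_hull_caratheodory by blast
  obtain e :: "'e \<Rightarrow> 'i" where e: "inj_on e S"
    using card_le_inj[of S "UNIV :: 'i set"] S card by auto
  have "\<exists>a\<in>K. g a = x" if "x \<in> S" for x
    using S(2) that by blast
  then obtain p where p: "\<And>x. x \<in> S \<Longrightarrow> p x \<in> K" "\<And>x. x \<in> S \<Longrightarrow> g (p x) = x"
    by metis
  have "K \<noteq> {}"
    using v by auto
  then obtain a0 where a0: "a0 \<in> K"
    by blast
  define z :: "(real \<times> 'a) ^ 'i" where
    "z = (\<chi> i. if i \<in> e ` S then (u (the_inv_into S e i), p (the_inv_into S e i)) else (0, a0))"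
  have z: "z $ e x = (u x, p x)" if "x \<in> S" for x
    using that e by (simp add: z_def the_inv_into_f_f)
  have z0: "z $ i = (0, a0)" if "i \<notin> e ` S" for i
    using that by (simp add: z_def)
  have sum: "(\<Sum>i\<in>UNIV. fst (z $ i) *\<^sub>R w (snd (z $ i))) = (\<Sum>x\<in>S. u x *\<^sub>R w (p x))"
    for w :: "'a \<Rightarrow> 'c::real_vector"
  proof -
    have "(\<Sum>i\<in>UNIV. fst (z $ i) *\<^sub>R w (snd (z $ i))) = (\<Sum>i\<in>e ` S. fst (z $ i) *\<^sub>R w (snd (z $ i)))"
      by (rule sum.mono_neutral_right) (auto simp: z0)
    also have "\<dots> = (\<Sum>x\<in>S. u x *\<^sub>R w (p x))"
      by (subst sum.reindex[OF e]) (simp add: z)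
    finally show ?thesis .
  qed
  have "z \<in> weighted_tuples K"
    unfolding weighted_tuples_def
  proof (intro CollectI conjI allI)
    fix i
    show "0 \<le> fst (z $ i)" "snd (z $ i) \<in> K"
      using z z0 u(1) p(1) a0 by (cases "i \<in> e ` S"; auto)+
    show "(\<Sum>i\<in>UNIV. fst (z $ i)) = 1"
      using sum[of "\<lambda>_. 1::real"] u(2) by simp
  qed
  moreover have "(\<Sum>i\<in>UNIV. fst (z $ i) *\<^sub>R g (snd (z $ i))) = v"
    unfolding sum using u(3) p(2) by simp
  ultimately show ?thesis by blast
qed

text \<open>By Caratheodory's theorem finitely many atoms, indexed by \<open>'i\<close>, realize any point of the hull, which
  reduces the selection of measures to a selection in a Euclidean space.\<close>

lemma relaxed_control_selection:
  fixes \<psi> :: "real \<Rightarrow> 'a::euclidean_space \<Rightarrow> 'e::euclidean_space" and h :: "real \<Rightarrow> 'e"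
  assumes card: "DIM('e) < CARD('i::finite)" and K: "compact K"
    and meas: "\<And>a. a \<in> K \<Longrightarrow> (\<lambda>s. \<psi> s a) \<in> borel_measurable (lebesgue_on {0..})"
    and cont: "\<And>s. 0 \<le> s \<Longrightarrow> continuous_on K (\<psi> s)"
    and h: "h \<in> borel_measurable (lebesgue_on {0..})"
    and hull: "\<And>s. 0 \<le> s \<Longrightarrow> h s \<in> convex hull (\<psi> s ` K)"
  obtains \<mu> where "\<mu> \<in> relaxed_controls K" "\<And>s. 0 \<le> s \<Longrightarrow> (LINT a|\<mu> s. \<psi> s a) = h s"
proof -
  let ?Z = "weighted_tuples K :: ((real \<times> 'a) ^ 'i) set"
  let ?M = "lebesgue_on {0..} :: real measure"
  \<comment> \<open>Its zeros are the tuples whose weighted mean of \<open>\<psi> s\<close> equals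
    \<open>h s\<close>.\<close>
  define \<Psi> where "\<Psi> s z = norm (h s - (\<Sum>i\<in>UNIV. fst (z $ i) *\<^sub>R \<psi> s (snd (z $ i))))"
    for s and z :: "(real \<times> 'a) ^ 'i"
  obtain \<zeta> where \<zeta>: "\<zeta> \<in> borel_measurable ?M" "\<And>s. s \<in> space ?M \<Longrightarrow> \<zeta> s \<in> ?Z \<and> \<Psi> s (\<zeta> s) = 0"
  proof (rule measurable_selection[of ?Z \<Psi> ?M])
    show "compact ?Z" using K by (rule compact_weighted_tuples)
    show "(\<lambda>s. \<Psi> s z) \<in> borel_measurable ?M" if "z \<in> ?Z" for z
    proof -
      have [measurable]: "(\<lambda>s. \<psi> s (snd (z $ i))) \<in> borel_measurable ?M" for i
        using that by (intro meas) (auto simp: weighted_tuples_def)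
      note h [measurable]
      show ?thesis
        unfolding \<Psi>_def by measurable
    qed
    show "continuous_on ?Z (\<Psi> s)" if "s \<in> space ?M" for s
      unfolding \<Psi>_def using that
      by (intro continuous_intros continuous_on_compose2[OF cont[of s]]) (auto simp: weighted_tuples_def)
    show "\<exists>z\<in>?Z. \<Psi> s z = 0" if s: "s \<in> space ?M" for s
    proof -
      obtain z where "z \<in> ?Z" "(\<Sum>i\<in>UNIV. fst (z $ i) *\<^sub>R \<psi> s (snd (z $ i))) = h s"
        using convex_hull_weighted_tuple[OF card hull[of s]] s by auto
      then show ?thesis
        by (intro bexI[of _ z]) (auto simp: \<Psi>_def)
    qed
  qed (auto simp: \<Psi>_def)
  define \<mu> where "\<mu> s = atomic_measure K (\<zeta> s)" for s
  have "\<mu> \<in> relaxed_controls K"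
    unfolding relaxed_controls_def
  proof (rule measurable_measure_of)
    show "{U. openin (weak_star K) U} \<subseteq> Pow (radon_prob K)"
      using openin_subset topspace_weak_star by blast
    show "\<mu> \<in> space ?M \<rightarrow> radon_prob K"
      using \<zeta>(2) by (auto simp: \<mu>_def intro!: atomic_measure_radon)
    fix U assume "U \<in> {U. openin (weak_star K) U}"
    then have "openin (top_of_set ?Z) {z \<in> topspace (top_of_set ?Z). atomic_measure K z \<in> U}"
      by (intro openin_continuous_map_preimage[OF continuous_map_atomic_measure]) auto
    then obtain T where T: "open T" "{z \<in> topspace (top_of_set ?Z). atomic_measure K z \<in> U} = ?Z \<inter> T"
      by (auto simp: openin_open)
    have "\<mu> -` U \<inter> space ?M = \<zeta> -` T \<inter> space ?M"
      using T(2) \<zeta>(2) by (auto simp: \<mu>_def)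
    also have "\<dots> \<in> sets ?M"
      using \<zeta>(1) T(1) by (intro measurable_sets) auto
    finally show "\<mu> -` U \<inter> space ?M \<in> sets ?M" .
  qed
  moreover have "(LINT a|\<mu> s. \<psi> s a) = h s" if "0 \<le> s" for s
    using \<zeta>(2)[of s] that integral_atomic_measure[OF _ cont[OF that], of "\<zeta> s"]
    by (auto simp: \<mu>_def \<Psi>_def)
  ultimately show ?thesis
    using that by blast
qed

section \<open>Approximation of relaxed by ordinary controls\<close>

lemma borel_measurable_continuous_pair:
  fixes \<Phi> :: "'x::euclidean_space \<Rightarrow> 'a::euclidean_space \<Rightarrow> 'b::euclidean_space"
  assumes \<Phi>: "continuous_on (UNIV \<times> K) (\<lambda>(x, a). \<Phi> x a)"
    and y: "y \<in> borel_measurable M" and w: "w \<in> borel_measurable M"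
    and K: "\<And>s. s \<in> space M \<Longrightarrow> w s \<in> K"
  shows "(\<lambda>s. \<Phi> (y s) (w s)) \<in> borel_measurable M"
proof -
  have "(\<lambda>s. (y s, w s)) \<in> measurable M (restrict_space borel (UNIV \<times> K))"
    using y w K by (intro measurable_restrict_space2) auto
  from measurable_compose[OF this borel_measurable_continuous_on_restrict[OF \<Phi>]]
  show ?thesis by simp
qed

lemma borel_measurable_lebesgue_on:
  assumes "w \<in> borel_measurable borel"
  shows "w \<in> borel_measurable (lebesgue_on S)"
  using assms by (intro measurable_restrict_space1 measurable_completion) auto

lemma continuous_on_section:
  assumes "continuous_on (UNIV \<times> K) (\<lambda>(x, a). \<Phi> x a)"
  shows "continuous_on K (\<Phi> x)"
proof -
  have "continuous_on K (\<lambda>a. (x, a))"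
    by (intro continuous_intros)
  from continuous_on_compose2[OF assms this] show ?thesis
    by auto
qed

lemma uniform_modulus:
  fixes \<Phi> :: "'x::euclidean_space \<Rightarrow> 'a::euclidean_space \<Rightarrow> 'b::euclidean_space"
  assumes "continuous_on (UNIV \<times> K) (\<lambda>(x, a). \<Phi> x a)" "compact K" "compact C" "e > 0"
  obtains d where "d > 0"
    "\<And>x y a. x \<in> C \<Longrightarrow> y \<in> C \<Longrightarrow> a \<in> K \<Longrightarrow> dist x y < d \<Longrightarrow> norm (\<Phi> x a - \<Phi> y a) < e"
proof -
  have "uniformly_continuous_on (C \<times> K) (\<lambda>(x, a). \<Phi> x a)"
    using assms by (intro compact_uniformly_continuous compact_Times) (auto intro: continuous_on_subset)
  then obtain d where "d > 0"
    "\<And>p p'. p \<in> C \<times> K \<Longrightarrow> p' \<in> C \<times> K \<Longrightarrow> dist p' p < d \<Longrightarrow>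
      dist (case p' of (x, a) \<Rightarrow> \<Phi> x a) (case p of (x, a) \<Rightarrow> \<Phi> x a) < e"
    using assms(4) unfolding uniformly_continuous_on_def by metis
  from this(1) this(2)[of "(y, a)" "(x, a)" for x y a] show ?thesis
    by (intro that[of d]) (auto simp: dist_Pair_Pair dist_norm)
qed

lemma bounded_on_compact:
  fixes \<Phi> :: "'x::euclidean_space \<Rightarrow> 'a::euclidean_space \<Rightarrow> 'b::euclidean_space"
  assumes "continuous_on (UNIV \<times> K) (\<lambda>(x, a). \<Phi> x a)" "compact K" "compact C"
  obtains b where "b > 0" "\<And>x a. x \<in> C \<Longrightarrow> a \<in> K \<Longrightarrow> norm (\<Phi> x a) \<le> b"
proof -
  have "bounded ((\<lambda>(x, a). \<Phi> x a) ` (C \<times> K))"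
    using assms by (intro compact_imp_bounded compact_continuous_image compact_Times)
      (auto intro: continuous_on_subset)
  then obtain b where "b > 0" "\<And>v. v \<in> (\<lambda>(x, a). \<Phi> x a) ` (C \<times> K) \<Longrightarrow> norm v \<le> b"
    by (meson bounded_pos)
  then show ?thesis
    by (intro that[of b]) auto
qed

lemma radon_prob_norm_mean_le:
  fixes \<phi> :: "'a::euclidean_space \<Rightarrow> 'b::euclidean_space"
  assumes \<mu>: "\<mu> \<in> radon_prob K" and K: "compact K" and \<phi>: "continuous_on K \<phi>"
    and le: "\<And>a. a \<in> K \<Longrightarrow> norm (\<phi> a) \<le> b"
  shows "norm (LINT a|\<mu>. \<phi> a) \<le> b"
proof -
  have "convex hull (\<phi> ` K) \<subseteq> cball 0 b"
    using le by (intro hull_minimal) auto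
  then show ?thesis
    using radon_prob_mean[OF \<mu> K \<phi>] by auto
qed

lemma radon_prob_mean_diff_le:
  fixes \<phi> \<psi> :: "'a::euclidean_space \<Rightarrow> 'b::euclidean_space"
  assumes \<mu>: "\<mu> \<in> radon_prob K" and K: "compact K" and \<phi>: "continuous_on K \<phi>" and \<psi>: "continuous_on K \<psi>"
    and le: "\<And>a. a \<in> K \<Longrightarrow> norm (\<phi> a - \<psi> a) \<le> b"
  shows "norm ((LINT a|\<mu>. \<phi> a) - (LINT a|\<mu>. \<psi> a)) \<le> b"
proof -
  have "(LINT a|\<mu>. \<phi> a) - (LINT a|\<mu>. \<psi> a) = (LINT a|\<mu>. \<phi> a - \<psi> a)"
    using radon_prob_integrable[OF \<mu> K] \<phi> \<psi> by (intro Bochner_Integration.integral_diff[symmetric]) auto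
  then show ?thesis
    using radon_prob_norm_mean_le[OF \<mu> K continuous_on_diff[OF \<phi> \<psi>] le] by simp
qed

lemma relax_continuous:
  fixes \<Phi> :: "'x::euclidean_space \<Rightarrow> 'a::euclidean_space \<Rightarrow> 'b::euclidean_space"
  assumes \<mu>: "\<mu> \<in> radon_prob K" and K: "compact K"
    and \<Phi>: "continuous_on (UNIV \<times> K) (\<lambda>(x, a). \<Phi> x a)"
  shows "continuous_on UNIV (\<lambda>x. relax \<Phi> x \<mu>)"
proof -
  have "\<exists>d>0. \<forall>y. dist y x < d \<longrightarrow> dist (relax \<Phi> y \<mu>) (relax \<Phi> x \<mu>) < e" if e: "e > 0" for x e
  proof -
    obtain d where d: "d > 0" "\<And>y z a. y \<in> cball x 1 \<Longrightarrow> z \<in> cball x 1 \<Longrightarrow> a \<in> K \<Longrightarrow> dist y z < d \<Longrightarrow>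
        norm (\<Phi> y a - \<Phi> z a) < e/2"
      using uniform_modulus[OF \<Phi> K compact_cball, of "e/2" x 1] e by auto
    have "dist (relax \<Phi> y \<mu>) (relax \<Phi> x \<mu>) < e" if "dist y x < min d 1" for y
    proof -
      have "norm (relax \<Phi> y \<mu> - relax \<Phi> x \<mu>) \<le> e/2"
        unfolding relax_def using that d(2)[of y x]
        by (intro radon_prob_mean_diff_le[OF \<mu> K] continuous_on_section[OF \<Phi>])
           (auto simp: dist_commute less_imp_le)
      then show ?thesis
        using e by (simp add: dist_norm)
    qed
    then show ?thesis
      using d(1) by (intro exI[of _ "min d 1"]) auto
  qed
  then show ?thesis
    unfolding continuous_on_iff by auto
qed

lemma relax_measurable:
  fixes \<Phi> :: "'x::euclidean_space \<Rightarrow> 'a::euclidean_space \<Rightarrow> 'b::euclidean_space"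
  assumes \<mu>: "\<mu> \<in> relaxed_controls K" and K: "compact K"
    and \<Phi>: "continuous_on (UNIV \<times> K) (\<lambda>(x, a). \<Phi> x a)"
    and y: "y \<in> borel_measurable (lebesgue_on {0..})"
  shows "(\<lambda>s. relax \<Phi> (y s) (\<mu> s)) \<in> borel_measurable (lebesgue_on {0..})"
proof (rule borel_measurable_caratheodory[where g="\<lambda>s z. relax \<Phi> z (\<mu> s)" and y=y])
  show "(\<lambda>s. relax \<Phi> z (\<mu> s)) \<in> borel_measurable (lebesgue_on {0..})" for z
    unfolding relax_def by (intro relaxed_controls_measurable[OF \<mu> K] continuous_on_section[OF \<Phi>])
  show "continuous_on UNIV (\<lambda>z. relax \<Phi> z (\<mu> s))" if "s \<in> space (lebesgue_on {0..})" for s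
    using that by (intro relax_continuous[OF relaxed_controls_radon[OF \<mu>] K \<Phi>]) auto
qed (rule y)

lemma average_in_closed_convex:
  fixes f :: "real \<Rightarrow> 'b::euclidean_space"
  assumes f: "f integrable_on {a..b}" and ab: "a < b" and C: "closed C" "convex C"
    and mem: "\<And>s. s \<in> {a..b} \<Longrightarrow> f s \<in> C"
  shows "inverse (b - a) *\<^sub>R integral {a..b} f \<in> C"
proof (rule ccontr)
  assume "inverse (b - a) *\<^sub>R integral {a..b} f \<notin> C"
  then obtain v c where vc: "v \<bullet> (inverse (b - a) *\<^sub>R integral {a..b} f) < c" "\<And>x. x \<in> C \<Longrightarrow> c < v \<bullet> x"
    using separating_hyperplane_closed_point[OF C(2,1)] by blast
  have *: "(\<lambda>s. f s \<bullet> v) integrable_on {a..b}"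
    using integrable_linear[OF f bounded_linear_inner_left] by (simp add: o_def)
  have "integral {a..b} (\<lambda>_. c) \<le> integral {a..b} (\<lambda>s. f s \<bullet> v)"
  proof (rule integral_le)
    show "c \<le> f s \<bullet> v" if "s \<in> {a..b}" for s
      using vc(2)[OF mem[OF that]] by (simp add: inner_commute)
  qed (use * in auto)
  also have "\<dots> = integral {a..b} f \<bullet> v"
    using integral_linear[OF f bounded_linear_inner_left, of v] by (simp add: o_def)
  finally have "(b - a) * c \<le> v \<bullet> integral {a..b} f"
    using ab by (simp add: inner_commute)
  with vc(1) ab show False
    by (simp add: field_simps)
qed

text \<open>\<open>V\<close> consists of the vectors that are averages of \<open>g\<close> along
  some control on every interval. It contains the image of \<open>P\<close> by constant controls,
  and it is convex: split the interval in the proportion of the two weights and use one control on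
  each piece. Quantifying over all intervals is what makes the pieces available.\<close>

lemma convex_hull_time_sharing:
  fixes g :: "'a::euclidean_space \<Rightarrow> 'b::euclidean_space"
  assumes "v \<in> convex hull (g ` P)" "a \<le> b"
  obtains w where "w \<in> borel_measurable borel" "\<And>s. w s \<in> P"
    "((\<lambda>s. g (w s)) has_integral (b - a) *\<^sub>R v) {a..b}"
proof -
  define V where "V = {v. \<forall>a b. a \<le> b \<longrightarrow> (\<exists>w\<in>borel_measurable borel. (\<forall>s. w s \<in> P) \<and>
      ((\<lambda>s. g (w s)) has_integral (b - a) *\<^sub>R v) {a..b})}"
  have "convex hull (g ` P) \<subseteq> V"
  proof (rule hull_minimal)
    show "g ` P \<subseteq> V"
    proof
      fix v assume "v \<in> g ` P"
      then obtain p where p: "p \<in> P" "v = g p" by blast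
      have "\<exists>w\<in>borel_measurable borel. (\<forall>s. w s \<in> P) \<and> ((\<lambda>s. g (w s)) has_integral (b - a) *\<^sub>R v) {a..b}"
        if "a \<le> b" for a b :: real
        using has_integral_const_real[of v a b] that p by (intro bexI[of _ "\<lambda>_. p"]) auto
      then show "v \<in> V" by (simp add: V_def)
    qed
    show "convex V"
    proof (rule convexI)
      fix v1 v2 and \<kappa> \<kappa>' :: real
      assume v: "v1 \<in> V" "v2 \<in> V" and \<kappa>: "0 \<le> \<kappa>" "0 \<le> \<kappa>'" "\<kappa> + \<kappa>' = 1"
      have "\<exists>w\<in>borel_measurable borel. (\<forall>s. w s \<in> P) \<and>
          ((\<lambda>s. g (w s)) has_integral (b - a) *\<^sub>R (\<kappa> *\<^sub>R v1 + \<kappa>' *\<^sub>R v2)) {a..b}"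
        if ab: "a \<le> b" for a b :: real
      proof -
        define c where "c = a + \<kappa> * (b - a)"
        have c: "a \<le> c" "c \<le> b" "c - a = (b - a) * \<kappa>" "b - c = (b - a) * \<kappa>'"
        proof -
          have k': "\<kappa>' = 1 - \<kappa>" using \<kappa> by simp
          show "c - a = (b - a) * \<kappa>" "b - c = (b - a) * \<kappa>'"
            by (simp_all add: c_def k' algebra_simps)
          then show "a \<le> c" "c \<le> b"
            using ab \<kappa> by (metis diff_ge_0_iff_ge mult_nonneg_nonneg)+
        qed
        obtain w1 where w1: "w1 \<in> borel_measurable borel" "\<And>s. w1 s \<in> P"
          "((\<lambda>s. g (w1 s)) has_integral (c - a) *\<^sub>R v1) {a..c}"
          using v(1) c(1) unfolding V_def by blast
        obtain w2 where w2: "w2 \<in> borel_measurable borel" "\<And>s. w2 s \<in> P"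
          "((\<lambda>s. g (w2 s)) has_integral (b - c) *\<^sub>R v2) {c..b}"
          using v(2) c(2) unfolding V_def by blast
        define w where "w s = (if s \<le> c then w1 s else w2 s)" for s
        have [measurable]: "w \<in> borel_measurable borel"
          unfolding w_def using w1(1) w2(1) by measurable
        have "((\<lambda>s. g (w s)) has_integral (c - a) *\<^sub>R v1) {a..c}"
          using w1(3) by (rule has_integral_eq[rotated]) (simp add: w_def)
        moreover have "((\<lambda>s. g (w s)) has_integral (b - c) *\<^sub>R v2) {c..b}"
          using w2(3) by (rule has_integral_spike_finite[of "{c}", rotated 2]) (auto simp: w_def)
        ultimately have "((\<lambda>s. g (w s)) has_integral (c - a) *\<^sub>R v1 + (b - c) *\<^sub>R v2) {a..b}"
          by (rule has_integral_combine[OF c(1,2)])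
        moreover have "(c - a) *\<^sub>R v1 + (b - c) *\<^sub>R v2 = (b - a) *\<^sub>R (\<kappa> *\<^sub>R v1 + \<kappa>' *\<^sub>R v2)"
          by (simp add: c scaleR_add_right)
        ultimately show ?thesis
          using w1(2) w2(2) by (intro bexI[of _ w]) (auto simp: w_def)
      qed
      then show "\<kappa> *\<^sub>R v1 + \<kappa>' *\<^sub>R v2 \<in> V" by (simp add: V_def)
    qed
  qed
  with assms show ?thesis
    using that unfolding V_def by blast
qed

lemma norm_integral_le:
  fixes f :: "real \<Rightarrow> 'b::euclidean_space"
  assumes "f integrable_on {a..b}" "a \<le> b" "\<And>s. s \<in> {a..b} \<Longrightarrow> norm (f s) \<le> B"
  shows "norm (integral {a..b} f) \<le> B * (b - a)"
proof -
  have "norm (f a) \<le> B"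
    using assms by simp
  then have "0 \<le> B"
    using norm_ge_zero[of "f a"] by linarith
  moreover have "(f has_integral integral {a..b} f) (cbox a b)"
    using assms(1) by (simp add: integrable_integral)
  ultimately have "norm (integral {a..b} f) \<le> B * measure lborel (cbox a b)"
    using assms(3) by (intro has_integral_bound) auto
  then show ?thesis
    using assms(2) by simp
qed

text \<open>On each cell of a fine time grid, \<open>w\<close> realizes the mean of the relaxed field at the left end point of
  the cell.\<close>

lemma chattering:
  fixes \<Phi> :: "'x::euclidean_space \<Rightarrow> 'a::euclidean_space \<Rightarrow> 'b::euclidean_space"
  assumes K: "compact K" and P: "P \<subseteq> K" "K \<subseteq> closure P"
    and \<Phi>: "continuous_on (UNIV \<times> K) (\<lambda>(x, a). \<Phi> x a)"
    and \<xi>: "continuous_on {0..} \<xi>" and \<mu>: "\<mu> \<in> relaxed_controls K"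
    and S: "S > 0" and \<epsilon>: "\<epsilon> > 0"
  obtains w where "w \<in> borel_measurable borel" "\<And>s. w s \<in> P"
    "\<And>t. t \<in> {0..S} \<Longrightarrow> norm (integral {0..t} (\<lambda>s. \<Phi> (\<xi> s) (w s) - relax \<Phi> (\<xi> s) (\<mu> s))) \<le> \<epsilon>"
proof -
  define h where "h s = relax \<Phi> (\<xi> s) (\<mu> s)" for s
  define C where "C = \<xi> ` {0..S}"
  have C: "compact C"
    unfolding C_def by (intro compact_continuous_image continuous_on_subset[OF \<xi>]) auto
  obtain B where B: "B > 0" "\<And>x a. x \<in> C \<Longrightarrow> a \<in> K \<Longrightarrow> norm (\<Phi> x a) \<le> B"
    using bounded_on_compact[OF \<Phi> K C] by blast
  \<comment> \<open>Each full cell will cost \<open>3 * e * \<eta>\<close>, hence all of them at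
    most \<open>3 * e * S = \<epsilon> / 2\<close>; the other half of \<epsilon> is kept for the
    incomplete last cell.\<close>
  define e where "e = \<epsilon> / (6 * S)"
  have e: "e > 0" using S \<epsilon> by (simp add: e_def)
  obtain d where d: "d > 0"
    "\<And>x y a. x \<in> C \<Longrightarrow> y \<in> C \<Longrightarrow> a \<in> K \<Longrightarrow> dist x y < d \<Longrightarrow> norm (\<Phi> x a - \<Phi> y a) < e"
    using uniform_modulus[OF \<Phi> K C e] by blast
  have "uniformly_continuous_on {0..S} \<xi>"
    by (intro compact_uniformly_continuous continuous_on_subset[OF \<xi>]) auto
  then obtain \<delta> where \<delta>: "\<delta> > 0"
    "\<And>s t. s \<in> {0..S} \<Longrightarrow> t \<in> {0..S} \<Longrightarrow> dist t s < \<delta> \<Longrightarrow> dist (\<xi> t) (\<xi> s) < d"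
    using d(1) unfolding uniformly_continuous_on_def by metis
  \<comment> \<open>A cell shorter than \<delta> lets \<xi> move by less than \<open>d\<close>; a
    cell shorter than \<open>\<epsilon> / (4 * B)\<close> contributes at most
    \<open>\<epsilon> / 2\<close>, because the integrand is bounded by \<open>2 * B\<close>.\<close>
  define r where "r = min \<delta> (\<epsilon> / (4 * B))"
  have r: "r > 0"
    using \<delta> \<epsilon> B by (auto simp: r_def)
  obtain n :: nat where n: "S / r < n"
    using reals_Archimedean2 by blast
  have n_pos: "n > 0"
    using n divide_pos_pos[OF S r] by (cases n) auto
  define \<eta> where "\<eta> = S / n"
  have \<eta>: "\<eta> > 0" "\<eta> * n = S"
    using S n_pos by (auto simp: \<eta>_def)
  have i\<eta>: "0 \<le> real i * \<eta>" for i
    using \<eta> by simp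
  have "\<eta> < r"
    using n r n_pos by (simp add: \<eta>_def divide_less_eq mult.commute)
  then have \<eta>_less: "\<eta> < \<delta>" "2 * B * \<eta> \<le> \<epsilon> / 2"
    using B by (auto simp: r_def field_simps)
  define x where "x i = \<xi> (i * \<eta>)" for i :: nat
  have grid: "{i * \<eta>..Suc i * \<eta>} \<subseteq> {0..S}" if "i < n" for i
  proof -
    have "real (Suc i) * \<eta> \<le> n * \<eta>"
      using that \<eta> by (intro mult_right_mono) auto
    then have "Suc i * \<eta> \<le> S"
      using \<eta>(2) by (simp add: mult.commute)
    then show ?thesis
      using i\<eta>[of i] unfolding atLeastatMost_subset_iff by blast
  qed
  have xC: "x i \<in> C" if "i < n" for i
  proof -
    have "i * \<eta> \<in> {i * \<eta>..Suc i * \<eta>}"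
      using \<eta> by auto
    then show ?thesis
      unfolding x_def C_def using grid[OF that] by blast
  qed
  have near: "dist (\<xi> s) (x i) < d" if "i < n" "s \<in> {i * \<eta>..Suc i * \<eta>}" for i s
    unfolding x_def
  proof (rule \<delta>(2))
    have "i * \<eta> \<in> {i * \<eta>..Suc i * \<eta>}"
      using \<eta> by auto
    then show "i * \<eta> \<in> {0..S}" "s \<in> {0..S}"
      using grid[OF that(1)] that(2) by blast+
    show "dist s (i * \<eta>) < \<delta>"
      using that(2) \<eta>_less by (auto simp: dist_real_def algebra_simps)
  qed
  have \<xi>_meas: "\<xi> \<in> borel_measurable (lebesgue_on {0..})"
    using \<xi> by (rule borel_measurable_lebesgue_on_continuous)
  have h_meas: "h \<in> borel_measurable (lebesgue_on {0..})"
    unfolding h_def by (rule relax_measurable[OF \<mu> K \<Phi> \<xi>_meas])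
  have h_le: "norm (h s) \<le> B" if "s \<in> {0..S}" for s
    unfolding h_def relax_def using that B(2)
    by (intro radon_prob_norm_mean_le[OF relaxed_controls_radon[OF \<mu>] K continuous_on_section[OF \<Phi>]])
       (auto simp: C_def)
  have int: "f integrable_on {a..b}"
    if "f \<in> borel_measurable (lebesgue_on {0..})" "0 \<le> a" "\<And>s. s \<in> {a..b} \<Longrightarrow> norm (f s) \<le> c"
    for f :: "real \<Rightarrow> 'b" and a b c
    using absolutely_integrable_bounded[OF that] set_lebesgue_integral_eq_integral(1) by blast
  define m where "m i s = relax \<Phi> (x i) (\<mu> s)" for i s
  have m_meas: "m i \<in> borel_measurable (lebesgue_on {0..})" for i
    unfolding m_def by (rule relax_measurable[OF \<mu> K \<Phi>]) simp
  have m_le: "norm (m i s) \<le> B" if "i < n" "0 \<le> s" for i s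
    unfolding m_def relax_def using that B(2) xC
    by (intro radon_prob_norm_mean_le[OF relaxed_controls_radon[OF \<mu>] K continuous_on_section[OF \<Phi>]]) auto
  have m_int: "m i integrable_on {i * \<eta>..Suc i * \<eta>}" if "i < n" for i
    using i\<eta>[of i] m_le[OF that] by (intro int[OF m_meas, where c=B]) auto
  have "\<exists>w. w \<in> borel_measurable borel \<and> (\<forall>s. w s \<in> P) \<and>
      (\<lambda>s. \<Phi> (x i) (w s)) integrable_on {i * \<eta>..Suc i * \<eta>} \<and>
      norm (integral {i * \<eta>..Suc i * \<eta>} (\<lambda>s. \<Phi> (x i) (w s)) - integral {i * \<eta>..Suc i * \<eta>} (m i)) \<le> e * \<eta>"
    if i: "i < n" for i
  proof -
    have len: "Suc i * \<eta> - i * \<eta> = \<eta>"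
      by (simp add: algebra_simps)
    \<comment> \<open>The closure is needed because \<open>P\<close> is only dense in
      \<open>K\<close>: the cell average is approximated up to \<open>e\<close> by a point
      \<open>v\<close> of the hull of the values on \<open>P\<close>.\<close>
    let ?H = "closure (convex hull (\<Phi> (x i) ` P))"
    note cont = continuous_on_section[OF \<Phi>, of "x i"]
    have "\<Phi> (x i) ` K \<subseteq> closure (\<Phi> (x i) ` P)"
    proof
      fix v assume "v \<in> \<Phi> (x i) ` K"
      then obtain a where a: "a \<in> K" "v = \<Phi> (x i) a" by blast
      then have "a \<in> closure P" using P(2) by blast
      then obtain p where p: "\<And>k::nat. p k \<in> P" "p \<longlonglongrightarrow> a"
        unfolding closure_sequential by blast
      have "(\<lambda>k. \<Phi> (x i) (p k)) \<longlonglongrightarrow> v"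
        unfolding a(2) by (rule continuous_on_tendsto_compose[OF cont p(2)])
           (use a p(1) P(1) in \<open>auto intro!: always_eventually\<close>)
      then show "v \<in> closure (\<Phi> (x i) ` P)"
        unfolding closure_sequential using p(1) by (intro exI[of _ "\<lambda>k. \<Phi> (x i) (p k)"]) auto
    qed
    also have "\<dots> \<subseteq> ?H"
      by (intro closure_mono hull_subset)
    finally have "convex hull (\<Phi> (x i) ` K) \<subseteq> ?H"
      by (intro hull_minimal convex_closure convex_convex_hull)
    then have mH: "m i s \<in> ?H" if "0 \<le> s" for s
      using radon_prob_mean[OF relaxed_controls_radon[OF \<mu> that] K cont] by (auto simp: m_def relax_def)
    have "0 \<le> s" if "s \<in> {i * \<eta>..Suc i * \<eta>}" for s
      using that i\<eta>[of i] unfolding atLeastAtMost_iff by linarith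
    then have "inverse (Suc i * \<eta> - i * \<eta>) *\<^sub>R integral {i * \<eta>..Suc i * \<eta>} (m i) \<in> ?H"
      using \<eta>(1) mH
      by (intro average_in_closed_convex m_int i convex_closure convex_convex_hull closed_closure) auto
    then obtain v where v: "v \<in> convex hull (\<Phi> (x i) ` P)"
      "dist v (inverse \<eta> *\<^sub>R integral {i * \<eta>..Suc i * \<eta>} (m i)) < e"
      unfolding closure_approachable len using e by blast
    obtain w where w: "w \<in> borel_measurable borel" "\<And>s. w s \<in> P"
      "((\<lambda>s. \<Phi> (x i) (w s)) has_integral (Suc i * \<eta> - i * \<eta>) *\<^sub>R v) {i * \<eta>..Suc i * \<eta>}"
      using convex_hull_time_sharing[OF v(1), of "i * \<eta>" "Suc i * \<eta>"] \<eta> by (auto simp: algebra_simps)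
    have "integral {i * \<eta>..Suc i * \<eta>} (\<lambda>s. \<Phi> (x i) (w s)) - integral {i * \<eta>..Suc i * \<eta>} (m i) =
        \<eta> *\<^sub>R (v - inverse \<eta> *\<^sub>R integral {i * \<eta>..Suc i * \<eta>} (m i))"
      using integral_unique[OF w(3)] \<eta> unfolding len by (simp add: scaleR_diff_right)
    then have "norm (integral {i * \<eta>..Suc i * \<eta>} (\<lambda>s. \<Phi> (x i) (w s)) - integral {i * \<eta>..Suc i * \<eta>} (m i)) \<le> e * \<eta>"
      using v(2) \<eta> by (simp add: dist_norm)
    then show ?thesis
      using w by blast
  qed
  then obtain W where W: "\<And>i. i < n \<Longrightarrow> W i \<in> borel_measurable borel" "\<And>i s. i < n \<Longrightarrow> W i s \<in> P"
    "\<And>i. i < n \<Longrightarrow> (\<lambda>s. \<Phi> (x i) (W i s)) integrable_on {i * \<eta>..Suc i * \<eta>}"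
    "\<And>i. i < n \<Longrightarrow> norm (integral {i * \<eta>..Suc i * \<eta>} (\<lambda>s. \<Phi> (x i) (W i s)) -
        integral {i * \<eta>..Suc i * \<eta>} (m i)) \<le> e * \<eta>"
    by metis
  \<comment> \<open>\<open>nat\<close> sends negative times to cell 0 and the minimum caps the index
    at the last cell, so that \<open>W\<close> is evaluated only at valid indices, also outside the
    interval from 0 to \<open>S\<close>.\<close>
  define idx where "idx s = min (nat \<lfloor>s / \<eta>\<rfloor>) (n - 1)" for s
  have idx_less: "idx s < n" for s
    using n_pos by (simp add: idx_def min_def) linarith
  define w where "w s = W (idx s) s" for s
  have idx: "idx s = i" if "i < n" "s \<in> {i * \<eta>..<Suc i * \<eta>}" for i s
  proof -
    have "\<lfloor>s / \<eta>\<rfloor> = int i"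
      using that \<eta> by (intro floor_unique) (auto simp: field_simps)
    then show ?thesis
      using that by (simp add: idx_def)
  qed
  have w_meas: "w \<in> borel_measurable borel"
    unfolding w_def
  proof (rule measurable_compose_countable'[where f=W and g=idx and I="{..<n}"])
    have "idx \<in> measurable borel (count_space UNIV)"
      unfolding idx_def by measurable
    then show "idx \<in> measurable borel (count_space {..<n})"
      using idx_less by (auto simp: measurable_count_space_eq2 measurable_count_space_eq_countable)
  qed (use W in auto)
  have wP: "w s \<in> P" for s
    unfolding w_def using W(2) idx_less by blast
  define \<phi> where "\<phi> s = \<Phi> (\<xi> s) (w s) - h s" for s
  have wK: "w s \<in> K" for s
    using wP P(1) by blast
  have \<Phi>w_meas: "(\<lambda>s. \<Phi> (y s) (w s)) \<in> borel_measurable (lebesgue_on {0..})"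
    if "y \<in> borel_measurable (lebesgue_on {0..})" for y
    by (rule borel_measurable_continuous_pair[OF \<Phi> that borel_measurable_lebesgue_on[OF w_meas]]) (use wK in auto)
  have \<phi>_meas: "\<phi> \<in> borel_measurable (lebesgue_on {0..})"
    unfolding \<phi>_def using \<Phi>w_meas[OF \<xi>_meas] h_meas by (rule borel_measurable_diff)
  have \<phi>_le: "norm (\<phi> s) \<le> 2 * B" if "s \<in> {0..S}" for s
  proof -
    have "norm (\<Phi> (\<xi> s) (w s)) \<le> B"
      using that B(2) wK by (auto simp: C_def)
    then show ?thesis
      unfolding \<phi>_def using h_le[OF that] norm_triangle_ineq4[of "\<Phi> (\<xi> s) (w s)" "h s"] by linarith
  qed
  have \<phi>_int: "\<phi> integrable_on {a..b}" if "0 \<le> a" "b \<le> S" for a b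
    using that by (intro int[OF \<phi>_meas, where c="2 * B"] \<phi>_le) auto
  \<comment> \<open>Three errors of size \<open>e\<close> per unit of time: freezing the state at
    the left end point, the average realized by \<open>W i\<close> against the relaxed mean, and
    unfreezing the state in the relaxed field.\<close>
  have cell: "norm (integral {i * \<eta>..Suc i * \<eta>} \<phi>) \<le> 3 * e * \<eta>" if i: "i < n" for i
  proof -
    let ?I = "{i * \<eta>..Suc i * \<eta>}"
    have I: "?I \<subseteq> {0..S}" and len: "Suc i * \<eta> - i * \<eta> = \<eta>" and le: "i * \<eta> \<le> Suc i * \<eta>" "0 \<le> i * \<eta>"
      using grid[OF i] \<eta> by (auto simp: algebra_simps)
    define f1 where "f1 s = \<Phi> (\<xi> s) (w s) - \<Phi> (x i) (w s)" for s
    define f3 where "f3 s = m i s - h s" for s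
    have f1_le: "norm (f1 s) \<le> e" if "s \<in> ?I" for s
      unfolding f1_def using d(2)[of "\<xi> s" "x i" "w s"] near[OF i that] that I xC[OF i] wK
      by (auto simp: C_def less_imp_le)
    have f3_le: "norm (f3 s) \<le> e" if "s \<in> ?I" for s
      unfolding f3_def m_def h_def relax_def
    proof (rule radon_prob_mean_diff_le[OF relaxed_controls_radon[OF \<mu>] K])
      show "norm (\<Phi> (x i) a - \<Phi> (\<xi> s) a) \<le> e" if "a \<in> K" for a
        using d(2)[of "x i" "\<xi> s" a] near[OF i \<open>s \<in> ?I\<close>] \<open>s \<in> ?I\<close> I xC[OF i] that
        by (auto simp: C_def less_imp_le dist_commute)
      show "0 \<le> s" using that I by auto
    qed (intro continuous_on_section[OF \<Phi>])+
    have f1_int: "f1 integrable_on ?I"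
      using f1_le le unfolding f1_def
      by (intro int[where c=e] borel_measurable_diff \<Phi>w_meas \<xi>_meas) auto
    have f3_int: "f3 integrable_on ?I"
      using f3_le le unfolding f3_def
      by (intro int[where c=e] borel_measurable_diff m_meas h_meas) auto
    have eq: "\<Phi> (x i) (w s) = \<Phi> (x i) (W i s)" if "s \<in> ?I - {Suc i * \<eta>}" for s
      using idx[OF i, of s] that by (simp add: w_def)
    have f2_int: "(\<lambda>s. \<Phi> (x i) (w s)) integrable_on ?I"
      by (rule integrable_spike_finite[OF _ _ W(3)[OF i], of "{Suc i * \<eta>}"]) (use eq in auto)
    have f2_eq: "integral ?I (\<lambda>s. \<Phi> (x i) (w s)) = integral ?I (\<lambda>s. \<Phi> (x i) (W i s))"
      by (rule integral_spike[of "{Suc i * \<eta>}"]) (use eq in auto)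
    have "integral ?I \<phi> = integral ?I (\<lambda>s. f1 s + ((\<Phi> (x i) (w s) - m i s) + f3 s))"
      by (intro integral_cong) (simp add: \<phi>_def f1_def f3_def)
    also have "\<dots> = integral ?I f1 + ((integral ?I (\<lambda>s. \<Phi> (x i) (w s)) - integral ?I (m i)) + integral ?I f3)"
      by (intro integral_unique has_integral_add has_integral_diff integrable_integral
          f1_int f2_int f3_int m_int i)
    finally have eq: "integral ?I \<phi> = integral ?I f1 +
        ((integral ?I (\<lambda>s. \<Phi> (x i) (W i s)) - integral ?I (m i)) + integral ?I f3)"
      by (simp only: f2_eq)
    have "norm (integral ?I f1) \<le> e * \<eta>"
      using norm_integral_le[OF f1_int le(1) f1_le] unfolding len .
    moreover have "norm (integral ?I f3) \<le> e * \<eta>"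
      using norm_integral_le[OF f3_int le(1) f3_le] unfolding len .
    ultimately show ?thesis
      unfolding eq using W(4)[OF i]
        norm_triangle_ineq[of "integral ?I f1"
          "(integral ?I (\<lambda>s. \<Phi> (x i) (W i s)) - integral ?I (m i)) + integral ?I f3"]
        norm_triangle_ineq[of "integral ?I (\<lambda>s. \<Phi> (x i) (W i s)) - integral ?I (m i)" "integral ?I f3"]
      by linarith
  qed
  have node: "i \<le> n \<Longrightarrow> norm (integral {0..i * \<eta>} \<phi>) \<le> i * (3 * e * \<eta>)" for i :: nat
  proof (induction i)
    case (Suc i)
    have "Suc i * \<eta> \<le> n * \<eta>"
      using Suc.prems \<eta> by (intro mult_right_mono) auto
    then have "integral {0..i * \<eta>} \<phi> + integral {i * \<eta>..Suc i * \<eta>} \<phi> = integral {0..Suc i * \<eta>} \<phi>"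
      using \<eta> by (intro Henstock_Kurzweil_Integration.integral_combine \<phi>_int) (auto simp: algebra_simps)
    then have "norm (integral {0..Suc i * \<eta>} \<phi>) \<le> i * (3 * e * \<eta>) + 3 * e * \<eta>"
      using cell[of i] Suc norm_triangle_ineq[of "integral {0..i * \<eta>} \<phi>" "integral {i * \<eta>..Suc i * \<eta>} \<phi>"]
      by auto
    then show ?case by (simp add: algebra_simps)
  qed simp
  have "norm (integral {0..t} \<phi>) \<le> \<epsilon>" if t: "t \<in> {0..S}" for t
  proof -
    define i where "i = nat \<lfloor>t / \<eta>\<rfloor>"
    have ti: "i * \<eta> \<le> t" "t < Suc i * \<eta>"
    proof -
      have i: "real i = \<lfloor>t / \<eta>\<rfloor>"
        using t \<eta> by (simp add: i_def)
      then have "real i \<le> t / \<eta>" "t / \<eta> < real i + 1"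
        by linarith+
      then show "i * \<eta> \<le> t" "t < Suc i * \<eta>"
        using \<eta> by (simp_all add: field_simps)
    qed
    have "i * \<eta> \<le> n * \<eta>"
      using ti t \<eta> by (simp add: mult.commute)
    then have i: "i \<le> n"
      using \<eta> by simp
    have "integral {0..i * \<eta>} \<phi> + integral {i * \<eta>..t} \<phi> = integral {0..t} \<phi>"
      using \<eta> ti t by (intro Henstock_Kurzweil_Integration.integral_combine \<phi>_int) auto
    moreover have "norm (integral {i * \<eta>..t} \<phi>) \<le> 2 * B * (t - i * \<eta>)"
      using i\<eta>[of i] ti t by (intro norm_integral_le \<phi>_int \<phi>_le) auto
    moreover have "2 * B * (t - i * \<eta>) \<le> 2 * B * \<eta>"
      using B ti by (intro mult_left_mono) (auto simp: algebra_simps)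
    moreover have "i * (3 * e * \<eta>) \<le> n * (3 * e * \<eta>)"
      using i e \<eta> by (intro mult_right_mono) auto
    moreover have "n * (3 * e * \<eta>) = \<epsilon> / 2"
      using \<eta>(2) S by (simp add: e_def field_simps)
    ultimately show ?thesis
      using node[OF i] \<eta>_less norm_triangle_ineq[of "integral {0..i * \<eta>} \<phi>" "integral {i * \<eta>..t} \<phi>"]
      by auto
  qed
  then show ?thesis
    using that[OF w_meas wP] unfolding \<phi>_def h_def by blast
qed

section \<open>Control problems with a clock\<close>

lemma borel_half_line_lebesgue:
  assumes "w \<in> borel_measurable (restrict_space borel {0::real..})"
  shows "w \<in> borel_measurable (lebesgue_on {0..})"
proof (rule measurableI)
  fix U :: "'a set" assume "U \<in> sets borel"
  then have "w -` U \<inter> space (restrict_space borel {0..}) \<in> sets (restrict_space borel {0..})"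
    by (rule measurable_sets[OF assms])
  then obtain T where T: "T \<in> sets borel" "w -` U \<inter> {0..} = {0..} \<inter> T"
    by (auto simp: sets_restrict_space space_restrict_space)
  then have "T \<in> sets lebesgue"
    by (simp add: sets_completionI_sets)
  then show "w -` U \<inter> space (lebesgue_on {0..}) \<in> sets (lebesgue_on {0..})"
    using T(2) by (auto simp: sets_restrict_space space_restrict_space)
qed simp

lemma integral_shift_from_zero: "integral {S..S + r} g = integral {0..r} (\<lambda>s. g (S + s))" for S r :: real
  using integral_shift_Icc_real[of 0 r g S] by (simp add: o_def add.commute[of r S])

lemma nn_integral_shift_half_line:
  fixes f :: "real \<Rightarrow> ennreal"
  assumes "f \<in> borel_measurable (lebesgue_on {0..})" "0 \<le> S"
  shows "(\<integral>\<^sup>+s\<in>{S..}. f s \<partial>lebesgue) = (\<integral>\<^sup>+r\<in>{0..}. f (S + r) \<partial>lebesgue)"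
proof -
  have "f \<in> borel_measurable (lebesgue_on {S..})"
    using assms by (intro measurable_restrict_mono[OF assms(1)]) auto
  then have "(\<lambda>s. f s * indicator {S..} s) \<in> borel_measurable lebesgue"
    by (subst borel_measurable_restrict_space_iff_ennreal[symmetric]) auto
  from nn_integral_real_affine_lebesgue[OF this, of 1 S]
  show ?thesis
    by (simp add: indicator_def)
qed

text \<open>Here \<open>\<tau>\<close> is the rate of the original time: it is \<open>1\<close> for compact control sets, while after compactification
  of an unbounded one the control values with \<open>\<tau> = 0\<close> are those at which the original time stands still.\<close>

locale control_problem =
  fixes K :: "'a::euclidean_space set"
    and F :: "real ^ 'n \<Rightarrow> 'a \<Rightarrow> real ^ 'n" and L :: "real ^ 'n \<Rightarrow> 'a \<Rightarrow> real"
    and \<tau> :: "'a \<Rightarrow> real" and B c\<^sub>1 c\<^sub>2 :: real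
  assumes K: "compact K"
    and F_cont: "continuous_on (UNIV \<times> K) (\<lambda>(x, a). F x a)"
    and L_cont: "continuous_on (UNIV \<times> K) (\<lambda>(x, a). L x a)"
    and \<tau>_cont: "continuous_on K \<tau>"
    and \<tau>: "a \<in> K \<Longrightarrow> 0 \<le> \<tau> a" "a \<in> K \<Longrightarrow> \<tau> a \<le> 1"
    and dense: "K \<subseteq> closure {a \<in> K. 0 < \<tau> a}"
    and F_lipschitz: "R > 0 \<Longrightarrow> \<exists>C\<ge>0. \<forall>a\<in>K. \<forall>x y. norm x \<le> R \<longrightarrow> norm y \<le> R \<longrightarrow>
      norm (F x a - F y a) \<le> C * norm (x - y)"
    and F_growth: "a \<in> K \<Longrightarrow> norm (F x a) \<le> B * (1 + norm x)"
    and B: "B > 0"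
    and L_nonneg: "a \<in> K \<Longrightarrow> 0 \<le> L x a"
    and coercive: "a \<in> K \<Longrightarrow> c\<^sub>1 - c\<^sub>2 * \<tau> a \<le> L x a"
    and c: "c\<^sub>1 > 0" "c\<^sub>2 > 0"
begin

text \<open>The condition \<open>0 < \<tau> (w s)\<close> keeps the clock strictly increasing, but
  it may still be bounded; \<open>admissible\<close> excludes that.\<close>

definition ordinary :: "(real \<Rightarrow> 'a) set"
  where "ordinary = {w. w \<in> borel_measurable (restrict_space borel {0..}) \<and> (\<forall>s\<ge>0. w s \<in> K \<and> 0 < \<tau> (w s))}"

definition clock :: "(real \<Rightarrow> 'a) \<Rightarrow> real \<Rightarrow> real"
  where "clock w s = integral {0..s} (\<lambda>r. \<tau> (w r))"

text \<open>Only controls whose clock runs through the whole half line describe controls of the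
  original problem on all of its infinite horizon.\<close>

definition admissible :: "(real \<Rightarrow> 'a) set"
  where "admissible = {w \<in> ordinary. \<forall>T. \<exists>s\<ge>0. T \<le> clock w s}"

abbreviation state :: "(real \<Rightarrow> 'a) \<Rightarrow> real ^ 'n \<Rightarrow> real \<Rightarrow> real ^ 'n"
  where "state w x \<equiv> trajectory (\<lambda>s z. F z (w s)) x"

definition cost :: "real \<Rightarrow> real ^ 'n \<Rightarrow> (real \<Rightarrow> 'a) \<Rightarrow> ennreal"
  where "cost \<delta> x w = (\<integral>\<^sup>+s\<in>{0..}. ennreal (exp (- \<delta> * clock w s) * L (state w x s) (w s)) \<partial>lebesgue)"

definition discounted :: "real \<Rightarrow> real ^ 'n \<Rightarrow> ennreal"
  where "discounted \<delta> x = (INF w\<in>admissible. cost \<delta> x w)"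

lemma ordinary_measurable: "w \<in> ordinary \<Longrightarrow> w \<in> borel_measurable (lebesgue_on {0..})"
  by (auto simp: ordinary_def intro: borel_half_line_lebesgue)

lemma ordinaryD: "w \<in> ordinary \<Longrightarrow> 0 \<le> s \<Longrightarrow> w s \<in> K" "w \<in> ordinary \<Longrightarrow> 0 \<le> s \<Longrightarrow> 0 < \<tau> (w s)"
  by (auto simp: ordinary_def)

lemma lipschitz_field_ordinary:
  assumes w: "w \<in> ordinary"
  shows "lipschitz_field (\<lambda>s z. F z (w s)) B"
proof
  show "(\<lambda>s. F z (w s)) \<in> borel_measurable (lebesgue_on {0..})" for z
    using ordinary_measurable[OF w] ordinaryD(1)[OF w]
    by (intro borel_measurable_continuous_pair[OF F_cont, where y="\<lambda>_. z"]) auto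
  show "\<exists>C\<ge>0. \<forall>s\<ge>0. \<forall>x y. norm x \<le> R \<longrightarrow> norm y \<le> R \<longrightarrow>
      norm (F x (w s) - F y (w s)) \<le> C * norm (x - y)" if "R > 0" for R
    using F_lipschitz[OF that] ordinaryD(1)[OF w] by blast
qed (use F_growth ordinaryD(1)[OF w] B in auto)

lemma relax_F_lipschitz:
  assumes C: "\<forall>a\<in>K. \<forall>x y. norm x \<le> R \<longrightarrow> norm y \<le> R \<longrightarrow> norm (F x a - F y a) \<le> C * norm (x - y)"
    and \<mu>: "\<mu> \<in> radon_prob K" and "norm x \<le> R" "norm y \<le> R"
  shows "norm (relax F x \<mu> - relax F y \<mu>) \<le> C * norm (x - y)"
  unfolding relax_def using assms
  by (intro radon_prob_mean_diff_le[OF \<mu> K] continuous_on_section[OF F_cont]) auto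

lemma lipschitz_field_relaxed:
  assumes \<mu>: "\<mu> \<in> relaxed_controls K"
  shows "lipschitz_field (\<lambda>s z. relax F z (\<mu> s)) B"
proof
  note \<mu>s = relaxed_controls_radon[OF \<mu>]
  show "(\<lambda>s. relax F z (\<mu> s)) \<in> borel_measurable (lebesgue_on {0..})" for z
    by (rule relax_measurable[OF \<mu> K F_cont, where y="\<lambda>_. z"]) simp
  show "norm (relax F z (\<mu> s)) \<le> B * (1 + norm z)" if "0 \<le> s" for s z
    unfolding relax_def
    by (intro radon_prob_norm_mean_le[OF \<mu>s[OF that] K] continuous_on_section[OF F_cont] F_growth)
  show "\<exists>C\<ge>0. \<forall>s\<ge>0. \<forall>x y. norm x \<le> R \<longrightarrow> norm y \<le> R \<longrightarrow>
      norm (relax F x (\<mu> s) - relax F y (\<mu> s)) \<le> C * norm (x - y)" if R: "R > 0" for R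
  proof -
    obtain C where "C \<ge> 0" "\<forall>a\<in>K. \<forall>x y. norm x \<le> R \<longrightarrow> norm y \<le> R \<longrightarrow> norm (F x a - F y a) \<le> C * norm (x - y)"
      using F_lipschitz[OF R] by blast
    then show ?thesis
      using relax_F_lipschitz[OF _ \<mu>s] by blast
  qed
qed (rule B)

lemma rate_measurable:
  assumes "w \<in> ordinary"
  shows "(\<lambda>s. \<tau> (w s)) \<in> borel_measurable (lebesgue_on {0..})"
proof -
  \<comment> \<open>The rate gets a dummy state argument so that the measurability result for pairs
    applies.\<close>
  have "continuous_on (UNIV \<times> K) (\<lambda>(x :: real, a). \<tau> a)"
    unfolding case_prod_beta
    by (rule continuous_on_compose2[OF \<tau>_cont]) (auto intro!: continuous_intros)
  from borel_measurable_continuous_pair[OF this, of "\<lambda>_. 0" _ w]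
  show ?thesis
    using ordinary_measurable[OF assms] ordinaryD(1)[OF assms] by auto
qed

lemma rate_integrable:
  assumes w: "w \<in> ordinary" and "0 \<le> a"
  shows "(\<lambda>s. \<tau> (w s)) integrable_on {a..b}"
  by (intro set_lebesgue_integral_eq_integral(1) absolutely_integrable_bounded[where B=1] rate_measurable assms)
     (use \<tau> ordinaryD[OF w] assms(2) in \<open>auto simp: less_imp_le\<close>)

lemma clock_nonneg: "w \<in> ordinary \<Longrightarrow> 0 \<le> clock w s"
  unfolding clock_def by (rule integral_nonneg[OF rate_integrable]) (auto intro: less_imp_le ordinaryD)

lemma clock_le:
  assumes "w \<in> ordinary" "0 \<le> s"
  shows "clock w s \<le> s"
proof -
  have "clock w s \<le> integral {0..s} (\<lambda>_. 1)"
    unfolding clock_def using assms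
    by (intro integral_le rate_integrable) (auto intro: \<tau> ordinaryD)
  then show ?thesis using assms by simp
qed

lemma clock_continuous:
  assumes w: "w \<in> ordinary"
  shows "continuous_on {0..} (clock w)"
  unfolding clock_def[abs_def]
  by (intro continuous_on_half_line indefinite_integral_continuous_1 rate_integrable w) auto

lemma running_cost_measurable:
  assumes w: "w \<in> ordinary" and y: "continuous_on {0..} y"
  shows "(\<lambda>s. L (y s) (w s)) \<in> borel_measurable (lebesgue_on {0..})"
  by (rule borel_measurable_continuous_pair[OF L_cont borel_measurable_lebesgue_on_continuous[OF y]
        ordinary_measurable[OF w]]) (use ordinaryD[OF w] in auto)

lemma state_continuous: "w \<in> ordinary \<Longrightarrow> continuous_on {0..} (state w x)"
  by (rule lipschitz_field.trajectory_continuous[OF lipschitz_field_ordinary])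

lemma cost_integrand_measurable:
  assumes "w \<in> ordinary"
  shows "(\<lambda>s. ennreal (exp (- \<delta> * clock w s) * L (state w x s) (w s))) \<in> borel_measurable (lebesgue_on {0..})"
proof -
  have [measurable]: "(\<lambda>s. L (state w x s) (w s)) \<in> borel_measurable (lebesgue_on {0..})"
    by (rule running_cost_measurable[OF assms state_continuous[OF assms]])
  have [measurable]: "clock w \<in> borel_measurable (lebesgue_on {0..})"
    by (rule borel_measurable_lebesgue_on_continuous[OF clock_continuous[OF assms]])
  show ?thesis by measurable
qed

section \<open>Concatenation of controls\<close>

definition switch :: "real \<Rightarrow> (real \<Rightarrow> 'a) \<Rightarrow> (real \<Rightarrow> 'a) \<Rightarrow> real \<Rightarrow> 'a"
  where "switch S u v s = (if s < S then u s else v (s - S))"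

lemma switch_ordinary:
  assumes u: "u \<in> ordinary" and v: "v \<in> ordinary" and S: "0 \<le> S"
  shows "switch S u v \<in> ordinary"
proof -
  have m: "w \<in> borel_measurable (restrict_space borel {0..})" if "w \<in> ordinary" for w
    using that by (simp add: ordinary_def)
  \<comment> \<open>\<open>v\<close> is measurable only on the half line. The maximum keeps its
    argument there and changes nothing in the branch where it is used.\<close>
  have "(\<lambda>s. max 0 (s - S)) \<in> measurable (restrict_space borel {0..}) (restrict_space borel {0..})"
    by (intro measurable_restrict_space2 measurable_restrict_space1) auto
  from measurable_compose[OF this m[OF v]]
  have "(\<lambda>s. if s < S then u s else v (max 0 (s - S))) \<in> borel_measurable (restrict_space borel {0..})"
    using m[OF u] by (intro measurable_If) (auto simp: sets_restrict_space space_restrict_space intro!: exI[of _ "{..<S}"])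
  also have "(\<lambda>s. if s < S then u s else v (max 0 (s - S))) = switch S u v"
    by (auto simp: switch_def max_def)
  finally have "switch S u v \<in> borel_measurable (restrict_space borel {0..})" .
  moreover have "switch S u v s \<in> K \<and> 0 < \<tau> (switch S u v s)" if "0 \<le> s" for s
    using ordinaryD[OF u that] ordinaryD[OF v, of "s - S"] by (auto simp: switch_def)
  ultimately show ?thesis
    by (simp add: ordinary_def)
qed

lemma clock_switch:
  assumes u: "u \<in> ordinary" and v: "v \<in> ordinary" and S: "0 \<le> S" and r: "0 \<le> r"
  shows "clock (switch S u v) (S + r) = clock u S + clock v r"
proof -
  note w = switch_ordinary[OF u v S]
  have "clock (switch S u v) (S + r) =
      integral {0..S} (\<lambda>s. \<tau> (switch S u v s)) + integral {S..S+r} (\<lambda>s. \<tau> (switch S u v s))"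
    unfolding clock_def using S r
    by (intro Henstock_Kurzweil_Integration.integral_combine[symmetric] rate_integrable[OF w]) auto
  also have "integral {0..S} (\<lambda>s. \<tau> (switch S u v s)) = clock u S"
    unfolding clock_def by (rule integral_spike[of "{S}"]) (auto simp: switch_def)
  also have "integral {S..S+r} (\<lambda>s. \<tau> (switch S u v s)) = clock v r"
    unfolding integral_shift_from_zero clock_def by (rule integral_cong) (simp add: switch_def)
  finally show ?thesis .
qed

lemma state_switch_before:
  assumes u: "u \<in> ordinary" and v: "v \<in> ordinary" and s: "0 \<le> s" "s \<le> S"
  shows "state (switch S u v) x s = state u x s"
proof -
  note w = switch_ordinary[OF u v order_trans[OF s]]
  have "solves_upto S (\<lambda>s z. F z (u s)) x (state u x)"
    "solves_upto S (\<lambda>s z. F z (switch S u v s)) x (state (switch S u v) x)"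
    using lipschitz_field.trajectory_solves[OF lipschitz_field_ordinary] u w
    by (auto simp: solves_iff_upto)
  then show ?thesis
    by (rule lipschitz_field.solves_upto_unique[OF lipschitz_field_ordinary[OF u], where N="{S}"])
       (use s in \<open>auto simp: switch_def\<close>)
qed

lemma state_switch_after:
  assumes u: "u \<in> ordinary" and v: "v \<in> ordinary" and S: "0 \<le> S" and r: "0 \<le> r"
  shows "state (switch S u v) x (S + r) = state v (state u x S) r"
proof -
  let ?w = "switch S u v"
  note w = switch_ordinary[OF u v S]
  interpret w: lipschitz_field "\<lambda>s z. F z (?w s)" B
    by (rule lipschitz_field_ordinary[OF w])
  interpret v: lipschitz_field "\<lambda>s z. F z (v s)" B
    by (rule lipschitz_field_ordinary[OF v])
  let ?z = "state ?w x"
  have cz: "continuous_on {0..} (\<lambda>r. ?z (S + r))"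
    by (rule continuous_on_compose2[OF state_continuous[OF w]]) (use S in \<open>auto intro!: continuous_intros\<close>)
  have "solves (\<lambda>s z. F z (v s)) (state u x S) (\<lambda>r. ?z (S + r))"
    unfolding solves_alt
  proof (intro allI impI conjI)
    fix t :: real assume t: "0 \<le> t"
    show "(\<lambda>s. F (?z (S + s)) (v s)) absolutely_integrable_on {0..t}"
      by (rule v.integrable_along[of t]) (use continuous_on_subset[OF cz] t in auto)
    let ?g = "\<lambda>s. F (?z s) (?w s)"
    have "?g absolutely_integrable_on {0..S+t}"
      by (rule w.integrable_along[of "S+t"]) (use continuous_on_subset[OF state_continuous[OF w]] S t in auto)
    then have g: "?g integrable_on {0..S+t}"
      by (rule set_lebesgue_integral_eq_integral(1))
    have "?z (S + t) = x + integral {0..S+t} ?g"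
      by (rule w.trajectory_eq) (use S t in auto)
    also have "integral {0..S+t} ?g = integral {0..S} ?g + integral {S..S+t} ?g"
      using S t by (intro Henstock_Kurzweil_Integration.integral_combine[symmetric] g) auto
    also have "integral {S..S+t} ?g = integral {0..t} (\<lambda>s. F (?z (S + s)) (v s))"
      unfolding integral_shift_from_zero by (rule integral_cong) (simp add: switch_def)
    also have "x + (integral {0..S} ?g + integral {0..t} (\<lambda>s. F (?z (S + s)) (v s))) =
        ?z S + integral {0..t} (\<lambda>s. F (?z (S + s)) (v s))"
      using w.trajectory_eq[OF S] by simp
    also have "?z S = state u x S"
      using state_switch_before[OF u v S order_refl] .
    finally show "?z (S + t) = state u x S + integral {0..t} (\<lambda>s. F (?z (S + s)) (v s))" .
  qed
  then show ?thesis
    using v.trajectory_unique r by metis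
qed

text \<open>One half of the dynamic programming principle. Before \<open>S\<close> the discount is
  dropped; after \<open>S\<close> the clock is additive, so the factor
  \<open>exp (- \<delta> * clock u S)\<close> splits off from the cost of \<open>v\<close>.\<close>

lemma discounted_switch_le:
  assumes u: "u \<in> ordinary" and v: "v \<in> admissible" and S: "0 \<le> S" and \<delta>: "0 < \<delta>"
  shows "discounted \<delta> x \<le> (\<integral>\<^sup>+s\<in>{0..S}. ennreal (L (state u x s) (u s)) \<partial>lebesgue) +
    ennreal (exp (- \<delta> * clock u S)) * cost \<delta> (state u x S) v"
proof -
  let ?w = "switch S u v"
  let ?f = "\<lambda>s. ennreal (exp (- \<delta> * clock ?w s) * L (state ?w x s) (?w s))"
  have v': "v \<in> ordinary"
    using v by (simp add: admissible_def)
  note w = switch_ordinary[OF u v' S]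
  have "?w \<in> admissible"
    unfolding admissible_def
  proof (intro CollectI conjI allI w)
    fix T
    obtain s where "s \<ge> 0" "T \<le> clock v s"
      using v by (auto simp: admissible_def)
    then show "\<exists>s\<ge>0. T \<le> clock ?w s"
      using clock_switch[OF u v' S, of s] clock_nonneg[OF u, of S] S by (intro exI[of _ "S + s"]) auto
  qed
  then have "discounted \<delta> x \<le> cost \<delta> x ?w"
    unfolding discounted_def by (rule INF_lower)
  also have "cost \<delta> x ?w = (\<integral>\<^sup>+s. ?f s * indicator {0..<S} s + ?f s * indicator {S..} s \<partial>lebesgue)"
    unfolding cost_def using S by (intro nn_integral_cong) (auto simp: indicator_def)
  also have "\<dots> = (\<integral>\<^sup>+s\<in>{0..<S}. ?f s \<partial>lebesgue) + (\<integral>\<^sup>+s\<in>{S..}. ?f s \<partial>lebesgue)"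
  proof (rule nn_integral_add)
    have m: "(\<lambda>s. ?f s * indicator T s) \<in> borel_measurable lebesgue" if "T \<subseteq> {0..}" "T \<in> sets lebesgue" for T
      using measurable_restrict_mono[OF cost_integrand_measurable[OF w] that(1)] that(2)
      by (subst borel_measurable_restrict_space_iff_ennreal[symmetric]) auto
    show "(\<lambda>s. ?f s * indicator {0..<S} s) \<in> borel_measurable lebesgue"
      by (rule m) auto
    show "(\<lambda>s. ?f s * indicator {S..} s) \<in> borel_measurable lebesgue"
      by (rule m) (use S in auto)
  qed
  also have "(\<integral>\<^sup>+s\<in>{0..<S}. ?f s \<partial>lebesgue) \<le> (\<integral>\<^sup>+s\<in>{0..S}. ennreal (L (state u x s) (u s)) \<partial>lebesgue)"
  proof (rule nn_integral_mono)
    fix s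
    show "?f s * indicator {0..<S} s \<le> ennreal (L (state u x s) (u s)) * indicator {0..S} s"
    proof (cases "s \<in> {0..<S}")
      case True
      then have "?w s = u s" "state ?w x s = state u x s"
        using state_switch_before[OF u v'] by (auto simp: switch_def)
      moreover have "exp (- \<delta> * clock ?w s) * L (state u x s) (u s) \<le> L (state u x s) (u s)"
        using clock_nonneg[OF w, of s] \<delta> True L_nonneg[OF ordinaryD(1)[OF u]]
        by (intro mult_left_le_one_le) auto
      ultimately show ?thesis
        using True by (auto simp: ennreal_leI)
    qed auto
  qed
  also have "(\<integral>\<^sup>+s\<in>{S..}. ?f s \<partial>lebesgue) = (\<integral>\<^sup>+r\<in>{0..}. ?f (S + r) \<partial>lebesgue)"
    by (rule nn_integral_shift_half_line[OF cost_integrand_measurable[OF w] S])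
  also have "\<dots> = (\<integral>\<^sup>+r. ennreal (exp (- \<delta> * clock u S)) *
      (ennreal (exp (- \<delta> * clock v r) * L (state v (state u x S) r) (v r)) * indicator {0..} r) \<partial>lebesgue)"
  proof (rule nn_integral_cong)
    fix r
    show "?f (S + r) * indicator {0..} r = ennreal (exp (- \<delta> * clock u S)) *
      (ennreal (exp (- \<delta> * clock v r) * L (state v (state u x S) r) (v r)) * indicator {0..} r)"
    proof (cases "0 \<le> r")
      case True
      have "?w (S + r) = v r"
        using True by (simp add: switch_def)
      moreover have "exp (- \<delta> * (clock u S + clock v r)) * l =
          exp (- \<delta> * clock u S) * (exp (- \<delta> * clock v r) * l)" for l
        by (simp only: distrib_left exp_add mult.assoc)
      ultimately show ?thesis
        using True L_nonneg[OF ordinaryD(1)[OF v' True]]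
        by (simp only: clock_switch[OF u v' S True] state_switch_after[OF u v' S True])
           (simp add: ennreal_mult)
    qed auto
  qed
  also have "\<dots> = ennreal (exp (- \<delta> * clock u S)) * cost \<delta> (state u x S) v"
    unfolding cost_def
    by (intro nn_integral_cmult borel_measurable_restrict_space_iff_ennreal[THEN iffD1]
        cost_integrand_measurable v') auto
  finally show ?thesis
    by (simp add: add_right_mono)
qed

end

section \<open>The upper bound\<close>

lemma integral_fst_snd:
  fixes f :: "'s \<Rightarrow> 'b::euclidean_space \<times> 'c::euclidean_space"
  assumes "integrable M f"
  shows "(LINT s|M. fst (f s)) = fst (LINT s|M. f s)" "(LINT s|M. snd (f s)) = snd (LINT s|M. f s)"
  using integral_bounded_linear[OF bounded_linear_fst assms]
    integral_bounded_linear[OF bounded_linear_snd assms] by simp_all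

lemma set_nn_integral_eq_integral:
  fixes f :: "real \<Rightarrow> real"
  assumes "f absolutely_integrable_on S" "\<And>s. s \<in> S \<Longrightarrow> 0 \<le> f s"
  shows "(\<integral>\<^sup>+s\<in>S. ennreal (f s) \<partial>lebesgue) = ennreal (integral S f)"
proof -
  have "(\<integral>\<^sup>+s\<in>S. ennreal (f s) \<partial>lebesgue) = (\<integral>\<^sup>+s. ennreal (indicator S s *\<^sub>R f s) \<partial>lebesgue)"
    by (rule nn_integral_cong) (auto simp: indicator_def)
  also have "\<dots> = ennreal (LINT s|lebesgue. indicator S s *\<^sub>R f s)"
    using assms by (intro nn_integral_eq_integral) (auto simp: set_integrable_def indicator_def)
  also have "(LINT s|lebesgue. indicator S s *\<^sub>R f s) = integral S f"
    using set_lebesgue_integral_eq_integral(2)[OF assms(1)] by (simp add: set_lebesgue_integral_def)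
  finally show ?thesis .
qed

lemma has_integral_Pair:
  fixes f :: "real \<Rightarrow> 'b::euclidean_space" and g :: "real \<Rightarrow> 'c::euclidean_space"
  assumes "(f has_integral i) S" "(g has_integral j) S"
  shows "((\<lambda>s. (f s, g s)) has_integral (i, j)) S"
proof -
  have "((\<lambda>s. (f s, 0 :: 'c)) has_integral (i, 0)) S"
    using has_integral_linear[OF assms(1) bounded_linear_Pair[OF bounded_linear_ident bounded_linear_zero]]
    by (simp add: o_def)
  from has_integral_add[OF this, of "\<lambda>s. (0, g s)" "(0, j)"] show ?thesis
    using has_integral_linear[OF assms(2) bounded_linear_Pair[OF bounded_linear_zero bounded_linear_ident]]
    by (simp add: o_def)
qed

context control_problem
begin

lemma rate_cont: "continuous_on (UNIV \<times> K) (\<lambda>(x :: real ^ 'n, a). \<tau> a)"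
  unfolding case_prod_beta
  by (rule continuous_on_compose2[OF \<tau>_cont]) (auto intro!: continuous_intros)

lemma relaxed_absolutely_integrable:
  fixes \<Phi> :: "real ^ 'n \<Rightarrow> 'a \<Rightarrow> 'b::euclidean_space"
  assumes \<Phi>: "continuous_on (UNIV \<times> K) (\<lambda>(x, a). \<Phi> x a)" and \<mu>: "\<mu> \<in> relaxed_controls K"
    and \<xi>: "continuous_on {0..} \<xi>"
  shows "(\<lambda>s. relax \<Phi> (\<xi> s) (\<mu> s)) absolutely_integrable_on {0..t}"
proof -
  have "compact (\<xi> ` {0..t})"
    by (intro compact_continuous_image continuous_on_subset[OF \<xi>]) auto
  then obtain b where b: "\<And>x a. x \<in> \<xi> ` {0..t} \<Longrightarrow> a \<in> K \<Longrightarrow> norm (\<Phi> x a) \<le> b"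
    using bounded_on_compact[OF \<Phi> K] by metis
  show ?thesis
  proof (rule absolutely_integrable_bounded[where B=b])
    show "(\<lambda>s. relax \<Phi> (\<xi> s) (\<mu> s)) \<in> borel_measurable (lebesgue_on {0..})"
      by (rule relax_measurable[OF \<mu> K \<Phi> borel_measurable_lebesgue_on_continuous[OF \<xi>]])
    fix s assume "s \<in> {0..t}"
    then show "norm (relax \<Phi> (\<xi> s) (\<mu> s)) \<le> b"
      unfolding relax_def using b
      by (intro radon_prob_norm_mean_le[OF relaxed_controls_radon[OF \<mu>] K continuous_on_section[OF \<Phi>]]) auto
  qed simp
qed

lemma ordinary_absolutely_integrable:
  fixes \<Phi> :: "real ^ 'n \<Rightarrow> 'a \<Rightarrow> 'b::euclidean_space"
  assumes \<Phi>: "continuous_on (UNIV \<times> K) (\<lambda>(x, a). \<Phi> x a)" and w: "w \<in> ordinary"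
    and \<xi>: "continuous_on {0..} \<xi>"
  shows "(\<lambda>s. \<Phi> (\<xi> s) (w s)) absolutely_integrable_on {0..t}"
proof -
  have "compact (\<xi> ` {0..t})"
    by (intro compact_continuous_image continuous_on_subset[OF \<xi>]) auto
  then obtain b where b: "\<And>x a. x \<in> \<xi> ` {0..t} \<Longrightarrow> a \<in> K \<Longrightarrow> norm (\<Phi> x a) \<le> b"
    using bounded_on_compact[OF \<Phi> K] by metis
  show ?thesis
  proof (rule absolutely_integrable_bounded[where B=b])
    show "(\<lambda>s. \<Phi> (\<xi> s) (w s)) \<in> borel_measurable (lebesgue_on {0..})"
      by (rule borel_measurable_continuous_pair[OF \<Phi> borel_measurable_lebesgue_on_continuous[OF \<xi>]
            ordinary_measurable[OF w]]) (use ordinaryD[OF w] in auto)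
  qed (use b ordinaryD[OF w] in auto)
qed

text \<open>Velocity, running cost and clock rate are approximated together, as one vector-valued
  integrand along the fixed path \<xi>. The first component says that \<xi> almost solves the
  equation of \<open>w\<close>, so \<open>stability\<close> brings the true state close to \<xi>,
  and uniform continuity of \<open>L\<close> moves the cost estimate from \<xi> to that
  state.\<close>

lemma chattering_control:
  assumes \<mu>: "\<mu> \<in> relaxed_controls K" and S: "S > 0" and \<epsilon>: "\<epsilon> > 0"
    and \<xi>: "\<xi> = trajectory (\<lambda>s z. relax F z (\<mu> s)) x"
  obtains w where "w \<in> ordinary"
    "integral {0..S} (\<lambda>s. L (state w x s) (w s)) \<le> integral {0..S} (\<lambda>s. relax L (\<xi> s) (\<mu> s)) + \<epsilon>"
    "integral {0..S} (\<lambda>s. relax (\<lambda>_. \<tau>) (\<xi> s) (\<mu> s)) - \<epsilon> \<le> clock w S"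
proof -
  interpret r: lipschitz_field "\<lambda>s z. relax F z (\<mu> s)" B
    by (rule lipschitz_field_relaxed[OF \<mu>])
  have c\<xi>: "continuous_on {0..} \<xi>"
    unfolding \<xi> by (rule r.trajectory_continuous)
  define R where "R = (1 + norm x) * exp (B * S)"
  have R_pos: "R > 0" by (simp add: R_def add_pos_nonneg)
  have R_bound: "(1 + norm x) * exp (B * t) \<le> R" if "t \<le> S" for t
    using that B by (simp add: R_def add_pos_nonneg)
  obtain C where C: "C \<ge> 0" "\<forall>a\<in>K. \<forall>x y. norm x \<le> R \<longrightarrow> norm y \<le> R \<longrightarrow> norm (F x a - F y a) \<le> C * norm (x - y)"
    using F_lipschitz[OF R_pos] by blast
  have "\<epsilon> / (2 * S) > 0" using \<epsilon> S by simp
  then obtain d where d: "d > 0"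
    "\<And>x y a. x \<in> cball 0 R \<Longrightarrow> y \<in> cball 0 R \<Longrightarrow> a \<in> K \<Longrightarrow> dist x y < d \<Longrightarrow> norm (L x a - L y a) < \<epsilon> / (2 * S)"
    using uniform_modulus[OF L_cont K compact_cball[of 0 R], of "\<epsilon> / (2 * S)"] by metis
  \<comment> \<open>Half of \<epsilon> is spent on the integrated running cost along \<xi>. The
    second bound leaves a distance below \<open>d\<close> after multiplication by the Gronwall
    factor \<open>exp (C * S)\<close>, and \<open>d\<close> was chosen so that replacing \<xi> by
    the state costs at most the other half.\<close>
  define e where "e = min (\<epsilon> / 2) (d / (2 * exp (C * S)))"
  have e: "e > 0" "e \<le> \<epsilon> / 2"
    using \<epsilon> d(1) by (auto simp: e_def)
  have "e * exp (C * S) \<le> d / (2 * exp (C * S)) * exp (C * S)"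
    by (intro mult_right_mono) (auto simp: e_def)
  then have ed: "e * exp (C * S) < d"
    using d(1) by simp
  define \<Phi> where "\<Phi> x a = (F x a, L x a, \<tau> a)" for x a
  have \<Phi>: "continuous_on (UNIV \<times> K) (\<lambda>(x, a). \<Phi> x a)"
    using F_cont L_cont rate_cont unfolding \<Phi>_def case_prod_beta by (intro continuous_on_Pair)
  obtain w where w: "w \<in> borel_measurable borel" "\<And>s. w s \<in> {a \<in> K. 0 < \<tau> a}"
    "\<And>t. t \<in> {0..S} \<Longrightarrow> norm (integral {0..t} (\<lambda>s. \<Phi> (\<xi> s) (w s) - relax \<Phi> (\<xi> s) (\<mu> s))) \<le> e"
    using chattering[OF K _ dense \<Phi> c\<xi> \<mu> S e(1)] by blast
  have wo: "w \<in> ordinary"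
    using w(1,2) by (auto simp: ordinary_def intro: measurable_restrict_space1)
  have relax: "relax \<Phi> y (\<mu> s) = (relax F y (\<mu> s), relax L y (\<mu> s), relax (\<lambda>_. \<tau>) y (\<mu> s))"
    if "0 \<le> s" for y s
  proof -
    have "integrable (\<mu> s) (\<Phi> y)"
      by (rule radon_prob_integrable[OF relaxed_controls_radon[OF \<mu> that] K continuous_on_section[OF \<Phi>]])
    then have "integrable (\<mu> s) (\<lambda>a. (F y a, L y a, \<tau> a))"
      by (simp add: \<Phi>_def[abs_def])
    from integral_fst_snd[OF this] integral_fst_snd[OF integrable_bounded_linear[OF bounded_linear_snd this]]
    show ?thesis
      unfolding relax_def \<Phi>_def by (simp add: prod_eq_iff)
  qed
  have comp: "norm (integral {0..t} (\<lambda>s. F (\<xi> s) (w s)) - integral {0..t} (\<lambda>s. relax F (\<xi> s) (\<mu> s))) \<le> e"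
    "\<bar>integral {0..t} (\<lambda>s. L (\<xi> s) (w s)) - integral {0..t} (\<lambda>s. relax L (\<xi> s) (\<mu> s))\<bar> \<le> e"
    "\<bar>integral {0..t} (\<lambda>s. \<tau> (w s)) - integral {0..t} (\<lambda>s. relax (\<lambda>_. \<tau>) (\<xi> s) (\<mu> s))\<bar> \<le> e"
    if t: "t \<in> {0..S}" for t
  proof -
    note i = set_lebesgue_integral_eq_integral(1)[OF ordinary_absolutely_integrable[OF F_cont wo c\<xi>, of t]]
      set_lebesgue_integral_eq_integral(1)[OF ordinary_absolutely_integrable[OF L_cont wo c\<xi>, of t]]
      set_lebesgue_integral_eq_integral(1)[OF ordinary_absolutely_integrable[OF rate_cont wo c\<xi>, of t]]
      set_lebesgue_integral_eq_integral(1)[OF relaxed_absolutely_integrable[OF F_cont \<mu> c\<xi>, of t]]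
      set_lebesgue_integral_eq_integral(1)[OF relaxed_absolutely_integrable[OF L_cont \<mu> c\<xi>, of t]]
      set_lebesgue_integral_eq_integral(1)[OF relaxed_absolutely_integrable[OF rate_cont \<mu> c\<xi>, of t]]
    let ?D1 = "integral {0..t} (\<lambda>s. F (\<xi> s) (w s)) - integral {0..t} (\<lambda>s. relax F (\<xi> s) (\<mu> s))"
    let ?D2 = "integral {0..t} (\<lambda>s. L (\<xi> s) (w s)) - integral {0..t} (\<lambda>s. relax L (\<xi> s) (\<mu> s))"
    let ?D3 = "integral {0..t} (\<lambda>s. \<tau> (w s)) - integral {0..t} (\<lambda>s. relax (\<lambda>_. \<tau>) (\<xi> s) (\<mu> s))"
    have "((\<lambda>s. (F (\<xi> s) (w s) - relax F (\<xi> s) (\<mu> s), L (\<xi> s) (w s) - relax L (\<xi> s) (\<mu> s),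
        \<tau> (w s) - relax (\<lambda>_. \<tau>) (\<xi> s) (\<mu> s))) has_integral (?D1, ?D2, ?D3)) {0..t}"
      by (intro has_integral_Pair has_integral_diff integrable_integral i)
    then have hi: "((\<lambda>s. \<Phi> (\<xi> s) (w s) - relax \<Phi> (\<xi> s) (\<mu> s)) has_integral (?D1, ?D2, ?D3)) {0..t}"
      by (rule has_integral_eq[rotated]) (simp add: relax \<Phi>_def)
    have n: "norm (?D1, ?D2, ?D3) \<le> e"
      using w(3)[OF t] unfolding integral_unique[OF hi] .
    then show "norm ?D1 \<le> e"
      using norm_fst_le[of ?D1 "(?D2, ?D3)"] by linarith
    from n have "norm (?D2, ?D3) \<le> e"
      using norm_snd_le[of "(?D2, ?D3)" ?D1] by linarith
    then show "\<bar>?D2\<bar> \<le> e" "\<bar>?D3\<bar> \<le> e"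
      using norm_fst_le[of ?D2 ?D3] norm_snd_le[of ?D3 ?D2] by auto
  qed
  interpret w: lipschitz_field "\<lambda>s z. F z (w s)" B
    by (rule lipschitz_field_ordinary[OF wo])
  let ?y = "state w x"
  have y_R: "norm (?y t) \<le> R" and \<xi>_R: "norm (\<xi> t) \<le> R" if "t \<in> {0..S}" for t
    using w.trajectory_bound[of t x] r.trajectory_bound[of t x] R_bound[of t] that unfolding \<xi> by auto
  have close: "norm (?y t - \<xi> t) < d" if t: "t \<in> {0..S}" for t
  proof -
    have "norm (?y t - \<xi> t) \<le> e * exp (C * t)"
    proof (rule w.stability[where T=S and R=R and x=x])
      show "solves_upto S (\<lambda>s z. F z (w s)) x ?y"
        using w.trajectory_solves by (simp add: solves_iff_upto)
      show "continuous_on {0..S} \<xi>"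
        by (rule continuous_on_subset[OF c\<xi>]) auto
      show "norm (\<xi> t - x - integral {0..t} (\<lambda>s. F (\<xi> s) (w s))) \<le> e" if "t \<in> {0..S}" for t
        using comp(1)[OF that] r.trajectory_eq[of t x] that unfolding \<xi>[symmetric]
        by (simp add: norm_minus_commute)
    qed (use y_R \<xi>_R C t w(2) in auto)
    also have "\<dots> \<le> e * exp (C * S)"
      using t C(1) e(1) by (intro mult_left_mono) (auto intro: mult_left_mono)
    finally show ?thesis using ed by simp
  qed
  have "integral {0..S} (\<lambda>s. L (?y s) (w s)) - integral {0..S} (\<lambda>s. L (\<xi> s) (w s)) \<le> \<epsilon> / 2"
  proof -
    note i = set_lebesgue_integral_eq_integral(1)[OF ordinary_absolutely_integrable[OF L_cont wo w.trajectory_continuous]]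
      set_lebesgue_integral_eq_integral(1)[OF ordinary_absolutely_integrable[OF L_cont wo c\<xi>]]
    have "norm (integral {0..S} (\<lambda>s. L (?y s) (w s) - L (\<xi> s) (w s))) \<le> \<epsilon> / (2 * S) * (S - 0)"
    proof (rule norm_integral_le)
      show "norm (L (?y s) (w s) - L (\<xi> s) (w s)) \<le> \<epsilon> / (2 * S)" if "s \<in> {0..S}" for s
        using d(2)[of "?y s" "\<xi> s" "w s"] y_R[OF that] \<xi>_R[OF that] w(2)[of s] close[OF that]
        by (auto simp: dist_norm less_imp_le)
    qed (use S i in \<open>auto intro: integrable_diff\<close>)
    moreover have "integral {0..S} (\<lambda>s. L (?y s) (w s) - L (\<xi> s) (w s)) =
        integral {0..S} (\<lambda>s. L (?y s) (w s)) - integral {0..S} (\<lambda>s. L (\<xi> s) (w s))"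
      using i by (intro integral_diff)
    moreover have "\<epsilon> / (2 * S) * (S - 0) = \<epsilon> / 2"
      using S by simp
    ultimately show ?thesis
      by simp
  qed
  moreover have "S \<in> {0..S}" using S by simp
  ultimately show ?thesis
    using comp(2,3)[of S] e(2) by (intro that[OF wo]) (auto simp: clock_def)
qed

lemma relaxed_coercive:
  assumes \<mu>: "\<mu> \<in> radon_prob K"
  shows "c\<^sub>1 - c\<^sub>2 * relax (\<lambda>_. \<tau>) x \<mu> \<le> relax L x \<mu>"
proof -
  interpret prob_space \<mu> using \<mu> by (simp add: radon_prob_def)
  note i = radon_prob_integrable[OF \<mu> K \<tau>_cont] radon_prob_integrable[OF \<mu> K continuous_on_section[OF L_cont]]
  have "(LINT a|\<mu>. c\<^sub>1 - c\<^sub>2 * \<tau> a) \<le> (LINT a|\<mu>. L x a)"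
    using i coercive space_radon_prob[OF \<mu>] by (intro integral_mono) auto
  then show ?thesis
    using i by (simp add: relax_def prob_space)
qed

lemma relaxed_L_nonneg: "\<mu> \<in> radon_prob K \<Longrightarrow> 0 \<le> relax L x \<mu>"
  unfolding relax_def using L_nonneg space_radon_prob by (intro Bochner_Integration.integral_nonneg) auto

text \<open>Finite cost and coercivity drive the relaxed clock to infinity. Once it is large, the boundedness of
  the discounted value makes the remaining cost negligible wherever the approximating trajectory ends,
  so no control of its end point is needed.\<close>

lemma discounted_le_relaxed:
  assumes bounded: "\<And>x. discounted \<delta> x \<le> ennreal k" and \<delta>: "0 < \<delta>"
  shows "discounted \<delta> x \<le> relaxed_value K F L x"
  unfolding relaxed_value_def
proof (rule INF_greatest)
  fix \<mu> assume \<mu>: "\<mu> \<in> relaxed_controls K"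
  define \<xi> where "\<xi> = trajectory (\<lambda>s z. relax F z (\<mu> s)) x"
  define J where "J = (\<integral>\<^sup>+t\<in>{0..}. ennreal (relax L (\<xi> t) (\<mu> t)) \<partial>lebesgue)"
  have c\<xi>: "continuous_on {0..} \<xi>"
    unfolding \<xi>_def by (rule lipschitz_field.trajectory_continuous[OF lipschitz_field_relaxed[OF \<mu>]])
  show "discounted \<delta> x \<le> (\<integral>\<^sup>+t\<in>{0..}. ennreal (relax L (trajectory (\<lambda>s z. relax F z (\<mu> s)) x t) (\<mu> t)) \<partial>lebesgue)"
    unfolding \<xi>_def[symmetric] J_def[symmetric]
  proof (rule ennreal_le_epsilon)
    fix \<epsilon> :: real assume fin: "J < \<top>" and \<epsilon>: "0 < \<epsilon>"
    define j where "j = enn2real J"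
    have j: "J = ennreal j" "0 \<le> j"
      using fin by (auto simp: j_def)
    have rL: "(\<lambda>s. relax L (\<xi> s) (\<mu> s)) absolutely_integrable_on {0..t}"
      "(\<lambda>s. relax L (\<xi> s) (\<mu> s)) integrable_on {0..t}" for t
      using relaxed_absolutely_integrable[OF L_cont \<mu> c\<xi>, of t] set_lebesgue_integral_eq_integral(1) by auto
    have r\<tau>: "(\<lambda>s. relax (\<lambda>_. \<tau>) (\<xi> s) (\<mu> s)) integrable_on {0..t}" for t
      using relaxed_absolutely_integrable[OF rate_cont \<mu> c\<xi>, of t] set_lebesgue_integral_eq_integral(1) by auto
    have le_j: "integral {0..t} (\<lambda>s. relax L (\<xi> s) (\<mu> s)) \<le> j" for t
    proof -
      have "ennreal (integral {0..t} (\<lambda>s. relax L (\<xi> s) (\<mu> s))) =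
          (\<integral>\<^sup>+s\<in>{0..t}. ennreal (relax L (\<xi> s) (\<mu> s)) \<partial>lebesgue)"
        using relaxed_L_nonneg[OF relaxed_controls_radon[OF \<mu>]]
        by (intro set_nn_integral_eq_integral[symmetric] rL) auto
      also have "\<dots> \<le> J"
        unfolding J_def by (intro nn_integral_mono) (auto simp: indicator_def)
      finally show ?thesis
        using j by (simp add: ennreal_le_iff)
    qed
    have r\<tau>c: "(\<lambda>s. c\<^sub>2 * relax (\<lambda>_. \<tau>) (\<xi> s) (\<mu> s)) integrable_on {0..t}" for t
      using integrable_cmul[OF r\<tau>, of c\<^sub>2] by simp
    \<comment> \<open>Once the clock has passed \<open>N\<close>, a continuation of cost below
      \<open>\<bar>k\<bar> + 1\<close> contributes less than \<open>\<epsilon> / 2\<close>. The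
      summand 1 leaves room for a control that is not exactly optimal.\<close>
    obtain N where N: "N \<ge> 0" "exp (- \<delta> * N) * (\<bar>k\<bar> + 1) < \<epsilon> / 2"
    proof -
      have "(\<lambda>n. exp (- \<delta>) ^ n * (\<bar>k\<bar> + 1)) \<longlonglongrightarrow> 0 * (\<bar>k\<bar> + 1)"
        using \<delta> by (intro tendsto_intros LIMSEQ_realpow_zero) auto
      then have "\<forall>\<^sub>F n in sequentially. exp (- \<delta>) ^ n * (\<bar>k\<bar> + 1) < \<epsilon> / 2"
        by (rule order_tendstoD(2)) (use \<epsilon> in auto)
      then obtain n where "exp (- \<delta>) ^ n * (\<bar>k\<bar> + 1) < \<epsilon> / 2"
        using eventually_happens'[OF sequentially_bot] by blast
      then show ?thesis
        by (intro that[of "real n"]) (simp_all add: exp_of_nat_mult[symmetric] mult.commute)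
    qed
    \<comment> \<open>The approximation raises the cost by at most \<open>\<epsilon> / 2\<close> and
      delays the clock by at most 1.\<close>
    define e where "e = min (\<epsilon> / 2) 1"
    have e: "e > 0" "e \<le> \<epsilon> / 2" "e \<le> 1"
      using \<epsilon> by (auto simp: e_def)
    \<comment> \<open>Integrated coercivity says that \<open>c\<^sub>1 * S\<close> minus
      \<open>c\<^sub>2\<close> times the relaxed clock is at most \<open>j\<close>. This
      \<open>S\<close> therefore forces the relaxed clock up to \<open>N + 1\<close>, where the
      extra 1 covers the delay of the approximating control.\<close>
    define S where "S = (j + c\<^sub>2 * (N + 1)) / c\<^sub>1"
    have S: "S > 0"
      using j c N by (auto simp: S_def intro!: divide_pos_pos add_nonneg_pos)
    have "c\<^sub>1 * S - c\<^sub>2 * integral {0..S} (\<lambda>s. relax (\<lambda>_. \<tau>) (\<xi> s) (\<mu> s)) =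
        integral {0..S} (\<lambda>s. c\<^sub>1 - c\<^sub>2 * relax (\<lambda>_. \<tau>) (\<xi> s) (\<mu> s))"
      using S r\<tau>c by (subst integral_diff) auto
    also have "\<dots> \<le> integral {0..S} (\<lambda>s. relax L (\<xi> s) (\<mu> s))"
      using r\<tau>c rL relaxed_coercive[OF relaxed_controls_radon[OF \<mu>]]
      by (intro integral_le integrable_diff) auto
    also have "\<dots> \<le> j" by (rule le_j)
    finally have "c\<^sub>1 * S - j \<le> c\<^sub>2 * integral {0..S} (\<lambda>s. relax (\<lambda>_. \<tau>) (\<xi> s) (\<mu> s))"
      by simp
    moreover have "c\<^sub>1 * S - j = c\<^sub>2 * (N + 1)"
      using c by (simp add: S_def)
    ultimately have clock: "N + 1 \<le> integral {0..S} (\<lambda>s. relax (\<lambda>_. \<tau>) (\<xi> s) (\<mu> s))"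
      using c by simp
    obtain w where w: "w \<in> ordinary"
      "integral {0..S} (\<lambda>s. L (state w x s) (w s)) \<le> integral {0..S} (\<lambda>s. relax L (\<xi> s) (\<mu> s)) + e"
      "integral {0..S} (\<lambda>s. relax (\<lambda>_. \<tau>) (\<xi> s) (\<mu> s)) - e \<le> clock w S"
      using chattering_control[OF \<mu> S e(1) \<xi>_def] by blast
    have "discounted \<delta> (state w x S) < ennreal (\<bar>k\<bar> + 1)"
      using bounded[of "state w x S"] by (rule le_less_trans) (intro ennreal_lessI; simp)
    then obtain v where v: "v \<in> admissible" "cost \<delta> (state w x S) v < ennreal (\<bar>k\<bar> + 1)"
      unfolding discounted_def by (auto simp: INF_less_iff)
    have "discounted \<delta> x \<le> (\<integral>\<^sup>+s\<in>{0..S}. ennreal (L (state w x s) (w s)) \<partial>lebesgue) +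
        ennreal (exp (- \<delta> * clock w S)) * cost \<delta> (state w x S) v"
      using S by (intro discounted_switch_le w v \<delta>) auto
    also have "(\<integral>\<^sup>+s\<in>{0..S}. ennreal (L (state w x s) (w s)) \<partial>lebesgue) = ennreal (integral {0..S} (\<lambda>s. L (state w x s) (w s)))"
      using L_nonneg ordinaryD[OF w(1)]
      by (intro set_nn_integral_eq_integral ordinary_absolutely_integrable[OF L_cont] w state_continuous) auto
    also have "\<dots> \<le> ennreal (j + \<epsilon> / 2)"
      using w(2) le_j[of S] e by (intro ennreal_leI) linarith
    also have "ennreal (exp (- \<delta> * clock w S)) * cost \<delta> (state w x S) v \<le>
        ennreal (exp (- \<delta> * N)) * ennreal (\<bar>k\<bar> + 1)"
      using w(3) clock e v(2) \<delta> by (intro mult_mono ennreal_leI) (auto simp: less_imp_le)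
    also have "\<dots> \<le> ennreal (\<epsilon> / 2)"
      using N(2) by (subst ennreal_mult[symmetric]) (auto intro!: ennreal_leI)
    also have "ennreal (j + \<epsilon> / 2) + ennreal (\<epsilon> / 2) = J + ennreal \<epsilon>"
      using j \<epsilon> by (simp add: ennreal_plus[symmetric] del: ennreal_plus)
    finally show "discounted \<delta> x \<le> J + ennreal \<epsilon>"
      by (simp add: add_mono)
  qed
qed

end

section \<open>The lower bound\<close>

text \<open>A diagonal subsequence converges at the rational times; the common Lipschitz bound makes
  it Cauchy at every other time by comparison with a nearby rational one.\<close>

lemma lipschitz_convergent_subsequence:
  fixes u :: "nat \<Rightarrow> real \<Rightarrow> 'b::euclidean_space"
  assumes bound: "\<And>T. \<exists>b. \<forall>n. \<forall>s\<in>{0..T}. norm (u n s) \<le> b"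
    and lip: "\<And>T. \<exists>c. \<forall>n. \<forall>r\<in>{0..T}. \<forall>s\<in>{0..T}. norm (u n s - u n r) \<le> c * \<bar>s - r\<bar>"
  obtains k :: "nat \<Rightarrow> nat" and v where "strict_mono k"
    "\<And>s. 0 \<le> s \<Longrightarrow> (\<lambda>n. u (k n) s) \<longlonglongrightarrow> v s"
proof -
  have "\<forall>T. \<exists>b. \<forall>n. \<forall>s\<in>{0..T}. norm (u n s) \<le> b"
    using bound by blast
  from choice[OF this] obtain b where "\<forall>T n. \<forall>s\<in>{0..T}. norm (u n s) \<le> b T"
    by blast
  then have b: "norm (u n s) \<le> b T" if "s \<in> {0..T}" for T n s
    using that by blast
  have b0: "0 < 1 + b s" if "0 \<le> s" for s
  proof -
    have "norm (u 0 s) \<le> b s"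
      using that by (intro b) auto
    then show ?thesis
      using norm_ge_zero[of "u 0 s"] by linarith
  qed
  \<comment> \<open>The values are rescaled time by time to the uniform bound 1 that the diagonal
    argument requires; the convergence at a fixed time is unaffected.\<close>
  define f where "f n s = inverse (1 + b s) *\<^sub>R u n s" for n s
  have "norm (f n s) \<le> 1" if "s \<in> \<rat> \<inter> {0..}" for n s
    using that b[of s s n] b0[of s] by (simp add: f_def divide_simps)
  moreover have "countable (\<rat> \<inter> {0::real..})"
    using countable_rat by (rule countable_subset[rotated]) auto
  ultimately obtain k :: "nat \<Rightarrow> nat" where k: "strict_mono k"
    "\<And>s. s \<in> \<rat> \<inter> {0..} \<Longrightarrow> \<exists>l. (\<lambda>n. f (k n) s) \<longlonglongrightarrow> l"
    using function_convergent_subsequence[of "\<rat> \<inter> {0..}" f 1] by metis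
  have rat: "convergent (\<lambda>n. u (k n) s)" if s: "s \<in> \<rat> \<inter> {0..}" for s
  proof -
    obtain l where "(\<lambda>n. f (k n) s) \<longlonglongrightarrow> l"
      using k(2)[OF s] by blast
    from tendsto_scaleR[OF tendsto_const this, of "1 + b s"]
    have "(\<lambda>n. (1 + b s) *\<^sub>R f (k n) s) \<longlonglongrightarrow> (1 + b s) *\<^sub>R l" .
    then show ?thesis
      using b0[of s] s by (auto simp: f_def convergent_def)
  qed
  have "Cauchy (\<lambda>n. u (k n) s)" if s: "0 \<le> s" for s
  proof (rule CauchyI)
    fix e :: real assume e: "0 < e"
    obtain c where c: "\<And>n r s'. r \<in> {0..s+1} \<Longrightarrow> s' \<in> {0..s+1} \<Longrightarrow> norm (u n s' - u n r) \<le> c * \<bar>s' - r\<bar>"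
      using lip[of "s + 1"] by blast
    define d where "d = min 1 (e / (3 * (\<bar>c\<bar> + 1)))"
    have d: "d > 0" using e by (simp add: d_def add_nonneg_pos)
    obtain r where r: "r \<in> \<rat>" "s < r" "r < s + d"
      using Rats_dense_in_real[of s "s + d"] d by auto
    have "norm (u n s - u n r) \<le> e / 3" for n
    proof -
      have "norm (u n s - u n r) \<le> c * \<bar>s - r\<bar>"
        using r s by (intro c) (auto simp: d_def)
      also have "\<dots> \<le> (\<bar>c\<bar> + 1) * (e / (3 * (\<bar>c\<bar> + 1)))"
        using r s by (intro mult_mono) (auto simp: d_def)
      also have "\<dots> = e / 3"
        by (simp add: field_simps add_eq_0_iff_both_eq_0)
      finally show ?thesis .
    qed
    then have close: "norm (u (k n) s - u (k n) r) \<le> e / 3" "norm (u (k n) r - u (k n) s) \<le> e / 3" for n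
      by (auto simp: norm_minus_commute)
    have "Cauchy (\<lambda>n. u (k n) r)"
      using rat[of r] r s by (auto intro: convergent_Cauchy)
    then obtain N where N: "\<And>m n. m \<ge> N \<Longrightarrow> n \<ge> N \<Longrightarrow> norm (u (k m) r - u (k n) r) < e / 3"
      using CauchyD[of "\<lambda>n. u (k n) r" "e / 3"] e by auto
    have "norm (u (k m) s - u (k n) s) < e" if "m \<ge> N" "n \<ge> N" for m n
    proof -
      have "norm (u (k m) s - u (k n) s) =
          norm ((u (k m) s - u (k m) r) + (u (k m) r - u (k n) r) + (u (k n) r - u (k n) s))"
        by simp
      then have "norm (u (k m) s - u (k n) s) \<le>
          norm (u (k m) s - u (k m) r) + norm (u (k m) r - u (k n) r) + norm (u (k n) r - u (k n) s)"
        using norm_triangle_ineq[of "(u (k m) s - u (k m) r) + (u (k m) r - u (k n) r)" "u (k n) r - u (k n) s"]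
          norm_triangle_ineq[of "u (k m) s - u (k m) r" "u (k m) r - u (k n) r"] by linarith
      then show ?thesis
        using close(1)[of m] close(2)[of n] N[OF that] by linarith
    qed
    then show "\<exists>M. \<forall>m\<ge>M. \<forall>n\<ge>M. norm (u (k m) s - u (k n) s) < e" by blast
  qed
  then have "\<exists>v. (\<lambda>n. u (k n) s) \<longlonglongrightarrow> v" if "0 \<le> s" for s
    using that by (simp add: Cauchy_convergent_iff convergent_def)
  then obtain v where "\<And>s. 0 \<le> s \<Longrightarrow> (\<lambda>n. u (k n) s) \<longlonglongrightarrow> v s"
    by metis
  then show ?thesis
    using that k(1) by blast
qed

lemma midpoint_hull_integral:
  fixes g :: "nat \<Rightarrow> real \<Rightarrow> 'e::euclidean_space"
  assumes "u \<in> midpoint_hull g N" "convex Q"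
    and "\<And>k. N \<le> k \<Longrightarrow> g k integrable_on S" "\<And>k. N \<le> k \<Longrightarrow> integral S (g k) \<in> Q"
  shows "u integrable_on S \<and> integral S u \<in> Q"
  using assms(1)
proof induction
  case (mid u v)
  have "((\<lambda>s. (1/2) *\<^sub>R (u s + v s)) has_integral (1/2) *\<^sub>R (integral S u + integral S v)) S"
    using mid by (intro has_integral_cmul has_integral_add integrable_integral) auto
  moreover have "(1/2) *\<^sub>R integral S u + (1/2) *\<^sub>R integral S v \<in> Q"
    using mid by (intro convexD[OF assms(2)]) auto
  ultimately show ?case
    by (metis has_integral_integrable integral_unique scaleR_add_right)
qed (use assms(3,4) in auto)

lemma set_nn_integral_half_line_le:
  fixes f :: "real \<Rightarrow> ennreal"
  assumes f: "f \<in> borel_measurable (lebesgue_on {0..})"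
    and le: "\<And>T. 0 \<le> T \<Longrightarrow> (\<integral>\<^sup>+s\<in>{0..T}. f s \<partial>lebesgue) \<le> c"
  shows "(\<integral>\<^sup>+s\<in>{0..}. f s \<partial>lebesgue) \<le> c"
proof -
  have "(\<integral>\<^sup>+s\<in>{0..}. f s \<partial>lebesgue) = (\<integral>\<^sup>+s. (SUP n::nat. f s * indicator {0..real n} s) \<partial>lebesgue)"
  proof (rule nn_integral_cong)
    fix s :: real
    obtain n :: nat where n: "s \<le> n"
      using real_arch_simple by blast
    show "f s * indicator {0..} s = (SUP n::nat. f s * indicator {0..real n} s)"
    proof (rule antisym)
      have "f s * indicator {0..} s \<le> f s * indicator {0..real n} s"
        using n by (auto simp: indicator_def)
      then show "f s * indicator {0..} s \<le> (SUP n::nat. f s * indicator {0..real n} s)"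
        by (rule order_trans) (rule SUP_upper, simp)
    qed (auto intro!: SUP_least simp: indicator_def)
  qed
  also have "\<dots> = (SUP n::nat. \<integral>\<^sup>+s\<in>{0..real n}. f s \<partial>lebesgue)"
  proof (rule nn_integral_monotone_convergence_SUP)
    show "incseq (\<lambda>n::nat. \<lambda>s. f s * indicator {0..real n} s)"
      by (auto simp: incseq_def le_fun_def indicator_def)
    show "(\<lambda>s. f s * indicator {0..real n} s) \<in> borel_measurable lebesgue" for n :: nat
      using measurable_restrict_mono[OF f, of "{0..real n}"]
      by (subst borel_measurable_restrict_space_iff_ennreal[symmetric]) auto
  qed
  also have "\<dots> \<le> c"
    by (intro SUP_least le) simp
  finally show ?thesis .
qed

lemma AE_half_line_negligible:
  assumes "AE s in lebesgue_on {0::real..}. P s"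
  shows "negligible {s \<in> {0..}. \<not> P s}"
proof -
  have "AE s in lebesgue. s \<in> {0..} \<longrightarrow> P s"
    using assms by (subst (asm) AE_restrict_space_iff) auto
  then obtain N where "{s \<in> space lebesgue. \<not> (s \<in> {0..} \<longrightarrow> P s)} \<subseteq> N" "N \<in> null_sets lebesgue"
    by (rule AE_E) (auto simp: null_sets_def)
  moreover have "{s \<in> {0..}. \<not> P s} \<subseteq> {s \<in> space lebesgue. \<not> (s \<in> {0..} \<longrightarrow> P s)}"
    by auto
  ultimately show ?thesis
    unfolding negligible_iff_null_sets[symmetric] by (meson negligible_subset order_trans)
qed

lemma sigma_finite_half_line: "sigma_finite_measure (lebesgue_on {0::real..})"
proof
  let ?A = "range (\<lambda>n::nat. {0..real n})"
  have "(\<Union>?A) = {0..}"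
    using real_arch_simple by (auto simp: image_iff)
  moreover have "?A \<subseteq> sets (lebesgue_on {0..})"
    by (auto simp: sets_restrict_space_iff)
  moreover have "emeasure (lebesgue_on {0..}) a \<noteq> \<infinity>" if "a \<in> ?A" for a
    using that by (auto simp: emeasure_restrict_space)
  ultimately show "\<exists>A. countable A \<and> A \<subseteq> sets (lebesgue_on {0::real..}) \<and> \<Union> A = space (lebesgue_on {0..}) \<and>
      (\<forall>a\<in>A. emeasure (lebesgue_on {0..}) a \<noteq> \<infinity>)"
    by (intro exI[of _ ?A]) auto
qed

context control_problem
begin

text \<open>The controls need not converge. Only the state argument is replaced, and the modulus of
  continuity of \<Phi> in the state is uniform over \<open>K\<close>, so the integrand tends to zero
  at each time, under a constant bound.\<close>

lemma ordinary_integral_tendsto: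
  fixes \<Phi> :: "real ^ 'n \<Rightarrow> 'a \<Rightarrow> 'b::euclidean_space"
  assumes \<Phi>: "continuous_on (UNIV \<times> K) (\<lambda>(x, a). \<Phi> x a)"
    and w: "\<And>n. w n \<in> ordinary" and y: "\<And>n. continuous_on {0..} (y n)" and \<xi>: "continuous_on {0..} \<xi>"
    and lim: "\<And>s. 0 \<le> s \<Longrightarrow> (\<lambda>n. y n s) \<longlonglongrightarrow> \<xi> s"
    and R: "\<And>n s. s \<in> {0..t} \<Longrightarrow> norm (y n s) \<le> R"
  shows "(\<lambda>n. integral {0..t} (\<lambda>s. \<Phi> (y n s) (w n s)) - integral {0..t} (\<lambda>s. \<Phi> (\<xi> s) (w n s))) \<longlonglongrightarrow> 0"
proof -
  have R': "norm (\<xi> s) \<le> R" if "s \<in> {0..t}" for s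
    using that lim by (intro LIMSEQ_le_const2[OF tendsto_norm[OF lim]] exI[of _ 0]) (auto intro: R)
  obtain b where b: "b > 0" "\<And>x a. x \<in> cball 0 R \<Longrightarrow> a \<in> K \<Longrightarrow> norm (\<Phi> x a) \<le> b"
    using bounded_on_compact[OF \<Phi> K compact_cball[of 0 R]] by blast
  have i: "(\<lambda>s. \<Phi> (y n s) (w n s)) integrable_on {0..t}" "(\<lambda>s. \<Phi> (\<xi> s) (w n s)) integrable_on {0..t}" for n
    using ordinary_absolutely_integrable[OF \<Phi> w] y \<xi> set_lebesgue_integral_eq_integral(1) by blast+
  have "(\<lambda>n. integral {0..t} (\<lambda>s. \<Phi> (y n s) (w n s) - \<Phi> (\<xi> s) (w n s))) \<longlonglongrightarrow> integral {0..t} (\<lambda>_. 0)"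
  proof (rule dominated_convergence(2))
    show "(\<lambda>s. \<Phi> (y n s) (w n s) - \<Phi> (\<xi> s) (w n s)) integrable_on {0..t}" for n
      using i by (rule integrable_diff)
    show "(\<lambda>_. 2 * b) integrable_on {0..t}"
      by (rule integrable_const_ivl)
    fix s assume s: "s \<in> {0..t}"
    show "norm (\<Phi> (y n s) (w n s) - \<Phi> (\<xi> s) (w n s)) \<le> 2 * b" for n
    proof -
      have "w n s \<in> K" using ordinaryD[OF w] s by auto
      then have "norm (\<Phi> (y n s) (w n s)) \<le> b" "norm (\<Phi> (\<xi> s) (w n s)) \<le> b"
        using b(2) R[OF s] R'[OF s] by auto
      then show ?thesis
        using norm_triangle_ineq4[of "\<Phi> (y n s) (w n s)" "\<Phi> (\<xi> s) (w n s)"] by linarith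
    qed
    show "(\<lambda>n. \<Phi> (y n s) (w n s) - \<Phi> (\<xi> s) (w n s)) \<longlonglongrightarrow> 0"
    proof (rule LIMSEQ_I)
      fix e :: real assume "0 < e"
      then obtain d where d: "d > 0" "\<And>x y a. x \<in> cball 0 R \<Longrightarrow> y \<in> cball 0 R \<Longrightarrow> a \<in> K \<Longrightarrow> dist x y < d \<Longrightarrow>
          norm (\<Phi> x a - \<Phi> y a) < e"
        using uniform_modulus[OF \<Phi> K compact_cball[of 0 R]] by metis
      obtain N where N: "\<And>n. n \<ge> N \<Longrightarrow> norm (y n s - \<xi> s) < d"
        using LIMSEQ_D[OF lim[of s] d(1)] s by auto
      have "norm (\<Phi> (y n s) (w n s) - \<Phi> (\<xi> s) (w n s) - 0) < e" if "n \<ge> N" for n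
        using d(2)[of "y n s" "\<xi> s" "w n s"] N[OF that] R[OF s] R'[OF s] ordinaryD[OF w] s
        by (auto simp: dist_norm)
      then show "\<exists>N. \<forall>n\<ge>N. norm (\<Phi> (y n s) (w n s) - \<Phi> (\<xi> s) (w n s) - 0) < e" by blast
    qed
  qed
  moreover have "integral {0..t} (\<lambda>s. \<Phi> (y n s) (w n s) - \<Phi> (\<xi> s) (w n s)) =
      integral {0..t} (\<lambda>s. \<Phi> (y n s) (w n s)) - integral {0..t} (\<lambda>s. \<Phi> (\<xi> s) (w n s))" for n
    using i by (intro integral_diff)
  ultimately show ?thesis by simp
qed

text \<open>Along a subsequence the states converge to some \<open>\<xi>\<close>. The velocities and running costs frozen at \<open>\<xi>\<close> have
  almost everywhere convergent convex combinations, and their limit takes values in the convex hulls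
  generated by the data along \<open>\<xi>\<close>, so it comes from a relaxed control with trajectory \<open>\<xi>\<close>.\<close>

lemma relaxed_value_le_limit:
  fixes w :: "nat \<Rightarrow> real \<Rightarrow> 'a"
  assumes w: "\<And>n. w n \<in> ordinary"
    and lim: "\<And>S e. 0 \<le> S \<Longrightarrow> 0 < e \<Longrightarrow> \<exists>N. \<forall>n\<ge>N. integral {0..S} (\<lambda>s. L (state (w n) x s) (w n s)) \<le> c + e"
  shows "relaxed_value K F L x \<le> ennreal c"
proof -
  define R where "R T = (1 + norm x) * exp (B * T)" for T
  have state_le: "norm (state (w n) x s) \<le> R T" if "s \<in> {0..T}" for n s T
  proof -
    have "norm (state (w n) x s) \<le> (1 + norm x) * exp (B * s)"
      using that by (intro lipschitz_field.trajectory_bound[OF lipschitz_field_ordinary[OF w]]) auto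
    also have "\<dots> \<le> R T"
      using that B by (auto simp: R_def intro!: mult_left_mono)
    finally show ?thesis .
  qed
  have state_lip: "norm (state (w n) x s - state (w n) x r) \<le> B * (1 + R T) * \<bar>s - r\<bar>"
    if "r \<in> {0..T}" "s \<in> {0..T}" for n r s T
  proof (cases "r \<le> s")
    case True
    then show ?thesis
      using lipschitz_field.trajectory_lipschitz[OF lipschitz_field_ordinary[OF w], of r s T n x] that
      by (simp add: R_def)
  next
    case False
    then show ?thesis
      using lipschitz_field.trajectory_lipschitz[OF lipschitz_field_ordinary[OF w], of s r T n x] that
      by (simp add: R_def norm_minus_commute)
  qed
  obtain k :: "nat \<Rightarrow> nat" and \<xi> where k: "strict_mono k"
    and \<xi>: "\<And>s. 0 \<le> s \<Longrightarrow> (\<lambda>n. state (w (k n)) x s) \<longlonglongrightarrow> \<xi> s"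
  proof (rule lipschitz_convergent_subsequence[of "\<lambda>n. state (w n) x"])
    show "\<exists>b. \<forall>n. \<forall>s\<in>{0..T}. norm (state (w n) x s) \<le> b" for T
      using state_le by blast
    show "\<exists>c. \<forall>n. \<forall>r\<in>{0..T}. \<forall>s\<in>{0..T}. norm (state (w n) x s - state (w n) x r) \<le> c * \<bar>s - r\<bar>" for T
      using state_lip by blast
  qed (rule that)
  define u where "u n = w (k n)" for n
  have u: "u n \<in> ordinary" for n
    unfolding u_def by (rule w)
  define y where "y n = state (u n) x" for n
  have y: "(\<lambda>n. y n s) \<longlonglongrightarrow> \<xi> s" if "0 \<le> s" for s
    using \<xi>[OF that] by (simp add: y_def u_def)
  have cy: "continuous_on {0..} (y n)" for n
    unfolding y_def by (rule state_continuous[OF u])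
  have c\<xi>: "continuous_on {0..} \<xi>"
  proof (rule continuous_on_half_line)
    fix T :: real assume T: "0 \<le> T"
    have "norm (\<xi> s - \<xi> r) \<le> B * (1 + R T) * \<bar>s - r\<bar>" if "r \<in> {0..T}" "s \<in> {0..T}" for r s
      using that state_lip[OF that]
      by (intro LIMSEQ_le_const2[OF tendsto_norm[OF tendsto_diff[OF y y]]]) (auto simp: y_def u_def)
    then have "(B * (1 + R T))-lipschitz_on {0..T} \<xi>"
      using B by (intro lipschitz_onI) (auto simp: dist_norm R_def)
    then show "continuous_on {0..T} \<xi>"
      by (rule lipschitz_on_continuous_on)
  qed
  define \<psi> where "\<psi> s a = (F (\<xi> s) a, L (\<xi> s) a)" for s a
  define \<Phi> where "\<Phi> z a = (F z a, L z a)" for z a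
  have \<Phi>: "continuous_on (UNIV \<times> K) (\<lambda>(x, a). \<Phi> x a)"
    using F_cont L_cont unfolding \<Phi>_def case_prod_beta by (intro continuous_on_Pair)
  have \<psi>_cont: "continuous_on K (\<psi> s)" for s
    using continuous_on_section[OF \<Phi>, of "\<xi> s"] by (simp add: \<Phi>_def[abs_def] \<psi>_def[abs_def])
  \<comment> \<open>With the state frozen at \<xi>, all \<open>g n s\<close> lie in the image of
    \<open>K\<close> under \<open>\<psi> s\<close>, a set independent of \<open>n\<close>; hence
    convex combinations and their limits stay in one compact hull.\<close>
  define g where "g n s = \<psi> s (u n s)" for n s
  have g_mem: "g n s \<in> \<psi> s ` K" if "0 \<le> s" for n s
    unfolding g_def using ordinaryD(1)[OF u that] by blast
  have g_meas: "g n \<in> borel_measurable (lebesgue_on {0..})" for n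
    using borel_measurable_continuous_pair[OF \<Phi> borel_measurable_lebesgue_on_continuous[OF c\<xi>]
        ordinary_measurable[OF u[of n]]] ordinaryD(1)[OF u]
    by (simp add: g_def[abs_def] \<psi>_def \<Phi>_def)
  have \<psi>_bound: "\<exists>b. \<forall>s\<in>{0..T}. \<forall>a\<in>K. norm (\<psi> s a) \<le> b" for T
  proof -
    have "compact (\<xi> ` {0..T})"
      by (intro compact_continuous_image continuous_on_subset[OF c\<xi>]) auto
    from bounded_on_compact[OF \<Phi> K this] show ?thesis
      unfolding \<psi>_def \<Phi>_def by (metis imageI)
  qed
  have hull_compact: "compact (convex hull (\<psi> s ` K))" for s
    by (intro compact_convex_hull compact_continuous_image \<psi>_cont K)
  obtain h where h: "\<And>n. h n \<in> midpoint_hull g n" "AE s in lebesgue_on {0..}. convergent (\<lambda>n. h n s)"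
  proof (rule mazur_AE[OF sigma_finite_half_line, of g])
    show "\<exists>b. \<forall>n. norm (g n s) \<le> b" if "s \<in> space (lebesgue_on {0..})" for s
    proof -
      have s: "0 \<le> s" using that by simp
      obtain b where "\<forall>s'\<in>{0..s}. \<forall>a\<in>K. norm (\<psi> s' a) \<le> b"
        using \<psi>_bound by blast
      then have "\<forall>n. norm (g n s) \<le> b"
        using s ordinaryD(1)[OF u s] by (simp add: g_def)
      then show ?thesis by blast
    qed
  qed (use g_meas that in blast)+
  have h_meas: "h n \<in> borel_measurable (lebesgue_on {0..})" for n
    by (rule midpoint_hull_measurable[OF h(1) g_meas])
  have h_mem: "h n s \<in> convex hull (\<psi> s ` K)" if "0 \<le> s" for n s
    using g_mem[OF that] by (intro midpoint_hull_convex[OF h(1) convex_convex_hull]) (auto intro: hull_inc)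
  \<comment> \<open>On the null set where \<open>h\<close> diverges it is replaced by the constant
    sequence \<open>g 0 s\<close>. The limit \<open>H\<close> then exists and lies in the hull at
    every time, as the selection of a relaxed control demands.\<close>
  define h' where "h' n s = (if convergent (\<lambda>n. h n s) then h n s else g 0 s)" for n s
  define H where "H s = lim (\<lambda>n. h' n s)" for s
  have h'_lim: "(\<lambda>n. h' n s) \<longlonglongrightarrow> H s" for s
  proof -
    have "convergent (\<lambda>n. h' n s)"
      by (cases "convergent (\<lambda>n. h n s)") (auto simp: h'_def convergent_const)
    then show ?thesis
      unfolding H_def by (rule convergent_LIMSEQ_iff[THEN iffD1])
  qed
  have h'_mem: "h' n s \<in> convex hull (\<psi> s ` K)" if "0 \<le> s" for n s
    using h_mem[OF that] g_mem[OF that] by (auto simp: h'_def intro: hull_inc)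
  have h'_meas: "h' n \<in> borel_measurable (lebesgue_on {0..})" for n
  proof -
    have "{s \<in> space (lebesgue_on {0..}). convergent (\<lambda>n. h n s)} \<in> sets (lebesgue_on {0..})"
      unfolding Cauchy_convergent_iff[symmetric] using h_meas by (rule sets_Collect_Cauchy)
    then show ?thesis
      unfolding h'_def[abs_def] using h_meas g_meas by (intro measurable_If)
  qed
  have H_mem: "H s \<in> convex hull (\<psi> s ` K)" if "0 \<le> s" for s
    using closed_sequentially[OF compact_imp_closed[OF hull_compact] h'_mem[OF that] h'_lim] .
  have H_meas: "H \<in> borel_measurable (lebesgue_on {0..})"
    by (rule borel_measurable_LIMSEQ_metric[OF h'_meas h'_lim])
  obtain \<mu> where \<mu>: "\<mu> \<in> relaxed_controls K" "\<And>s. 0 \<le> s \<Longrightarrow> (LINT a|\<mu> s. \<psi> s a) = H s"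
  \<comment> \<open>Velocity and cost form a vector of dimension n + 1, so n + 2 atoms are needed in
    general; \<open>'n option option\<close> has exactly that many elements.\<close>
  proof (rule relaxed_control_selection[where 'i="'n option option", OF _ K _ \<psi>_cont H_meas H_mem])
    show "DIM((real ^ 'n) \<times> real) < CARD('n option option)"
      by simp
    show "(\<lambda>s. \<psi> s a) \<in> borel_measurable (lebesgue_on {0..})" if "a \<in> K" for a
      using borel_measurable_continuous_pair[OF \<Phi> borel_measurable_lebesgue_on_continuous[OF c\<xi>], of "\<lambda>_. a"] that
      by (simp add: \<psi>_def \<Phi>_def)
  qed auto
  have relax: "relax F (\<xi> s) (\<mu> s) = fst (H s)" "relax L (\<xi> s) (\<mu> s) = snd (H s)" if "0 \<le> s" for s
  proof -
    have "integrable (\<mu> s) (\<lambda>a. (F (\<xi> s) a, L (\<xi> s) a))"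
      using radon_prob_integrable[OF relaxed_controls_radon[OF \<mu>(1) that] K \<psi>_cont[of s]]
      by (simp add: \<psi>_def[abs_def])
    from integral_fst_snd[OF this] show "relax F (\<xi> s) (\<mu> s) = fst (H s)" "relax L (\<xi> s) (\<mu> s) = snd (H s)"
      using \<mu>(2)[OF that] by (simp_all add: relax_def \<psi>_def)
  qed
  have main: "integral {0..t} (\<lambda>s. relax F (\<xi> s) (\<mu> s)) = \<xi> t - x \<and>
      integral {0..t} (\<lambda>s. relax L (\<xi> s) (\<mu> s)) \<le> c" if t: "0 \<le> t" for t
  proof -
    have iFL: "(\<lambda>s. F (\<xi> s) (u n s)) integrable_on {0..t}" "(\<lambda>s. L (\<xi> s) (u n s)) integrable_on {0..t}" for n
      using ordinary_absolutely_integrable[OF F_cont u c\<xi>] ordinary_absolutely_integrable[OF L_cont u c\<xi>]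
        set_lebesgue_integral_eq_integral(1) by blast+
    have g_int: "(g n has_integral (integral {0..t} (\<lambda>s. F (\<xi> s) (u n s)), integral {0..t} (\<lambda>s. L (\<xi> s) (u n s)))) {0..t}" for n
      unfolding g_def[abs_def] \<psi>_def by (intro has_integral_Pair integrable_integral iFL)
    have R: "norm (y n s) \<le> R t" if "s \<in> {0..t}" for n s
      unfolding y_def u_def by (rule state_le[OF that])
    have F_lim: "(\<lambda>n. integral {0..t} (\<lambda>s. F (\<xi> s) (u n s))) \<longlonglongrightarrow> \<xi> t - x"
    proof -
      have "integral {0..t} (\<lambda>s. F (y n s) (u n s)) = y n t - x" for n
        using lipschitz_field.trajectory_eq[OF lipschitz_field_ordinary[OF u[of n]] t, of x] by (simp add: y_def)
      moreover have "(\<lambda>n. (y n t - x) - (integral {0..t} (\<lambda>s. F (y n s) (u n s)) -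
          integral {0..t} (\<lambda>s. F (\<xi> s) (u n s)))) \<longlonglongrightarrow> (\<xi> t - x) - 0"
        by (intro tendsto_diff tendsto_const y t ordinary_integral_tendsto[OF F_cont u cy c\<xi> y R])
      ultimately show ?thesis by simp
    qed
    have L_lim: "\<forall>\<^sub>F n in sequentially. integral {0..t} (\<lambda>s. L (\<xi> s) (u n s)) \<le> c + e" if e: "0 < e" for e
    proof -
      have "(\<lambda>n. integral {0..t} (\<lambda>s. L (y n s) (u n s)) - integral {0..t} (\<lambda>s. L (\<xi> s) (u n s))) \<longlonglongrightarrow> 0"
        by (rule ordinary_integral_tendsto[OF L_cont u cy c\<xi> y R])
      from tendstoD[OF this, of "e / 2"]
      have "\<forall>\<^sub>F n in sequentially. norm (integral {0..t} (\<lambda>s. L (y n s) (u n s)) -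
          integral {0..t} (\<lambda>s. L (\<xi> s) (u n s))) < e / 2"
        using e by simp
      moreover have "\<forall>\<^sub>F n in sequentially. integral {0..t} (\<lambda>s. L (y n s) (u n s)) \<le> c + e / 2"
      proof -
        obtain N where N: "\<And>n. n \<ge> N \<Longrightarrow> integral {0..t} (\<lambda>s. L (state (w n) x s) (w n s)) \<le> c + e / 2"
          using lim[OF t, of "e / 2"] e by auto
        have "integral {0..t} (\<lambda>s. L (y n s) (u n s)) \<le> c + e / 2" if "n \<ge> N" for n
          unfolding y_def u_def by (rule N) (use seq_suble[OF k, of n] that in linarith)
        then show ?thesis
          by (auto simp: eventually_sequentially)
      qed
      ultimately show ?thesis
        by eventually_elim (unfold real_norm_def abs_less_iff, linarith)
    qed
    have H_int: "(\<lambda>n. integral {0..t} (h n)) \<longlonglongrightarrow> integral {0..t} H"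
    proof -
      obtain b where b: "\<And>s a. s \<in> {0..t} \<Longrightarrow> a \<in> K \<Longrightarrow> norm (\<psi> s a) \<le> b"
        using \<psi>_bound by blast
      have h'_le: "norm (h' n s) \<le> b" if "s \<in> {0..t}" for n s
      proof -
        have "convex hull (\<psi> s ` K) \<subseteq> cball 0 b"
          using b[OF that] by (intro hull_minimal) auto
        then show ?thesis
          using h'_mem[of s n] that by auto
      qed
      have "(\<lambda>n. integral {0..t} (h' n)) \<longlonglongrightarrow> integral {0..t} H"
      proof (rule dominated_convergence(2))
        show "h' n integrable_on {0..t}" for n
          using h'_le by (intro set_lebesgue_integral_eq_integral(1) absolutely_integrable_bounded[OF h'_meas]) auto
        show "(\<lambda>_. b) integrable_on {0..t}"
          by (rule integrable_const_ivl)
      qed (use h'_le h'_lim in auto)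
      moreover have "integral {0..t} (h' n) = integral {0..t} (h n)" for n
        by (rule integral_spike[OF AE_half_line_negligible[OF h(2)]]) (auto simp: h'_def)
      ultimately show ?thesis by simp
    qed
    \<comment> \<open>The set is convex and closed and contains the integrals of \<open>g n\<close>
      for large \<open>n\<close>; since \<open>h n\<close> combines only terms from index
      \<open>n\<close> on, it contains the integrals of \<open>h n\<close>, hence that of the limit.
      A ball for the velocity and a half line for the cost yield, as \<open>e\<close> vanishes, an
      equality for the former and an inequality for the latter.\<close>
    have in_Q: "integral {0..t} H \<in> cball (\<xi> t - x) e \<times> {..c + e}" if e: "0 < e" for e
    proof -
      let ?Q = "cball (\<xi> t - x) e \<times> {..c + e}"
      have "\<forall>\<^sub>F n in sequentially. integral {0..t} (g n) \<in> ?Q"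
        using tendstoD[OF F_lim e] L_lim[OF e]
        by eventually_elim (auto simp: integral_unique[OF g_int] dist_commute)
      then obtain N where N: "\<And>n. n \<ge> N \<Longrightarrow> integral {0..t} (g n) \<in> ?Q"
        by (auto simp: eventually_sequentially)
      have "convex ?Q"
        by (intro convex_Times convex_cball convex_real_interval)
      then have "integral {0..t} (h n) \<in> ?Q" if "n \<ge> N" for n
        using midpoint_hull_integral[OF midpoint_hull_antimono[OF that h(1)], of ?Q "{0..t}"] N g_int by blast
      moreover have "closed ?Q"
        by (intro closed_Times closed_cball closed_atMost)
      ultimately show ?thesis
        using Lim_in_closed_set[OF _ _ _ H_int, of ?Q] by (auto simp: eventually_sequentially)
    qed
    have eq: "fst (integral {0..t} H) = \<xi> t - x" and le: "snd (integral {0..t} H) \<le> c"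
    proof -
      have "dist (\<xi> t - x) (fst (integral {0..t} H)) \<le> e" if "0 < e" for e
        using in_Q[OF that] by (auto simp: mem_Times_iff)
      then have "dist (\<xi> t - x) (fst (integral {0..t} H)) \<le> 0"
        using field_le_epsilon[of "dist (\<xi> t - x) (fst (integral {0..t} H))" 0] by simp
      then show "fst (integral {0..t} H) = \<xi> t - x" by simp
      show "snd (integral {0..t} H) \<le> c"
        by (rule field_le_epsilon) (use in_Q in \<open>auto simp: mem_Times_iff\<close>)
    qed
    have i: "(\<lambda>s. relax F (\<xi> s) (\<mu> s)) integrable_on {0..t}" "(\<lambda>s. relax L (\<xi> s) (\<mu> s)) integrable_on {0..t}"
      using relaxed_absolutely_integrable[OF F_cont \<mu>(1) c\<xi>] relaxed_absolutely_integrable[OF L_cont \<mu>(1) c\<xi>]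
        set_lebesgue_integral_eq_integral(1) by blast+
    have "((\<lambda>s. (relax F (\<xi> s) (\<mu> s), relax L (\<xi> s) (\<mu> s))) has_integral
        (integral {0..t} (\<lambda>s. relax F (\<xi> s) (\<mu> s)), integral {0..t} (\<lambda>s. relax L (\<xi> s) (\<mu> s)))) {0..t}"
      by (intro has_integral_Pair integrable_integral i)
    then have "(H has_integral
        (integral {0..t} (\<lambda>s. relax F (\<xi> s) (\<mu> s)), integral {0..t} (\<lambda>s. relax L (\<xi> s) (\<mu> s)))) {0..t}"
      by (rule has_integral_eq[rotated]) (simp add: relax)
    from integral_unique[OF this] show ?thesis
      using eq le by auto
  qed
  have "solves (\<lambda>s z. relax F z (\<mu> s)) x \<xi>"
    unfolding solves_alt using relaxed_absolutely_integrable[OF F_cont \<mu>(1) c\<xi>] main by auto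
  then have traj: "trajectory (\<lambda>s z. relax F z (\<mu> s)) x t = \<xi> t" if "0 \<le> t" for t
    using lipschitz_field.trajectory_unique[OF lipschitz_field_relaxed[OF \<mu>(1)]] that by blast
  have "relaxed_value K F L x \<le>
      (\<integral>\<^sup>+t\<in>{0..}. ennreal (relax L (trajectory (\<lambda>s z. relax F z (\<mu> s)) x t) (\<mu> t)) \<partial>lebesgue)"
    unfolding relaxed_value_def by (rule INF_lower[OF \<mu>(1)])
  also have "\<dots> = (\<integral>\<^sup>+t\<in>{0..}. ennreal (relax L (\<xi> t) (\<mu> t)) \<partial>lebesgue)"
    by (rule nn_integral_cong) (auto simp: indicator_def traj)
  also have "\<dots> \<le> ennreal c"
  proof (rule set_nn_integral_half_line_le)
    show "(\<lambda>t. ennreal (relax L (\<xi> t) (\<mu> t))) \<in> borel_measurable (lebesgue_on {0..})"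
      by (intro measurable_compose[OF relax_measurable[OF \<mu>(1) K L_cont
            borel_measurable_lebesgue_on_continuous[OF c\<xi>]]] measurable_ennreal)
    fix T :: real assume T: "0 \<le> T"
    have "(\<integral>\<^sup>+s\<in>{0..T}. ennreal (relax L (\<xi> s) (\<mu> s)) \<partial>lebesgue) =
        ennreal (integral {0..T} (\<lambda>s. relax L (\<xi> s) (\<mu> s)))"
      using relaxed_L_nonneg[OF relaxed_controls_radon[OF \<mu>(1)]]
      by (intro set_nn_integral_eq_integral relaxed_absolutely_integrable[OF L_cont \<mu>(1) c\<xi>]) auto
    then show "(\<integral>\<^sup>+s\<in>{0..T}. ennreal (relax L (\<xi> s) (\<mu> s)) \<partial>lebesgue) \<le> ennreal c"
      using main[OF T] by (simp add: ennreal_leI)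
  qed
  finally show ?thesis .
qed

text \<open>The upper bound holds for each single \<delta>. If the lower bound failed, there would
  be a sequence of discounts tending to 0 with controls of cost at most
  \<open>c + 1 / Suc n\<close>. As the clock stays below \<open>S\<close> on the interval from 0 to
  \<open>S\<close>, their undiscounted cost there is at most
  \<open>exp (\<delta> n * S) * (c + 1 / Suc n)\<close>, which tends to \<open>c\<close>; so
  \<open>relaxed_value_le_limit\<close> applies.\<close>

theorem discounted_tendsto:
  assumes bounded: "\<And>\<delta>. 0 < \<delta> \<Longrightarrow> \<exists>k. \<forall>x. discounted \<delta> x \<le> ennreal k"
  shows "((\<lambda>\<delta>. discounted \<delta> x) \<longlongrightarrow> relaxed_value K F L x) (at_right 0)"
proof (rule order_tendstoI)
  have upper: "discounted \<delta> x \<le> relaxed_value K F L x" if "0 < \<delta>" for \<delta>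
    using bounded[OF that] discounted_le_relaxed that by blast
  fix a
  show "\<forall>\<^sub>F \<delta> in at_right 0. discounted \<delta> x < a" if "relaxed_value K F L x < a"
    unfolding eventually_at_right_field using upper that
    by (intro exI[of _ 1]) (auto intro: le_less_trans)
  assume less: "a < relaxed_value K F L x"
  show "\<forall>\<^sub>F \<delta> in at_right 0. a < discounted \<delta> x"
  proof (rule ccontr)
    assume "\<not> ?thesis"
    then have *: "\<exists>\<delta>>0. \<delta> < b \<and> discounted \<delta> x \<le> a" if "b > 0" for b :: real
      using that unfolding eventually_at_right_field by (metis not_le)
    define c where "c = enn2real a"
    have c: "a = ennreal c" "0 \<le> c"
      using less_le_trans[OF less top_greatest] by (simp_all add: c_def)
    have "\<exists>\<delta> w. 0 < \<delta> \<and> \<delta> < 1 / Suc n \<and> w \<in> admissible \<and> cost \<delta> x w < ennreal (c + 1 / Suc n)" for n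
    proof -
      obtain \<delta> where \<delta>: "0 < \<delta>" "\<delta> < 1 / Suc n" "discounted \<delta> x \<le> a"
        using *[of "1 / Suc n"] by auto
      have "discounted \<delta> x < ennreal (c + 1 / Suc n)"
        using \<delta>(3) c by (intro le_less_trans[OF \<delta>(3)]) (auto intro!: ennreal_lessI add_nonneg_pos simp del: ennreal_plus)
      then obtain w where "w \<in> admissible" "cost \<delta> x w < ennreal (c + 1 / Suc n)"
        unfolding discounted_def by (auto simp: INF_less_iff)
      then show ?thesis using \<delta> by blast
    qed
    then obtain \<delta> w where \<delta>: "\<And>n. 0 < \<delta> n" "\<And>n. \<delta> n < 1 / Suc n"
      and w: "\<And>n. w n \<in> admissible" "\<And>n. cost (\<delta> n) x (w n) < ennreal (c + 1 / Suc n)"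
      by metis
    have wo: "w n \<in> ordinary" for n
      using w(1)[of n] by (simp add: admissible_def)
    have le: "integral {0..S} (\<lambda>s. L (state (w n) x s) (w n s)) \<le> exp (\<delta> n * S) * (c + 1 / Suc n)"
      if S: "0 \<le> S" for S n
    proof -
      have "ennreal (integral {0..S} (\<lambda>s. L (state (w n) x s) (w n s))) =
          (\<integral>\<^sup>+s\<in>{0..S}. ennreal (L (state (w n) x s) (w n s)) \<partial>lebesgue)"
        using L_nonneg ordinaryD[OF wo]
        by (intro set_nn_integral_eq_integral[symmetric] ordinary_absolutely_integrable[OF L_cont] wo state_continuous) auto
      also have "\<dots> \<le> (\<integral>\<^sup>+s. ennreal (exp (\<delta> n * S)) *
          (ennreal (exp (- \<delta> n * clock (w n) s) * L (state (w n) x s) (w n s)) * indicator {0..} s) \<partial>lebesgue)"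
      proof (rule nn_integral_mono)
        fix s
        show "ennreal (L (state (w n) x s) (w n s)) * indicator {0..S} s \<le> ennreal (exp (\<delta> n * S)) *
          (ennreal (exp (- \<delta> n * clock (w n) s) * L (state (w n) x s) (w n s)) * indicator {0..} s)"
        proof (cases "s \<in> {0..S}")
          case True
          then have l: "0 \<le> L (state (w n) x s) (w n s)"
            using L_nonneg ordinaryD[OF wo] by auto
          have "\<delta> n * clock (w n) s \<le> \<delta> n * S"
            using clock_le[OF wo[of n], of s] True \<delta>(1)[of n] by (intro mult_left_mono) (auto simp: less_imp_le)
          then have "1 * L (state (w n) x s) (w n s) \<le>
              exp (\<delta> n * S + - \<delta> n * clock (w n) s) * L (state (w n) x s) (w n s)"
            using l by (intro mult_right_mono) auto
          then have "L (state (w n) x s) (w n s) \<le>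
              exp (\<delta> n * S) * (exp (- \<delta> n * clock (w n) s) * L (state (w n) x s) (w n s))"
            by (simp only: exp_add mult.assoc mult_1)
          then show ?thesis
            using True l by (simp add: ennreal_mult[symmetric] ennreal_leI)
        qed auto
      qed
      also have "\<dots> = ennreal (exp (\<delta> n * S)) * cost (\<delta> n) x (w n)"
        unfolding cost_def
        by (intro nn_integral_cmult borel_measurable_restrict_space_iff_ennreal[THEN iffD1]
            cost_integrand_measurable wo) auto
      also have "\<dots> \<le> ennreal (exp (\<delta> n * S)) * ennreal (c + 1 / Suc n)"
        using w(2)[of n] by (intro mult_left_mono) auto
      also have "\<dots> = ennreal (exp (\<delta> n * S) * (c + 1 / Suc n))"
        using c by (intro ennreal_mult[symmetric]) auto
      finally show ?thesis
        using c by (subst (asm) ennreal_le_iff) auto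
    qed
    have "relaxed_value K F L x \<le> ennreal c"
    proof (rule relaxed_value_le_limit[OF wo])
      fix S e :: real assume S: "0 \<le> S" and e: "0 < e"
      have "\<delta> \<longlonglongrightarrow> 0"
        using \<delta> by (intro tendsto_sandwich[OF _ _ tendsto_const LIMSEQ_Suc[OF lim_const_over_n[of 1]]])
          (auto intro!: always_eventually less_imp_le)
      then have "(\<lambda>n. exp (\<delta> n * S) * (c + 1 / Suc n)) \<longlonglongrightarrow> exp (0 * S) * (c + 0)"
        by (intro tendsto_intros LIMSEQ_Suc[OF lim_const_over_n])
      then have "\<forall>\<^sub>F n in sequentially. exp (\<delta> n * S) * (c + 1 / Suc n) < c + e"
        using e by (intro order_tendstoD(2)) auto
      then obtain N where "\<And>n. n \<ge> N \<Longrightarrow> exp (\<delta> n * S) * (c + 1 / Suc n) < c + e"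
        by (auto simp: eventually_sequentially)
      then show "\<exists>N. \<forall>n\<ge>N. integral {0..S} (\<lambda>s. L (state (w n) x s) (w n s)) \<le> c + e"
        using le[OF S] by (meson less_imp_le order_trans)
    qed
    with less c(1) show False by simp
  qed
qed

end

section \<open>Change of time\<close>

text \<open>\<open>k\<close> is the rate of one time with respect to another. It is used in both
  directions: with the rate \<open>\<tau> (w s)\<close> of the original time in the new one, and
  with the rate \<open>1 + norm (\<alpha> t) ^ q\<close> of the new time in the original
  one.\<close>

locale time_change =
  fixes k :: "real \<Rightarrow> real"
  assumes rate_borel: "k \<in> borel_measurable (restrict_space borel {0..})"
    and rate_pos: "0 \<le> s \<Longrightarrow> 0 < k s"
    and rate_int: "0 \<le> s \<Longrightarrow> k integrable_on {0..s}"
    and rate_unbounded: "\<exists>s\<ge>0. T \<le> integral {0..s} k"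
begin

definition \<kappa> :: "real \<Rightarrow> real" where "\<kappa> s = integral {0..s} k"

lemma \<kappa>_0: "\<kappa> 0 = 0"
  by (simp add: \<kappa>_def)

lemma \<kappa>_nonneg: "0 \<le> s \<Longrightarrow> 0 \<le> \<kappa> s"
  unfolding \<kappa>_def by (intro integral_nonneg rate_int) (auto intro: less_imp_le rate_pos)

lemma \<kappa>_continuous: "continuous_on {0..} \<kappa>"
  unfolding \<kappa>_def[abs_def]
  by (intro continuous_on_half_line indefinite_integral_continuous_1 rate_int)

lemma rate_borel_ennreal: "(\<lambda>s. ennreal (k s) * indicator {0..} s) \<in> borel_measurable borel"
  using measurable_compose[OF rate_borel measurable_ennreal]
  by (subst borel_measurable_restrict_space_iff_ennreal[symmetric]) auto

lemma nn_integral_rate: "0 \<le> s \<Longrightarrow> (\<integral>\<^sup>+r\<in>{0..s}. ennreal (k r) \<partial>lborel) = ennreal (\<kappa> s)"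
  unfolding \<kappa>_def using rate_pos
  by (subst set_nn_integral_eq_integral[symmetric])
     (auto simp: nn_integral_completion less_imp_le intro!: nonnegative_absolutely_integrable_1 rate_int)

text \<open>A positive integrand with vanishing integral would force the interval to be a null
  set.\<close>

lemma \<kappa>_less:
  assumes "0 \<le> r" "r < s"
  shows "\<kappa> r < \<kappa> s"
proof -
  have eq: "\<kappa> r + integral {r..s} k = \<kappa> s"
    unfolding \<kappa>_def using assms by (intro Henstock_Kurzweil_Integration.integral_combine rate_int) auto
  have ki: "k integrable_on {r..s}"
    using integrable_subinterval_real[OF rate_int[of s]] assms by auto
  have "0 \<le> integral {r..s} k"
    using ki assms rate_pos by (intro integral_nonneg) (auto simp: less_imp_le)
  moreover have "integral {r..s} k \<noteq> 0"
  proof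
    assume 0: "integral {r..s} k = 0"
    have "(\<integral>\<^sup>+u\<in>{r..s}. ennreal (k u) \<partial>lebesgue) = ennreal (integral {r..s} k)"
      using ki assms rate_pos
      by (intro set_nn_integral_eq_integral nonnegative_absolutely_integrable_1) (auto simp: less_imp_le)
    then have "(\<integral>\<^sup>+u. ennreal (k u) * indicator {r..s} u \<partial>lborel) = 0"
      by (simp add: 0 nn_integral_completion)
    moreover have "(\<lambda>u. ennreal (k u) * indicator {r..s} u) \<in> borel_measurable lborel"
    proof -
      have "(\<lambda>u. ennreal (k u) * indicator {0..} u * indicator {r..s} u) \<in> borel_measurable borel"
        using rate_borel_ennreal by measurable
      also have "(\<lambda>u. ennreal (k u) * indicator {0..} u * indicator {r..s} u) = (\<lambda>u. ennreal (k u) * indicator {r..s} u)"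
        using assms by (auto simp: indicator_def)
      finally show ?thesis by simp
    qed
    ultimately have "AE u in lborel. ennreal (k u) * indicator {r..s} u = 0"
      by (subst (asm) nn_integral_0_iff_AE) auto
    then have "AE u in lborel. u \<notin> {r..s}"
    proof (rule eventually_mono)
      fix u assume "ennreal (k u) * indicator {r..s} u = 0"
      then show "u \<notin> {r..s}"
        using rate_pos[of u] assms(1) by (auto simp: ennreal_eq_0_iff)
    qed
    then have "emeasure lborel {r..s} = 0"
      by (subst (asm) AE_iff_measurable[of "{r..s}"]) auto
    then show False
      using assms by simp
  qed
  ultimately show ?thesis
    using eq by linarith
qed

lemma \<kappa>_le_iff: "0 \<le> r \<Longrightarrow> 0 \<le> s \<Longrightarrow> \<kappa> r \<le> \<kappa> s \<longleftrightarrow> r \<le> s"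
  using \<kappa>_less by (metis linorder_not_le order_le_less)

lemma \<kappa>_surj:
  assumes "0 \<le> T"
  shows "\<exists>s\<ge>0. \<kappa> s = T"
proof -
  obtain b where b: "0 \<le> b" "T \<le> \<kappa> b"
    using rate_unbounded[of T] by (auto simp: \<kappa>_def)
  have "\<exists>s\<ge>0. s \<le> b \<and> \<kappa> s = T"
    using b assms by (intro IVT' continuous_on_subset[OF \<kappa>_continuous]) (auto simp: \<kappa>_0)
  then show ?thesis by blast
qed

definition \<sigma> :: "real \<Rightarrow> real" where "\<sigma> T = (SOME s. 0 \<le> s \<and> \<kappa> s = T)"

lemma \<sigma>: "0 \<le> T \<Longrightarrow> 0 \<le> \<sigma> T" "0 \<le> T \<Longrightarrow> \<kappa> (\<sigma> T) = T"
  using someI_ex[OF \<kappa>_surj] by (auto simp: \<sigma>_def)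

lemma \<sigma>_\<kappa>: "0 \<le> s \<Longrightarrow> \<sigma> (\<kappa> s) = s"
  using \<sigma>[OF \<kappa>_nonneg] \<kappa>_le_iff by (metis order_antisym order_refl)

lemma \<sigma>_measurable: "\<sigma> \<in> measurable (restrict_space borel {0..}) (restrict_space borel {0..})"
proof (rule measurable_restrict_space2)
  have "mono_on {0..} \<sigma>"
    using \<sigma> \<kappa>_le_iff by (intro mono_onI) (metis atLeast_iff)
  then show "\<sigma> \<in> borel_measurable (restrict_space borel {0..})"
    by (rule borel_measurable_mono_on_fnc)
qed (auto simp: \<sigma>)

lemma \<kappa>_max_measurable: "(\<lambda>s. \<kappa> (max 0 s)) \<in> borel_measurable borel"
  by (intro borel_measurable_continuous_onI continuous_on_compose2[OF \<kappa>_continuous] continuous_intros) auto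

text \<open>The measure \<open>k ds\<close>, pushed forward by \<kappa>, is Lebesgue measure on the
  half line, since both give mass \<open>max 0 b\<close> to each initial segment. This yields the
  substitution rule for measurable integrands without differentiating \<kappa>; \<open>max 0\<close>
  extends \<kappa> to negative times, which carry no mass.\<close>

lemma distr_rate:
  "distr (density lborel (\<lambda>s. ennreal (k s) * indicator {0..} s)) borel (\<lambda>s. \<kappa> (max 0 s)) =
    density lborel (indicator {0..})" (is "?N = ?D")
proof (rule measure_eqI_generator_eq[where E="range (\<lambda>a. {..a})" and \<Omega>=UNIV and A="\<lambda>i. {..real i}"])
  show "Int_stable (range (\<lambda>a::real. {..a}))"
    by (auto simp: Int_stable_def)
  have D: "emeasure ?D {..b} = ennreal (max 0 b)" for b
  proof -
    have "emeasure ?D {..b} = (\<integral>\<^sup>+t. indicator {0..} t * indicator {..b} t \<partial>lborel)"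
      by (rule emeasure_density) auto
    also have "\<dots> = (\<integral>\<^sup>+t. indicator {0..b} t \<partial>lborel)"
      by (rule nn_integral_cong) (auto split: split_indicator)
    also have "\<dots> = emeasure lborel {0..b}"
      by (rule nn_integral_indicator) simp
    finally show ?thesis by (auto simp: max_def)
  qed
  have N: "emeasure ?N {..b} = ennreal (max 0 b)" for b
  proof -
    have "emeasure ?N {..b} = emeasure (density lborel (\<lambda>s. ennreal (k s) * indicator {0..} s)) ((\<lambda>s. \<kappa> (max 0 s)) -` {..b} \<inter> space borel)"
      using \<kappa>_max_measurable by (subst emeasure_distr) auto
    also have "\<dots> = (\<integral>\<^sup>+s. ennreal (k s) * indicator {0..} s * indicator ((\<lambda>s. \<kappa> (max 0 s)) -` {..b} \<inter> space borel) s \<partial>lborel)"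
      using rate_borel_ennreal measurable_sets[OF \<kappa>_max_measurable, of "{..b}"]
      by (intro emeasure_density) auto
    also have "\<dots> = ennreal (max 0 b)"
    proof (cases "0 \<le> b")
      case True
      have "\<kappa> s \<le> b \<longleftrightarrow> s \<le> \<sigma> b" if "0 \<le> s" for s
        using \<kappa>_le_iff[OF that \<sigma>(1)[OF True]] \<sigma>(2)[OF True] by simp
      then have "(\<integral>\<^sup>+s. ennreal (k s) * indicator {0..} s * indicator ((\<lambda>s. \<kappa> (max 0 s)) -` {..b} \<inter> space borel) s \<partial>lborel) =
          (\<integral>\<^sup>+s\<in>{0..\<sigma> b}. ennreal (k s) \<partial>lborel)"
        by (intro nn_integral_cong) (auto simp: indicator_def max_def)
      then show ?thesis
        using nn_integral_rate[OF \<sigma>(1)[OF True]] \<sigma>(2)[OF True] True by simp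
    next
      case False
      have "\<not> \<kappa> s \<le> b" if "0 \<le> s" for s
        using \<kappa>_nonneg[OF that] False by linarith
      then have "(\<integral>\<^sup>+s. ennreal (k s) * indicator {0..} s * indicator ((\<lambda>s. \<kappa> (max 0 s)) -` {..b} \<inter> space borel) s \<partial>lborel) =
          (\<integral>\<^sup>+(s::real). 0 \<partial>lborel)"
        by (intro nn_integral_cong) (auto simp: indicator_def max_def)
      then show ?thesis
        using False by simp
    qed
    finally show ?thesis .
  qed
  show "emeasure ?N X = emeasure ?D X" if "X \<in> range (\<lambda>a. {..a})" for X
    using that N D by auto
  show "sets ?N = sigma_sets UNIV (range (\<lambda>a. {..a}))" "sets ?D = sigma_sets UNIV (range (\<lambda>a. {..a}))"
    by (simp_all add: borel_eq_atMost)
  show "(\<Union>i. {..real i}) = UNIV"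
    using real_arch_simple by auto
  show "emeasure ?N {..real i} \<noteq> \<infinity>" for i
    by (simp add: N)
qed auto

lemma nn_integral_change:
  assumes g: "g \<in> borel_measurable (restrict_space borel {0..})"
  shows "(\<integral>\<^sup>+t\<in>{0..}. g t \<partial>lebesgue) = (\<integral>\<^sup>+s\<in>{0..}. g (\<kappa> s) * ennreal (k s) \<partial>lebesgue)"
proof -
  define g0 where "g0 t = g t * indicator {0..} t" for t
  have g0: "g0 \<in> borel_measurable borel"
    unfolding g0_def using g by (subst borel_measurable_restrict_space_iff_ennreal[symmetric]) auto
  have "(\<integral>\<^sup>+t\<in>{0..}. g t \<partial>lebesgue) = (\<integral>\<^sup>+t. indicator {0..} t * g0 t \<partial>lborel)"
    unfolding nn_integral_completion by (intro nn_integral_cong) (auto simp: g0_def indicator_def)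
  also have "\<dots> = integral\<^sup>N (density lborel (indicator {0..})) g0"
    using g0 by (intro nn_integral_density[symmetric]) auto
  also have "\<dots> = (\<integral>\<^sup>+s. g0 (\<kappa> (max 0 s)) \<partial>density lborel (\<lambda>s. ennreal (k s) * indicator {0..} s))"
    unfolding distr_rate[symmetric] using g0 \<kappa>_max_measurable by (intro nn_integral_distr) auto
  also have "\<dots> = (\<integral>\<^sup>+s. ennreal (k s) * indicator {0..} s * g0 (\<kappa> (max 0 s)) \<partial>lborel)"
    using rate_borel_ennreal measurable_compose[OF \<kappa>_max_measurable g0] by (intro nn_integral_density) auto
  also have "\<dots> = (\<integral>\<^sup>+s\<in>{0..}. g (\<kappa> s) * ennreal (k s) \<partial>lebesgue)"
    unfolding nn_integral_completion using \<kappa>_nonneg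
    by (intro nn_integral_cong) (auto simp: g0_def indicator_def max_def mult.commute)
  finally show ?thesis .
qed

text \<open>The hypothesis accepts integrability on either side, because the rule is applied in both
  directions. Both integrals are integrals of \<open>H\<close>, which is \<open>h\<close> cut off
  outside the interval from 0 to \<open>\<kappa> S\<close>, against the two forms of the measure in
  \<open>distr_rate\<close>.\<close>

lemma integral_change:
  fixes h :: "real \<Rightarrow> 'b::euclidean_space"
  assumes h: "h \<in> borel_measurable (restrict_space borel {0..})" and S: "0 \<le> S"
    and int: "(\<lambda>s. k s *\<^sub>R h (\<kappa> s)) absolutely_integrable_on {0..S} \<or> h absolutely_integrable_on {0..\<kappa> S}"
  shows "(\<lambda>s. k s *\<^sub>R h (\<kappa> s)) absolutely_integrable_on {0..S}" "h absolutely_integrable_on {0..\<kappa> S}"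
    "integral {0..\<kappa> S} h = integral {0..S} (\<lambda>s. k s *\<^sub>R h (\<kappa> s))"
proof -
  define H where "H t = indicator {..\<kappa> S} t *\<^sub>R (indicator {0..} t *\<^sub>R h t)" for t
  have h0: "(\<lambda>t. indicator {0..} t *\<^sub>R h t) \<in> borel_measurable borel"
    using h by (subst borel_measurable_restrict_space_iff[symmetric]) auto
  have H: "H \<in> borel_measurable borel"
    unfolding H_def using h0 by measurable
  define k0 where "k0 s = k s * indicator {0..} s" for s
  have k0: "k0 \<in> borel_measurable borel" "0 \<le> k0 s" for s
  proof -
    have "(\<lambda>s. indicator {0..} s *\<^sub>R k s) \<in> borel_measurable borel"
      using rate_borel by (subst borel_measurable_restrict_space_iff[symmetric]) auto
    then show "k0 \<in> borel_measurable borel"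
      by (simp add: k0_def[abs_def] mult.commute)
    show "0 \<le> k0 s"
      using rate_pos by (auto simp: k0_def indicator_def less_imp_le)
  qed
  let ?\<nu> = "density lborel (\<lambda>s. ennreal (k s) * indicator {0..} s)"
  have \<nu>: "?\<nu> = density lborel (\<lambda>s. ennreal (k0 s))"
    by (intro arg_cong2[where f=density] refl ext) (auto simp: k0_def indicator_def)
  have ind: "density lborel (indicator {0..}) = density lborel (\<lambda>t. ennreal (indicator {0..} t))"
    by (intro arg_cong2[where f=density] refl ext) (auto simp: indicator_def)
  note Hk = measurable_compose[OF \<kappa>_max_measurable H]
  have 1: "(\<lambda>t. indicator {0..} t *\<^sub>R H t) = (\<lambda>t. indicator {0..\<kappa> S} t *\<^sub>R h t)"
    by (auto simp: H_def indicator_def)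
  have 2: "(\<lambda>s. k0 s *\<^sub>R H (\<kappa> (max 0 s))) = (\<lambda>s. indicator {0..S} s *\<^sub>R (k s *\<^sub>R h (\<kappa> s)))"
    using \<kappa>_le_iff S \<kappa>_nonneg by (auto simp: H_def k0_def indicator_def max_def)
  have m1: "(\<lambda>t. indicator {0..\<kappa> S} t *\<^sub>R h t) \<in> borel_measurable lborel"
    unfolding 1[symmetric] using H by measurable
  have m2: "(\<lambda>s. indicator {0..S} s *\<^sub>R (k s *\<^sub>R h (\<kappa> s))) \<in> borel_measurable lborel"
    unfolding 2[symmetric] using k0(1) Hk by measurable
  have "h absolutely_integrable_on {0..\<kappa> S} \<longleftrightarrow> integrable lborel (\<lambda>t. indicator {0..} t *\<^sub>R H t)"
    unfolding set_integrable_def 1 using m1 by (intro integrable_completion) simp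
  also have "\<dots> \<longleftrightarrow> integrable (density lborel (indicator {0..})) H"
    unfolding ind using H by (intro integrable_density[symmetric]) auto
  also have "\<dots> \<longleftrightarrow> integrable ?\<nu> (\<lambda>s. H (\<kappa> (max 0 s)))"
    unfolding distr_rate[symmetric] using H \<kappa>_max_measurable by (intro integrable_distr_eq) auto
  also have "\<dots> \<longleftrightarrow> integrable lborel (\<lambda>s. k0 s *\<^sub>R H (\<kappa> (max 0 s)))"
    unfolding \<nu> using Hk k0 by (intro integrable_density) auto
  also have "\<dots> \<longleftrightarrow> (\<lambda>s. k s *\<^sub>R h (\<kappa> s)) absolutely_integrable_on {0..S}"
    unfolding set_integrable_def 2 using m2 by (intro integrable_completion[symmetric]) simp
  finally show i: "(\<lambda>s. k s *\<^sub>R h (\<kappa> s)) absolutely_integrable_on {0..S}" "h absolutely_integrable_on {0..\<kappa> S}"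
    using int by blast+
  have "integral {0..\<kappa> S} h = (LINT t|lebesgue. indicator {0..\<kappa> S} t *\<^sub>R h t)"
    using set_lebesgue_integral_eq_integral(2)[OF i(2)] by (simp add: set_lebesgue_integral_def)
  also have "\<dots> = (LINT t|lborel. indicator {0..} t *\<^sub>R H t)"
    unfolding 1 using m1 by (intro integral_completion) simp
  also have "\<dots> = integral\<^sup>L (density lborel (indicator {0..})) H"
    unfolding ind using H by (intro integral_density[symmetric]) auto
  also have "\<dots> = (LINT s|?\<nu>. H (\<kappa> (max 0 s)))"
    unfolding distr_rate[symmetric] using H \<kappa>_max_measurable by (intro integral_distr) auto
  also have "\<dots> = (LINT s|lborel. k0 s *\<^sub>R H (\<kappa> (max 0 s)))"
    unfolding \<nu> using Hk k0 by (intro integral_density) auto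
  also have "\<dots> = (LINT s|lebesgue. indicator {0..S} s *\<^sub>R (k s *\<^sub>R h (\<kappa> s)))"
    unfolding 2 using m2 by (intro integral_completion[symmetric]) simp
  also have "\<dots> = integral {0..S} (\<lambda>s. k s *\<^sub>R h (\<kappa> s))"
    using set_lebesgue_integral_eq_integral(2)[OF i(1)] by (simp add: set_lebesgue_integral_def)
  finally show "integral {0..\<kappa> S} h = integral {0..S} (\<lambda>s. k s *\<^sub>R h (\<kappa> s))" .
qed

end

section \<open>Compactification\<close>

text \<open>Inside the ball this is composition with \<Phi>. At the sphere, the value at a nearby
  \<open>(y, a)\<close> with \<open>r a \<noteq> 0\<close> is the rescaled \<Phi> with parameter
  \<rho> equal to \<open>r a\<close>, which is uniformly close to \<open>\<Phi>_inf y a\<close> once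
  \<open>r a\<close> is small; continuity of the recession function finishes the comparison.\<close>

lemma compactified_continuous:
  fixes \<Phi> \<Phi>_inf :: "'x::euclidean_space \<Rightarrow> 'a::euclidean_space \<Rightarrow> 'b::euclidean_space"
  assumes \<Phi>: "continuous_on (UNIV \<times> A) (\<lambda>(x, a). \<Phi> x a)"
    and rec: "recession q A \<Phi> \<Phi>_inf"
    and A: "closed A" "cone A" and q: "0 < q"
  shows "continuous_on (UNIV \<times> (cball 0 1 \<inter> A)) (\<lambda>(x, w). compactified q \<Phi> \<Phi>_inf x w)"
proof (rule continuous_on_eq_continuous_within[THEN iffD2], intro ballI)
  let ?S = "UNIV \<times> (cball 0 1 \<inter> A) :: ('x \<times> 'a) set"
  define r where "r w = root q (1 - norm w ^ q)" for w :: 'a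
  define \<Psi> where "\<Psi> = (\<lambda>(x, w). compactified q \<Phi> \<Phi>_inf x w)"
  have r_cont: "continuous_on UNIV r"
    unfolding r_def by (intro continuous_intros)
  have \<Psi>: "\<Psi> (x, w) = (if r w \<noteq> 0 then r w ^ q *\<^sub>R \<Phi> x (inverse (r w) *\<^sub>R w) else \<Phi>_inf x w)" for x w
    by (simp add: \<Psi>_def compactified_def extended_def r_def)
  have r_nonneg: "0 \<le> r w" if "norm w \<le> 1" for w
    using that by (simp add: r_def power_le_one real_root_ge_zero)
  fix p assume p: "p \<in> ?S"
  obtain x w where xw: "p = (x, w)" by (cases p)
  have w: "norm w \<le> 1" "w \<in> A"
    using p xw by auto
  show "continuous (at p within ?S) (\<lambda>(x, w). compactified q \<Phi> \<Phi>_inf x w)"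
    unfolding \<Psi>_def[symmetric]
  proof (cases "r w = 0")
    case False
    define U where "U = {p :: 'x \<times> 'a. r (snd p) \<noteq> 0}"
    have "open U"
      unfolding U_def by (intro open_Collect_neq continuous_on_compose2[OF r_cont] continuous_intros) auto
    have "continuous_on (?S \<inter> U) (\<lambda>p. r (snd p) ^ q *\<^sub>R \<Phi> (fst p) (inverse (r (snd p)) *\<^sub>R snd p))"
    proof (intro continuous_intros)
      show cr: "continuous_on (?S \<inter> U) (\<lambda>p. r (snd p))"
        by (intro continuous_on_compose2[OF r_cont] continuous_intros) auto
      have "continuous_on (?S \<inter> U) (\<lambda>p. (fst p, inverse (r (snd p)) *\<^sub>R snd p))"
        by (intro continuous_intros cr) (auto simp: U_def)
      moreover have "(\<lambda>p. (fst p, inverse (r (snd p)) *\<^sub>R snd p)) ` (?S \<inter> U) \<subseteq> UNIV \<times> A"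
        using A(2) r_nonneg by (auto simp: cone_def)
      ultimately show "continuous_on (?S \<inter> U) (\<lambda>p. \<Phi> (fst p) (inverse (r (snd p)) *\<^sub>R snd p))"
        using continuous_on_compose2[OF \<Phi>] by fastforce
    qed
    then have "continuous_on (?S \<inter> U) \<Psi>"
      by (rule continuous_on_eq) (auto simp: \<Psi> U_def)
    then have "continuous (at p within (?S \<inter> U)) \<Psi>"
      using p False by (auto simp: continuous_on_eq_continuous_within U_def xw)
    moreover have "at p within (?S \<inter> U) = at p within ?S"
      using False by (intro at_within_nhd[OF _ \<open>open U\<close>]) (auto simp: U_def xw)
    ultimately show "continuous (at p within ?S) \<Psi>" by simp
  next
    case True
    show "continuous (at p within ?S) \<Psi>"
      unfolding continuous_within
    proof (rule tendstoI)
      fix e :: real assume e: "0 < e"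
      have \<Phi>_inf: "continuous_on (UNIV \<times> A) (\<lambda>(x, a). \<Phi>_inf x a)"
        using rec by (simp add: recession_def)
      \<comment> \<open>A compact set containing all points of the domain within distance 1 of
        \<open>p\<close>; on it the convergence to the recession function is uniform.\<close>
      define C where "C = cball x 1 \<times> (cball 0 1 \<inter> A)"
      have "compact C"
        unfolding C_def using A(1) by (intro compact_Times compact_Int_closed) auto
      moreover have "C \<subseteq> UNIV \<times> A"
        by (auto simp: C_def)
      ultimately have "uniform_limit C (\<lambda>\<rho> (x, a). \<rho> ^ q *\<^sub>R \<Phi> x (inverse \<rho> *\<^sub>R a)) (\<lambda>(x, a). \<Phi>_inf x a) (at_right 0)"
        using rec by (simp add: recession_def)
      then have "\<forall>\<^sub>F \<rho> in at_right 0. \<forall>p\<in>C. dist (case p of (x, a) \<Rightarrow> \<rho> ^ q *\<^sub>R \<Phi> x (inverse \<rho> *\<^sub>R a)) (case p of (x, a) \<Rightarrow> \<Phi>_inf x a) < e / 2"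
        using e by (intro uniform_limitD) auto
      then obtain \<rho>0 where \<rho>0: "\<rho>0 > 0" "\<And>\<rho> y a. 0 < \<rho> \<Longrightarrow> \<rho> < \<rho>0 \<Longrightarrow> (y, a) \<in> C \<Longrightarrow>
          dist (\<rho> ^ q *\<^sub>R \<Phi> y (inverse \<rho> *\<^sub>R a)) (\<Phi>_inf y a) < e / 2"
        unfolding eventually_at_right_field by fastforce
      have "continuous_on ?S (\<lambda>p. r (snd p))"
        by (intro continuous_on_compose2[OF r_cont] continuous_intros) auto
      then have "((\<lambda>p. r (snd p)) \<longlongrightarrow> r (snd p)) (at p within ?S)"
        using p unfolding continuous_on_def by blast
      then have "\<forall>\<^sub>F p' in at p within ?S. r (snd p') < \<rho>0"
        using True \<rho>0(1) by (intro order_tendstoD(2)) (auto simp: xw)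
      moreover have "continuous_on ?S (\<lambda>(x, a). \<Phi>_inf x a)"
        by (rule continuous_on_subset[OF \<Phi>_inf]) auto
      then have "((\<lambda>(x, a). \<Phi>_inf x a) \<longlongrightarrow> (\<lambda>(x, a). \<Phi>_inf x a) p) (at p within ?S)"
        using p unfolding continuous_on_def by blast
      from tendstoD[OF this, of "e / 2"] e
      have "\<forall>\<^sub>F p' in at p within ?S. dist (case p' of (x, a) \<Rightarrow> \<Phi>_inf x a) (\<Phi>_inf x w) < e / 2"
        by (simp add: xw)
      moreover have "\<forall>\<^sub>F p' in at p within ?S. p' \<in> ?S \<and> dist p' p < 1"
        by (auto simp: eventually_at intro!: exI[of _ 1])
      ultimately show "\<forall>\<^sub>F p' in at p within ?S. dist (\<Psi> p') (\<Psi> p) < e"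
      proof eventually_elim
        case (elim p')
        obtain y a where ya: "p' = (y, a)" by (cases p')
        have a: "norm a \<le> 1" "a \<in> A"
          using elim(3) ya by auto
        have "dist y x \<le> dist p' p"
          using dist_fst_le[of p' p] by (simp add: ya xw)
        then have yaC: "(y, a) \<in> C"
          using elim(3) a by (auto simp: C_def dist_commute)
        have "dist (\<Psi> p') (\<Phi>_inf y a) < e / 2"
        proof (cases "r a = 0")
          case True
          then show ?thesis using e by (simp add: ya \<Psi>)
        next
          case False
          then have "0 < r a" using r_nonneg[OF a(1)] by simp
          then show ?thesis
            using \<rho>0(2)[of "r a" y a] elim(1) yaC False by (simp add: ya \<Psi>)
        qed
        moreover have "dist (\<Phi>_inf y a) (\<Psi> p) < e / 2"
          using elim(2) True by (simp add: ya xw \<Psi>)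
        ultimately show ?case
          using dist_triangle_half_r[of "\<Phi>_inf y a" "\<Psi> p'" e "\<Psi> p"] by (metis dist_commute)
      qed
    qed
  qed
qed

lemma borel_measurable_half_line_continuous_pair:
  fixes \<Phi> :: "'x::euclidean_space \<Rightarrow> 'a::euclidean_space \<Rightarrow> 'b::euclidean_space"
  assumes "continuous_on (UNIV \<times> A) (\<lambda>(x, a). \<Phi> x a)" "y \<in> borel_measurable (restrict_space borel {0::real..})"
    "\<alpha> \<in> borel_measurable (restrict_space borel {0..})" "\<And>t. 0 \<le> t \<Longrightarrow> \<alpha> t \<in> A"
  shows "(\<lambda>t. \<Phi> (y t) (\<alpha> t)) \<in> borel_measurable (restrict_space borel {0..})"
  by (rule borel_measurable_continuous_pair[OF assms(1-3)])
     (use assms(4) in \<open>auto simp: space_restrict_space\<close>)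

section \<open>Reduction of the problem with unbounded controls to a compact control set\<close>

locale unbounded_problem =
  fixes A :: "'a::euclidean_space set"
    and f f_inf :: "real ^ 'n \<Rightarrow> 'a \<Rightarrow> real ^ 'n" and l l_inf :: "real ^ 'n \<Rightarrow> 'a \<Rightarrow> real"
    and p q :: nat and M C\<^sub>1 C\<^sub>2 :: real
  assumes A: "closed A" "cone A"
    and f_cont: "continuous_on (UNIV \<times> A) (\<lambda>(x, a). f x a)"
    and l_cont: "continuous_on (UNIV \<times> A) (\<lambda>(x, a). l x a)"
    and pq: "1 \<le> p" "p \<le> q"
    and f_lipschitz: "R > 0 \<Longrightarrow> \<exists>L>0. \<forall>a\<in>A. \<forall>x1 x2. norm x1 \<le> R \<and> norm x2 \<le> R \<longrightarrow>
      norm (f x1 a - f x2 a) \<le> L * (1 + norm a ^ p) * norm (x1 - x2)"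
    and l_nonneg: "a \<in> A \<Longrightarrow> 0 \<le> l x a"
    and M: "M > 0"
    and f_growth: "a \<in> A \<Longrightarrow> norm (f x a) \<le> M * (1 + norm a ^ p) * (1 + norm x)"
    and l_coercive: "a \<in> A \<Longrightarrow> C\<^sub>2 * norm a ^ q - C\<^sub>1 \<le> l x a"
    and C: "C\<^sub>1 \<ge> 0" "C\<^sub>2 > 0"
    and f_recession: "recession q A f f_inf"
    and l_recession: "recession q A l l_inf"
begin

abbreviation "K \<equiv> cball 0 1 \<inter> A"
abbreviation "F \<equiv> compactified q f f_inf"
abbreviation "L \<equiv> compactified q l l_inf"

text \<open>The value \<open>\<omega> w\<close> is the homogenizing coordinate of \<open>w\<close>,
  so that the \<open>q\<close>-th powers of \<open>\<omega> w\<close> and \<open>norm w\<close> add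
  up to 1 in the ball. The factor that rescales the dynamics is the \<open>q\<close>-th power of it,
  which is therefore the speed \<tau> of the original time.\<close>

definition \<tau> :: "'a \<Rightarrow> real" where "\<tau> w = 1 - norm w ^ q"
definition \<omega> :: "'a \<Rightarrow> real" where "\<omega> w = root q (\<tau> w)"
text \<open>\<open>dehom w\<close> is the original control value represented by \<open>w\<close> (junk where \<open>\<tau> w = 0\<close>).\<close>

definition dehom :: "'a \<Rightarrow> 'a" where "dehom w = inverse (\<omega> w) *\<^sub>R w"

lemma q: "0 < q" using pq by simp

lemma \<tau>_bounds: "norm w \<le> 1 \<Longrightarrow> 0 \<le> \<tau> w" "\<tau> w \<le> 1"
  by (simp_all add: \<tau>_def power_le_one)

lemma \<omega>_pos: "0 < \<tau> w \<Longrightarrow> 0 < \<omega> w"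
  unfolding \<omega>_def using q by simp

lemma \<omega>_power: "0 < \<tau> w \<Longrightarrow> \<omega> w ^ q = \<tau> w"
  unfolding \<omega>_def using q by (simp add: real_root_pow_pos2)

lemma \<omega>_le_1: "\<omega> w \<le> 1"
  unfolding \<omega>_def using q \<tau>_bounds(2)[of w] by (simp add: real_root_le_1_iff)

lemma compactified_pos:
  assumes "0 < \<tau> w"
  shows "compactified q \<Phi> \<Phi>_inf x w = \<tau> w *\<^sub>R \<Phi> x (dehom w)"
proof -
  have "root q (1 - norm w ^ q) = \<omega> w"
    by (simp only: \<omega>_def \<tau>_def)
  then have "compactified q \<Phi> \<Phi>_inf x w = \<omega> w ^ q *\<^sub>R \<Phi> x (dehom w)"
    using \<omega>_pos[OF assms] by (simp only: compactified_def extended_def dehom_def) simp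
  then show ?thesis
    by (simp only: \<omega>_power[OF assms])
qed

lemma norm_dehom: "0 < \<tau> w \<Longrightarrow> norm (dehom w) = norm w / \<omega> w"
  using \<omega>_pos[of w] by (simp add: dehom_def divide_inverse_commute)

lemma norm_dehom_q:
  assumes "0 < \<tau> w"
  shows "\<tau> w * norm (dehom w) ^ q = norm w ^ q"
  unfolding norm_dehom[OF assms] power_divide \<omega>_power[OF assms] using assms by simp

text \<open>Because \<open>p \<le> q\<close>, the factor \<tau> absorbs the growth of order
  \<open>p\<close>: what remains is \<open>\<omega> w ^ (q - p) * norm w ^ p \<le> 1\<close>. The
  bound 2 is the origin of the constant \<open>2 * M\<close> of the compactified problem.\<close>

lemma norm_dehom_p:
  assumes "0 < \<tau> w" "norm w \<le> 1"
  shows "\<tau> w * (1 + norm (dehom w) ^ p) \<le> 2"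
proof -
  have "\<tau> w = \<omega> w ^ (q - p) * \<omega> w ^ p"
    using \<omega>_power[OF assms(1)] pq by (simp add: power_add[symmetric])
  then have "\<tau> w * norm (dehom w) ^ p = \<omega> w ^ (q - p) * norm w ^ p"
    using \<omega>_pos[OF assms(1)] by (simp add: norm_dehom[OF assms(1)] power_divide)
  also have "\<dots> \<le> 1"
    using \<omega>_pos[OF assms(1)] \<omega>_le_1 assms(2) by (intro mult_le_one power_le_one) auto
  finally show ?thesis
    using \<tau>_bounds(2)[of w] by (simp add: distrib_left)
qed

lemma dehom_mem: "0 < \<tau> w \<Longrightarrow> w \<in> A \<Longrightarrow> dehom w \<in> A"
  using A(2) \<omega>_pos[of w] by (auto simp: dehom_def cone_def)

text \<open>Shrinking \<open>w\<close> by factors tending to 1 stays in the cone and moves it off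
  the unit sphere.\<close>

lemma K_pos_dense: "K \<subseteq> closure {w \<in> K. 0 < \<tau> w}"
proof
  fix w assume w: "w \<in> K"
  define s where "s n = (1 - inverse (real (Suc n))) *\<^sub>R w" for n
  have c: "0 \<le> 1 - inverse (real (Suc n))" "1 - inverse (real (Suc n)) < 1" for n
    by (simp_all add: field_simps)
  have "norm (s n) < 1" for n
  proof -
    have "norm (s n) = (1 - inverse (real (Suc n))) * norm w"
      using c[of n] by (simp only: s_def norm_scaleR abs_of_nonneg)
    also have "\<dots> \<le> (1 - inverse (real (Suc n))) * 1"
      using c[of n] w by (intro mult_left_mono) auto
    finally have "norm (s n) \<le> 1 - inverse (real (Suc n))"
      unfolding mult_1_right .
    then show ?thesis using c(2)[of n] by (rule le_less_trans)
  qed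
  then have "0 < \<tau> (s n)" for n
    using power_strict_mono[of "norm (s n)" 1 q] q by (simp add: \<tau>_def)
  moreover have "s n \<in> K" for n
  proof -
    have "s n \<in> A"
      unfolding s_def using A(2) w c(1)[of n] by (auto simp only: cone_def Int_iff)
    then show ?thesis
      using \<open>\<And>n. norm (s n) < 1\<close>[of n] by simp
  qed
  moreover have "s \<longlonglongrightarrow> (1 - 0) *\<^sub>R w"
    unfolding s_def by (intro tendsto_intros LIMSEQ_inverse_real_of_nat)
  ultimately show "w \<in> closure {w \<in> K. 0 < \<tau> w}"
    unfolding closure_sequential by (intro exI[of _ s]) auto
qed

lemma compact_K: "compact K"
  using A(1) by (intro compact_Int_closed) auto

lemma F_cont: "continuous_on (UNIV \<times> K) (\<lambda>(x, w). F x w)"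
  by (rule compactified_continuous[OF f_cont f_recession A q])

lemma L_cont: "continuous_on (UNIV \<times> K) (\<lambda>(x, w). L x w)"
  by (rule compactified_continuous[OF l_cont l_recession A q])

text \<open>Estimates are verified where \<open>\<tau> w > 0\<close>, in terms of \<open>f\<close>
  and \<open>l\<close>, and extend by continuity to the sphere; so none has to be proved for the
  recession functions directly.\<close>

lemma le_by_density:
  fixes g :: "'a \<Rightarrow> real"
  assumes "continuous_on K g" "\<And>w. w \<in> K \<Longrightarrow> 0 < \<tau> w \<Longrightarrow> g w \<le> c" "w \<in> K"
  shows "g w \<le> c"
proof (rule continuous_le_on_closure[where S="{w \<in> K. 0 < \<tau> w}"])
  have "closure {w \<in> K. 0 < \<tau> w} \<subseteq> K"
    using compact_K by (intro closure_minimal compact_imp_closed) auto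
  then show "continuous_on (closure {w \<in> K. 0 < \<tau> w}) g"
    using assms(1) continuous_on_subset by blast
  show "w \<in> closure {w \<in> K. 0 < \<tau> w}"
    using K_pos_dense assms(3) by blast
qed (use assms(2) in auto)

lemma rate_continuous: "continuous_on S \<tau>"
  unfolding \<tau>_def[abs_def] by (intro continuous_intros)

text \<open>The coercivity constants come from multiplying that of \<open>l\<close> by \<tau>: since
  \<tau> times the \<open>q\<close>-th power of \<open>norm (dehom w)\<close> equals
  \<open>1 - \<tau> w\<close>, the lower bound becomes
  \<open>C\<^sub>2 * (1 - \<tau> w) - C\<^sub>1 * \<tau> w\<close>.\<close>

sublocale control_problem K F L \<tau> "2 * M" "C\<^sub>2" "C\<^sub>1 + C\<^sub>2"
proof
  note F_sec = continuous_on_section[OF F_cont] and L_sec = continuous_on_section[OF L_cont]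
  show "compact K" by (rule compact_K)
  show "continuous_on (UNIV \<times> K) (\<lambda>(x, w). F x w)" by (rule F_cont)
  show "continuous_on (UNIV \<times> K) (\<lambda>(x, w). L x w)" by (rule L_cont)
  show "continuous_on K \<tau>" by (rule rate_continuous)
  show "0 \<le> \<tau> a" "\<tau> a \<le> 1" if "a \<in> K" for a
    using that \<tau>_bounds by auto
  show "K \<subseteq> closure {a \<in> K. 0 < \<tau> a}" by (rule K_pos_dense)
  show "\<exists>C\<ge>0. \<forall>a\<in>K. \<forall>x y. norm x \<le> R \<longrightarrow> norm y \<le> R \<longrightarrow> norm (F x a - F y a) \<le> C * norm (x - y)"
    if R: "R > 0" for R
  proof -
    obtain c where c: "c > 0" "\<forall>a\<in>A. \<forall>x1 x2. norm x1 \<le> R \<and> norm x2 \<le> R \<longrightarrow>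
      norm (f x1 a - f x2 a) \<le> c * (1 + norm a ^ p) * norm (x1 - x2)"
      using f_lipschitz[OF R] by blast
    have "norm (F x a - F y a) \<le> 2 * c * norm (x - y)" if "a \<in> K" "norm x \<le> R" "norm y \<le> R" for a x y
    proof (rule le_by_density[OF _ _ that(1)])
      show "continuous_on K (\<lambda>a. norm (F x a - F y a))"
        by (intro continuous_intros F_sec)
      fix w assume w: "w \<in> K" "0 < \<tau> w"
      have "norm (F x w - F y w) = \<tau> w * norm (f x (dehom w) - f y (dehom w))"
        using w(2) by (simp add: compactified_pos scaleR_diff_right[symmetric])
      also have "\<dots> \<le> \<tau> w * (c * (1 + norm (dehom w) ^ p) * norm (x - y))"
        using c(2) that dehom_mem[of w] w by (intro mult_left_mono) auto
      also have "\<dots> = (\<tau> w * (1 + norm (dehom w) ^ p)) * (c * norm (x - y))"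
        by simp
      also have "\<dots> \<le> 2 * (c * norm (x - y))"
        using norm_dehom_p[of w] w c(1) by (intro mult_right_mono) auto
      finally show "norm (F x w - F y w) \<le> 2 * c * norm (x - y)" by simp
    qed
    then show ?thesis
      using c(1) by (intro exI[of _ "2 * c"]) auto
  qed
  show "norm (F x a) \<le> 2 * M * (1 + norm x)" if a: "a \<in> K" for x a
  proof (rule le_by_density[OF _ _ a])
    show "continuous_on K (\<lambda>a. norm (F x a))"
      by (intro continuous_intros F_sec)
    fix w assume w: "w \<in> K" "0 < \<tau> w"
    have "norm (F x w) = \<tau> w * norm (f x (dehom w))"
      using w(2) by (simp add: compactified_pos)
    also have "\<dots> \<le> \<tau> w * (M * (1 + norm (dehom w) ^ p) * (1 + norm x))"
      using f_growth dehom_mem[of w] w by (intro mult_left_mono) auto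
    also have "\<dots> = (\<tau> w * (1 + norm (dehom w) ^ p)) * (M * (1 + norm x))"
      by simp
    also have "\<dots> \<le> 2 * (M * (1 + norm x))"
      using norm_dehom_p[of w] w M by (intro mult_right_mono) auto
    finally show "norm (F x w) \<le> 2 * M * (1 + norm x)" by simp
  qed
  show "2 * M > 0" using M by simp
  show "0 \<le> L x a" if a: "a \<in> K" for x a
  proof -
    have "- L x a \<le> 0"
    proof (rule le_by_density[OF _ _ a])
      show "continuous_on K (\<lambda>a. - L x a)"
        by (intro continuous_intros L_sec)
    qed (use l_nonneg dehom_mem in \<open>auto simp: compactified_pos\<close>)
    then show ?thesis by simp
  qed
  show "C\<^sub>2 - (C\<^sub>1 + C\<^sub>2) * \<tau> a \<le> L x a" if a: "a \<in> K" for x a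
  proof -
    have "C\<^sub>2 - (C\<^sub>1 + C\<^sub>2) * \<tau> a - L x a \<le> 0"
    proof (rule le_by_density[OF _ _ a])
      show "continuous_on K (\<lambda>a. C\<^sub>2 - (C\<^sub>1 + C\<^sub>2) * \<tau> a - L x a)"
        by (intro continuous_intros L_sec rate_continuous)
      fix w assume w: "w \<in> K" "0 < \<tau> w"
      have "\<tau> w * (C\<^sub>2 * norm (dehom w) ^ q - C\<^sub>1) \<le> \<tau> w * l x (dehom w)"
        using l_coercive dehom_mem[of w] w by (intro mult_left_mono) auto
      also have "\<tau> w * (C\<^sub>2 * norm (dehom w) ^ q - C\<^sub>1) = C\<^sub>2 * (\<tau> w * norm (dehom w) ^ q) - C\<^sub>1 * \<tau> w"
        by (simp add: algebra_simps)
      also have "\<dots> = C\<^sub>2 - (C\<^sub>1 + C\<^sub>2) * \<tau> w"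
        unfolding norm_dehom_q[OF w(2)] by (simp add: \<tau>_def algebra_simps)
      finally show "C\<^sub>2 - (C\<^sub>1 + C\<^sub>2) * \<tau> w - L x w \<le> 0"
        using w(2) by (simp add: compactified_pos)
    qed
    then show ?thesis by simp
  qed
  show "C\<^sub>2 > 0" "C\<^sub>1 + C\<^sub>2 > 0" using C by auto
qed

lemma time_change_clock:
  assumes w: "w \<in> admissible"
  shows "time_change (\<lambda>s. \<tau> (w s))"
proof
  have wo: "w \<in> ordinary" using w by (simp add: admissible_def)
  then have "w \<in> borel_measurable (restrict_space borel {0..})"
    by (simp add: ordinary_def)
  from measurable_compose[OF this borel_measurable_continuous_onI[OF rate_continuous]]
  show "(\<lambda>s. \<tau> (w s)) \<in> borel_measurable (restrict_space borel {0..})" .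
  show "\<exists>s\<ge>0. T \<le> integral {0..s} (\<lambda>s. \<tau> (w s))" for T
    using w by (auto simp: admissible_def clock_def)
  show "0 < \<tau> (w s)" if "0 \<le> s" for s
    by (rule ordinaryD(2)[OF wo that])
  show "(\<lambda>s. \<tau> (w s)) integrable_on {0..s}" for s
    by (rule rate_integrable[OF wo order_refl])
qed

text \<open>\<open>\<alpha>\<close> is the control \<open>w\<close> read in the original time. The
  equation of \<open>f\<close> along \<alpha> is not solved directly: its solutions correspond to
  those of the compactified equation by composition with the clock, which supplies existence as well
  as uniqueness.\<close>

lemma cost_eq:
  assumes w: "w \<in> admissible" and \<alpha>: "\<alpha> \<in> borel_measurable (restrict_space borel {0..})"
    and rel: "\<And>s. 0 \<le> s \<Longrightarrow> \<alpha> (clock w s) = dehom (w s)"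
  shows "\<alpha> \<in> controls q A"
    "(\<integral>\<^sup>+t\<in>{0..}. ennreal (exp (- \<delta> * t) * l (trajectory (\<lambda>s z. f z (\<alpha> s)) x t) (\<alpha> t)) \<partial>lebesgue) = cost \<delta> x w"
proof -
  have wo: "w \<in> ordinary" using w by (simp add: admissible_def)
  have wK: "w s \<in> K" and w_pos: "0 < \<tau> (w s)" if "0 \<le> s" for s
    using ordinaryD[OF wo that] by auto
  interpret tc: time_change "\<lambda>s. \<tau> (w s)" by (rule time_change_clock[OF w])
  interpret s: lipschitz_field "\<lambda>s z. F z (w s)" "2 * M"
    by (rule lipschitz_field_ordinary[OF wo])
  have \<kappa>: "tc.\<kappa> = clock w"
    by (auto simp: tc.\<kappa>_def clock_def)
  have \<alpha>A: "\<alpha> t \<in> A" if "0 \<le> t" for t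
  proof -
    have "\<alpha> t = dehom (w (tc.\<sigma> t))"
      using rel[OF tc.\<sigma>(1)[OF that]] tc.\<sigma>(2)[OF that] by (simp add: \<kappa>)
    then show ?thesis
      using dehom_mem w_pos[OF tc.\<sigma>(1)[OF that]] wK[OF tc.\<sigma>(1)[OF that]] by auto
  qed
  \<comment> \<open>The clock is onto the half line, so a property of all original times may be
    checked at clock values only.\<close>
  have all_T: "P T" if "\<And>S. 0 \<le> S \<Longrightarrow> P (clock w S)" "0 \<le> T" for P T
    using that(1)[OF tc.\<sigma>(1)[OF that(2)]] tc.\<sigma>(2)[OF that(2)] by (simp add: \<kappa>)
  show "\<alpha> \<in> controls q A"
    unfolding controls_def
  proof (intro CollectI conjI allI impI \<alpha> \<alpha>A)
    fix T :: real assume T: "0 \<le> T"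
    show "set_integrable lebesgue {0..T} (\<lambda>t. norm (\<alpha> t) ^ q)"
    proof (rule all_T[OF _ T])
      fix S :: real assume S: "0 \<le> S"
      have eq: "\<tau> (w s) *\<^sub>R norm (\<alpha> (tc.\<kappa> s)) ^ q = norm (w s) ^ q" if "s \<in> {0..S}" for s
        using that rel[of s] norm_dehom_q[OF w_pos[of s]] by (simp add: \<kappa>)
      have m: "(\<lambda>s. norm (w s) ^ q) \<in> borel_measurable (lebesgue_on {0..})"
        using ordinary_measurable[OF wo] by measurable
      have "(\<lambda>s. norm (w s) ^ q) absolutely_integrable_on {0..S}"
      proof (rule absolutely_integrable_bounded[OF m, where B=1])
        show "norm (norm (w s) ^ q) \<le> 1" if "s \<in> {0..S}" for s
          using wK[of s] that by (auto intro: power_le_one)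
      qed simp
      moreover have "(\<lambda>s. \<tau> (w s) *\<^sub>R norm (\<alpha> (tc.\<kappa> s)) ^ q) absolutely_integrable_on {0..S} \<longleftrightarrow>
          (\<lambda>s. norm (w s) ^ q) absolutely_integrable_on {0..S}"
        by (rule set_integrable_cong[OF refl refl eq])
      moreover have "(\<lambda>t. norm (\<alpha> t) ^ q) \<in> borel_measurable (restrict_space borel {0..})"
        using \<alpha> by measurable
      ultimately show "set_integrable lebesgue {0..clock w S} (\<lambda>t. norm (\<alpha> t) ^ q)"
        using tc.integral_change(2)[of "\<lambda>t. norm (\<alpha> t) ^ q" S] S by (simp add: \<kappa>)
    qed
  qed
  let ?\<xi> = "state w x"
  have F_eq: "\<tau> (w s) *\<^sub>R f (z (clock w s)) (\<alpha> (clock w s)) = F (z (clock w s)) (w s)" if "0 \<le> s" for s z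
    by (simp add: compactified_pos[OF w_pos[OF that]] rel[OF that])
  \<comment> \<open>Only Borel measurability of \<open>y\<close> is assumed, because the equivalence
    is applied to the state composed with the inverse clock, which is known to be measurable from
    monotonicity.\<close>
  have iff: "solves (\<lambda>t z. f z (\<alpha> t)) x y \<longleftrightarrow> solves (\<lambda>s z. F z (w s)) x (\<lambda>s. y (clock w s))"
    if y: "y \<in> borel_measurable (restrict_space borel {0..})" for y
  proof -
    let ?h = "\<lambda>t. f (y t) (\<alpha> t)"
    have h: "?h \<in> borel_measurable (restrict_space borel {0..})"
      by (rule borel_measurable_half_line_continuous_pair[OF f_cont y \<alpha> \<alpha>A])
    have i: "?h absolutely_integrable_on {0..clock w S} \<longleftrightarrow> (\<lambda>s. F (y (clock w s)) (w s)) absolutely_integrable_on {0..S}"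
      and e: "?h absolutely_integrable_on {0..clock w S} \<Longrightarrow>
        integral {0..clock w S} ?h = integral {0..S} (\<lambda>s. F (y (clock w s)) (w s))" if S: "0 \<le> S" for S
    proof -
      have eq: "\<tau> (w s) *\<^sub>R ?h (tc.\<kappa> s) = F (y (clock w s)) (w s)" if "s \<in> {0..S}" for s
        using F_eq[of s y] that by (simp add: \<kappa>)
      have c: "(\<lambda>s. \<tau> (w s) *\<^sub>R ?h (tc.\<kappa> s)) absolutely_integrable_on {0..S} \<longleftrightarrow>
          (\<lambda>s. F (y (clock w s)) (w s)) absolutely_integrable_on {0..S}"
        by (rule set_integrable_cong[OF refl refl eq])
      show "?h absolutely_integrable_on {0..clock w S} \<longleftrightarrow> (\<lambda>s. F (y (clock w s)) (w s)) absolutely_integrable_on {0..S}"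
        unfolding c[symmetric] using tc.integral_change(1,2)[OF h S] unfolding \<kappa> by blast
      assume "?h absolutely_integrable_on {0..clock w S}"
      then have "integral {0..clock w S} ?h = integral {0..S} (\<lambda>s. \<tau> (w s) *\<^sub>R ?h (tc.\<kappa> s))"
        using tc.integral_change(3)[OF h S] unfolding \<kappa> by blast
      also have "\<dots> = integral {0..S} (\<lambda>s. F (y (clock w s)) (w s))"
        by (rule integral_cong[OF eq])
      finally show "integral {0..clock w S} ?h = integral {0..S} (\<lambda>s. F (y (clock w s)) (w s))" .
    qed
    show ?thesis
    proof
      assume *: "solves (\<lambda>t z. f z (\<alpha> t)) x y"
      then show "solves (\<lambda>s z. F z (w s)) x (\<lambda>s. y (clock w s))"
        using i e clock_nonneg[OF wo] by (auto simp: solves_alt)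
    next
      assume *: "solves (\<lambda>s z. F z (w s)) x (\<lambda>s. y (clock w s))"
      have "?h absolutely_integrable_on {0..T} \<and> y T = x + integral {0..T} ?h" if "0 \<le> T" for T
      proof (rule all_T[OF _ that])
        fix S :: real assume S: "0 \<le> S"
        then show "?h absolutely_integrable_on {0..clock w S} \<and> y (clock w S) = x + integral {0..clock w S} ?h"
          using * i[OF S] e[OF S] by (auto simp: solves_alt)
      qed
      then show "solves (\<lambda>t z. f z (\<alpha> t)) x y"
        by (simp add: solves_alt)
    qed
  qed
  have cont_borel: "y \<in> borel_measurable (restrict_space borel {0..})" if "continuous_on {0..} y" for y :: "real \<Rightarrow> real ^ 'n"
    using that by (rule borel_measurable_continuous_on_restrict)
  define y where "y = trajectory (\<lambda>t z. f z (\<alpha> t)) x"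
  \<comment> \<open>A solution has to be exhibited first; only then is the choice in
    \<open>trajectory\<close> known to be a solution.\<close>
  have "solves (\<lambda>t z. f z (\<alpha> t)) x (\<lambda>t. ?\<xi> (tc.\<sigma> t))"
  proof (rule iff[THEN iffD2])
    show "(\<lambda>t. ?\<xi> (tc.\<sigma> t)) \<in> borel_measurable (restrict_space borel {0..})"
      by (rule measurable_compose[OF tc.\<sigma>_measurable cont_borel[OF state_continuous[OF wo]]])
    have *: "?\<xi> (tc.\<sigma> (clock w s)) = ?\<xi> s" if "0 \<le> s" for s
      using tc.\<sigma>_\<kappa>[OF that] by (simp add: \<kappa>)
    show "solves (\<lambda>s z. F z (w s)) x (\<lambda>s. ?\<xi> (tc.\<sigma> (clock w s)))"
      unfolding solves_alt
    proof (intro allI impI)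
      fix t :: real assume t: "0 \<le> t"
      have eq: "F (?\<xi> (tc.\<sigma> (clock w s))) (w s) = F (?\<xi> s) (w s)" if "s \<in> {0..t}" for s
        using *[of s] that by simp
      have i: "(\<lambda>s. F (?\<xi> (tc.\<sigma> (clock w s))) (w s)) absolutely_integrable_on {0..t} \<longleftrightarrow>
          (\<lambda>s. F (?\<xi> s) (w s)) absolutely_integrable_on {0..t}"
        by (rule set_integrable_cong[OF refl refl eq])
      have e: "integral {0..t} (\<lambda>s. F (?\<xi> (tc.\<sigma> (clock w s))) (w s)) = integral {0..t} (\<lambda>s. F (?\<xi> s) (w s))"
        by (rule integral_cong[OF eq])
      show "(\<lambda>s. F (?\<xi> (tc.\<sigma> (clock w s))) (w s)) absolutely_integrable_on {0..t} \<and>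
          ?\<xi> (tc.\<sigma> (clock w t)) = x + integral {0..t} (\<lambda>s. F (?\<xi> (tc.\<sigma> (clock w s))) (w s))"
        unfolding i e *[OF t] using s.trajectory_solves[of x] t by (simp add: solves_alt)
    qed
  qed
  from someI[of "solves (\<lambda>t z. f z (\<alpha> t)) x", OF this]
  have y: "solves (\<lambda>t z. f z (\<alpha> t)) x y"
    by (simp only: y_def trajectory_def)
  note y_borel = cont_borel[OF solves_continuous[OF y]]
  \<comment> \<open>The chosen solution, run by the clock, solves the compactified equation, where
    solutions are unique.\<close>
  have y_eq: "y (clock w s) = ?\<xi> s" if "0 \<le> s" for s
    using s.trajectory_unique[OF iff[OF y_borel, THEN iffD1, OF y] that] by simp
  have "(\<lambda>t. l (y t) (\<alpha> t)) \<in> borel_measurable (restrict_space borel {0..})"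
    by (rule borel_measurable_half_line_continuous_pair[OF l_cont y_borel \<alpha> \<alpha>A])
  moreover have "(\<lambda>t::real. t) \<in> borel_measurable (restrict_space borel {0..})"
    by (rule measurable_restrict_space1) simp
  ultimately have "(\<lambda>t. ennreal (exp (- \<delta> * t) * l (y t) (\<alpha> t))) \<in> borel_measurable (restrict_space borel {0..})"
    by measurable
  from tc.nn_integral_change[OF this]
  have "(\<integral>\<^sup>+t\<in>{0..}. ennreal (exp (- \<delta> * t) * l (y t) (\<alpha> t)) \<partial>lebesgue) =
      (\<integral>\<^sup>+s\<in>{0..}. ennreal (exp (- \<delta> * clock w s) * l (y (clock w s)) (\<alpha> (clock w s))) * ennreal (\<tau> (w s)) \<partial>lebesgue)"
    unfolding \<kappa> .
  also have "\<dots> = cost \<delta> x w"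
    unfolding cost_def
  proof (rule nn_integral_cong)
    fix s :: real
    show "ennreal (exp (- \<delta> * clock w s) * l (y (clock w s)) (\<alpha> (clock w s))) * ennreal (\<tau> (w s)) * indicator {0..} s =
        ennreal (exp (- \<delta> * clock w s) * L (?\<xi> s) (w s)) * indicator {0..} s"
    proof (cases "0 \<le> s")
      case True
      have "0 \<le> l (?\<xi> s) (dehom (w s))"
        using l_nonneg dehom_mem w_pos[OF True] wK[OF True] by auto
      then have "ennreal (exp (- \<delta> * clock w s) * l (?\<xi> s) (dehom (w s))) * ennreal (\<tau> (w s)) =
          ennreal (exp (- \<delta> * clock w s) * l (?\<xi> s) (dehom (w s)) * \<tau> (w s))"
        using w_pos[OF True] by (intro ennreal_mult[symmetric]) auto
      then show ?thesis
        using True by (simp add: y_eq rel compactified_pos[OF w_pos[OF True]] mult_ac)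
    qed auto
  qed
  finally show "(\<integral>\<^sup>+t\<in>{0..}. ennreal (exp (- \<delta> * t) * l (trajectory (\<lambda>s z. f z (\<alpha> s)) x t) (\<alpha> t)) \<partial>lebesgue) = cost \<delta> x w"
    unfolding y_def .
qed

text \<open>The control is read off at the inverse clock and dehomogenized; the inverse clock is
  Borel because it is monotone.\<close>

lemma control_of_admissible:
  assumes w: "w \<in> admissible"
  obtains \<alpha> where "\<alpha> \<in> borel_measurable (restrict_space borel {0..})"
    "\<And>s. 0 \<le> s \<Longrightarrow> \<alpha> (clock w s) = dehom (w s)"
proof -
  have wo: "w \<in> ordinary" using w by (simp add: admissible_def)
  interpret tc: time_change "\<lambda>s. \<tau> (w s)" by (rule time_change_clock[OF w])
  have \<kappa>: "tc.\<kappa> = clock w"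
    by (auto simp: tc.\<kappa>_def clock_def)
  have [measurable]: "\<tau> \<in> borel_measurable borel"
    by (rule borel_measurable_continuous_onI[OF rate_continuous])
  have "continuous_on UNIV \<omega>"
    unfolding \<omega>_def[abs_def] by (intro continuous_intros rate_continuous)
  then have [measurable]: "\<omega> \<in> borel_measurable borel"
    by (rule borel_measurable_continuous_onI)
  have "dehom \<in> borel_measurable borel"
    unfolding dehom_def[abs_def] by measurable
  moreover have "(\<lambda>t. w (tc.\<sigma> t)) \<in> borel_measurable (restrict_space borel {0..})"
    using wo by (intro measurable_compose[OF tc.\<sigma>_measurable]) (simp add: ordinary_def)
  ultimately have "(\<lambda>t. dehom (w (tc.\<sigma> t))) \<in> borel_measurable (restrict_space borel {0..})"
    by (rule measurable_compose[rotated])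
  then show ?thesis
    using tc.\<sigma>_\<kappa> by (intro that[of "\<lambda>t. dehom (w (tc.\<sigma> t))"]) (auto simp: \<kappa>)
qed

text \<open>The representative \<open>v\<close> of \<alpha> in the unit ball satisfies
  \<open>\<tau> (v t) = inverse (k t)\<close>, so the new time must run at the rate \<open>k\<close>
  in the original one. Local integrability of the \<open>q\<close>-th power of
  \<open>norm (\<alpha> t)\<close> is what makes this new time finite, and \<open>k \<ge> 1\<close>
  makes it unbounded.\<close>

lemma admissible_of_control:
  assumes \<alpha>: "\<alpha> \<in> controls q A"
  obtains w where "w \<in> admissible" "\<And>s. 0 \<le> s \<Longrightarrow> \<alpha> (clock w s) = dehom (w s)"
proof -
  define k where "k t = 1 + norm (\<alpha> t) ^ q" for t
  have \<alpha>_meas: "\<alpha> \<in> borel_measurable (restrict_space borel {0..})" and \<alpha>A: "\<And>t. 0 \<le> t \<Longrightarrow> \<alpha> t \<in> A"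
    and \<alpha>_int: "\<And>T. 0 \<le> T \<Longrightarrow> (\<lambda>t. norm (\<alpha> t) ^ q) absolutely_integrable_on {0..T}"
    using \<alpha> by (auto simp: controls_def)
  have k_int: "k integrable_on {0..s}" if "0 \<le> s" for s
    unfolding k_def[abs_def] using set_lebesgue_integral_eq_integral(1)[OF \<alpha>_int[OF that]]
    by (intro integrable_add integrable_const_ivl)
  have k_pos: "0 < k s" "1 \<le> k s" for s
    by (simp_all add: k_def add_pos_nonneg)
  have k_meas: "k \<in> borel_measurable (restrict_space borel {0..})"
    unfolding k_def[abs_def] using \<alpha>_meas by measurable
  have k_unbounded: "\<exists>s\<ge>0. T \<le> integral {0..s} k" for T
  proof (intro exI[of _ "max 0 T"] conjI)
    define S where "S = max 0 T"
    have S: "0 \<le> S" "T \<le> S"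
      by (simp_all add: S_def)
    have "integral {0..S} (\<lambda>_. 1) \<le> integral {0..S} k"
      using k_pos(2) k_int[OF S(1)] by (intro integral_le) auto
    moreover have "integral {0..S} (\<lambda>_. 1 :: real) = S"
      using S(1) by simp
    ultimately show "T \<le> integral {0..max 0 T} k"
      using S(2) unfolding S_def by linarith
  qed simp
  interpret tc: time_change k
    by (rule time_change.intro[OF k_meas k_pos(1) k_int k_unbounded])
  define v where "v t = inverse (root q (k t)) *\<^sub>R \<alpha> t" for t
  have root_pos: "0 < root q (k t)" and root_pow: "root q (k t) ^ q = k t" for t
    using k_pos(1)[of t] q by (auto simp: real_root_pow_pos)
  have norm_v: "norm (v t) ^ q = norm (\<alpha> t) ^ q / k t" for t
    using root_pos[of t] root_pow[of t]
    by (simp add: v_def power_mult_distrib divide_inverse_commute power_inverse)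
  have \<tau>_v: "\<tau> (v t) = inverse (k t)" for t
    using k_pos(1)[of t] by (simp add: \<tau>_def norm_v field_simps) (simp add: k_def)
  have v_K: "v t \<in> K" if "0 \<le> t" for t
  proof -
    have "norm (v t) ^ q \<le> 1 ^ q"
      using k_pos(1)[of t] by (simp add: norm_v divide_le_eq) (simp add: k_def)
    then have "norm (v t) \<le> 1"
      using power_le_imp_le_base[of "norm (v t)" "q - 1" 1] q by simp
    moreover have "v t \<in> A"
      unfolding v_def using A(2) \<alpha>A[OF that] root_pos[of t] by (auto simp: cone_def)
    ultimately show ?thesis by simp
  qed
  have dehom_v: "dehom (v t) = \<alpha> t" for t
  proof -
    have "\<omega> (v t) = inverse (root q (k t))"
      using q by (simp add: \<omega>_def \<tau>_v real_root_inverse)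
    then show ?thesis
      using root_pos[of t] by (simp add: dehom_def v_def)
  qed
  have v_meas: "v \<in> borel_measurable (restrict_space borel {0..})"
  proof -
    have "root q \<in> borel_measurable borel"
      by (intro borel_measurable_continuous_onI continuous_intros)
    from measurable_compose[OF k_meas this] show ?thesis
      unfolding v_def[abs_def] using \<alpha>_meas by measurable
  qed
  define w where "w s = v (tc.\<sigma> s)" for s
  have w_meas: "w \<in> borel_measurable (restrict_space borel {0..})"
    unfolding w_def[abs_def] by (rule measurable_compose[OF tc.\<sigma>_measurable v_meas])
  have wo: "w \<in> ordinary"
    unfolding ordinary_def using w_meas v_K tc.\<sigma>(1) k_pos(1) by (auto simp: w_def \<tau>_v)
  \<comment> \<open>The clock of \<open>w\<close> undoes the new time: the two rates multiply to 1
    along \<open>tc.\<kappa>\<close>. In particular it reaches every original time.\<close>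
  have clock: "clock w (tc.\<kappa> T) = T" if T: "0 \<le> T" for T
  proof -
    have eq: "k t *\<^sub>R \<tau> (w (tc.\<kappa> t)) = 1" if "t \<in> {0..T}" for t
      using that k_pos(1)[of t] by (simp add: w_def tc.\<sigma>_\<kappa> \<tau>_v)
    have "(\<lambda>t. k t *\<^sub>R \<tau> (w (tc.\<kappa> t))) absolutely_integrable_on {0..T} \<longleftrightarrow>
        (\<lambda>t. 1 :: real) absolutely_integrable_on {0..T}"
      by (rule set_integrable_cong[OF refl refl eq])
    then have "(\<lambda>t. k t *\<^sub>R \<tau> (w (tc.\<kappa> t))) absolutely_integrable_on {0..T}"
      by simp
    moreover have "(\<lambda>s. \<tau> (w s)) \<in> borel_measurable (restrict_space borel {0..})"
      by (rule measurable_compose[OF w_meas borel_measurable_continuous_onI[OF rate_continuous]])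
    ultimately have "clock w (tc.\<kappa> T) = integral {0..T} (\<lambda>t. k t *\<^sub>R \<tau> (w (tc.\<kappa> t)))"
      unfolding clock_def using tc.integral_change(3) T by blast
    also have "\<dots> = integral {0..T} (\<lambda>_. 1)"
      by (rule integral_cong[OF eq])
    finally show ?thesis
      using T by simp
  qed
  show ?thesis
  proof (rule that[of w])
    have "\<exists>s\<ge>0. T \<le> clock w s" for T
      using clock[of "max 0 T"] tc.\<kappa>_nonneg[of "max 0 T"] by (intro exI[of _ "tc.\<kappa> (max 0 T)"]) auto
    then show "w \<in> admissible"
      using wo by (simp add: admissible_def)
    fix s :: real assume s: "0 \<le> s"
    show "\<alpha> (clock w s) = dehom (w s)"
      using clock[OF tc.\<sigma>(1)[OF s]] tc.\<sigma>(2)[OF s] by (simp add: w_def dehom_v)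
  qed
qed

text \<open>Each control of either problem has a partner in the other one related to it as in
  \<open>cost_eq\<close>, and partners have equal cost.\<close>

lemma discounted_value_eq: "discounted_value q A f l \<delta> x = discounted \<delta> x"
proof (rule antisym)
  show "discounted_value q A f l \<delta> x \<le> discounted \<delta> x"
    unfolding discounted_def
  proof (rule INF_greatest)
    fix w assume w: "w \<in> admissible"
    obtain \<alpha> where "\<alpha> \<in> borel_measurable (restrict_space borel {0..})"
      "\<And>s. 0 \<le> s \<Longrightarrow> \<alpha> (clock w s) = dehom (w s)"
      using control_of_admissible[OF w] by blast
    from cost_eq[OF w this] show "discounted_value q A f l \<delta> x \<le> cost \<delta> x w"
      unfolding discounted_value_def by (metis (no_types, lifting) INF_lower)
  qed
  show "discounted \<delta> x \<le> discounted_value q A f l \<delta> x"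
    unfolding discounted_value_def
  proof (rule INF_greatest)
    fix \<alpha> assume \<alpha>: "\<alpha> \<in> controls q A"
    obtain w where w: "w \<in> admissible" "\<And>s. 0 \<le> s \<Longrightarrow> \<alpha> (clock w s) = dehom (w s)"
      using admissible_of_control[OF \<alpha>] by blast
    have "\<alpha> \<in> borel_measurable (restrict_space borel {0..})"
      using \<alpha> by (simp add: controls_def)
    from cost_eq(2)[OF w(1) this w(2)]
    show "discounted \<delta> x \<le> (\<integral>\<^sup>+t\<in>{0..}. ennreal (exp (- \<delta> * t) * l (trajectory (\<lambda>s z. f z (\<alpha> s)) x t) (\<alpha> t)) \<partial>lebesgue)"
      unfolding discounted_def using w(1) by (simp add: INF_lower)
  qed
qed

end

section \<open>Compact control sets, and conclusion\<close>

lemma discounted_value_tendsto_compact: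
  fixes A :: "'a::euclidean_space set"
    and f :: "real ^ 'n \<Rightarrow> 'a \<Rightarrow> real ^ 'n" and l :: "real ^ 'n \<Rightarrow> 'a \<Rightarrow> real"
  assumes A: "compact A"
    and f_cont: "continuous_on (UNIV \<times> A) (\<lambda>(x, a). f x a)"
    and l_cont: "continuous_on (UNIV \<times> A) (\<lambda>(x, a). l x a)"
    and f_lipschitz: "\<And>R. R > 0 \<Longrightarrow> \<exists>L>0. \<forall>a\<in>A. \<forall>x1 x2. norm x1 \<le> R \<and> norm x2 \<le> R \<longrightarrow>
      norm (f x1 a - f x2 a) \<le> L * (1 + norm a ^ p) * norm (x1 - x2)"
    and l_nonneg: "\<And>x a. a \<in> A \<Longrightarrow> 0 \<le> l x a"
    and M: "M > 0"
    and f_growth: "\<And>x a. a \<in> A \<Longrightarrow> norm (f x a) \<le> M * (1 + norm a ^ p) * (1 + norm x)"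
    and bounded: "\<And>\<delta>. \<delta> > 0 \<Longrightarrow> \<exists>K::real. \<forall>x. discounted_value q A f l \<delta> x \<le> ennreal K"
  shows "((\<lambda>\<delta>. discounted_value q A f l \<delta> x) \<longlongrightarrow> relaxed_value A f l x) (at_right 0)"
proof -
  \<comment> \<open>A bound on the control values turns the factor \<open>1 + norm a ^ p\<close> in
    the growth and Lipschitz conditions into a constant.\<close>
  obtain D where D: "D > 0" "\<And>a. a \<in> A \<Longrightarrow> norm a \<le> D"
    using compact_imp_bounded[OF A] by (auto simp: bounded_pos)
  have Dp: "1 + norm a ^ p \<le> 1 + D ^ p" if "a \<in> A" for a
    using D(2)[OF that] by (auto intro: power_mono)
  \<comment> \<open>With rate 1 the clock is the identity, and with both coercivity constants equal
    to 1 coercivity reduces to \<open>0 \<le> l x a\<close>.\<close>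
  interpret c: control_problem A f l "\<lambda>_. 1" "M * (1 + D ^ p)" 1 1
  proof
    show "\<exists>C\<ge>0. \<forall>a\<in>A. \<forall>x y. norm x \<le> R \<longrightarrow> norm y \<le> R \<longrightarrow> norm (f x a - f y a) \<le> C * norm (x - y)"
      if R: "R > 0" for R
    proof -
      obtain c where c: "c > 0" "\<forall>a\<in>A. \<forall>x1 x2. norm x1 \<le> R \<and> norm x2 \<le> R \<longrightarrow>
        norm (f x1 a - f x2 a) \<le> c * (1 + norm a ^ p) * norm (x1 - x2)"
        using f_lipschitz[OF R] by blast
      have "norm (f x a - f y a) \<le> c * (1 + D ^ p) * norm (x - y)"
        if "a \<in> A" "norm x \<le> R" "norm y \<le> R" for a x y
      proof -
        have "norm (f x a - f y a) \<le> c * (1 + norm a ^ p) * norm (x - y)"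
          using c(2) that by blast
        also have "\<dots> \<le> c * (1 + D ^ p) * norm (x - y)"
          using Dp[OF that(1)] c(1) by (intro mult_right_mono mult_left_mono) auto
        finally show ?thesis .
      qed
      then show ?thesis
        using c(1) D(1) by (intro exI[of _ "c * (1 + D ^ p)"]) auto
    qed
    show "norm (f x a) \<le> M * (1 + D ^ p) * (1 + norm x)" if "a \<in> A" for x a
    proof -
      have "norm (f x a) \<le> M * (1 + norm a ^ p) * (1 + norm x)"
        using that by (rule f_growth)
      also have "\<dots> \<le> M * (1 + D ^ p) * (1 + norm x)"
        using Dp[OF that] M by (intro mult_right_mono mult_left_mono) auto
      finally show ?thesis .
    qed
    show "M * (1 + D ^ p) > 0"
      using M D(1) by (intro mult_pos_pos add_pos_pos) auto
    show "A \<subseteq> closure {a \<in> A. 0 < (1::real)}"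
      using closure_subset[of A] by simp
  qed (use A f_cont l_cont l_nonneg in auto)
  have clock: "c.clock w s = s" if "0 \<le> s" for w s
    using that by (simp add: c.clock_def)
  have "w \<in> c.admissible \<longleftrightarrow> w \<in> c.ordinary" for w
  proof -
    have "\<exists>s\<ge>0. T \<le> c.clock w s" for T
      using clock[of "max 0 T" w] by (intro exI[of _ "max 0 T"]) auto
    then show ?thesis
      by (simp add: c.admissible_def)
  qed
  moreover have "w \<in> controls q A \<longleftrightarrow> w \<in> c.ordinary" for w
  proof -
    have "(\<lambda>t. norm (w t) ^ q) absolutely_integrable_on {0..T}" if "w \<in> c.ordinary" for T
    proof -
      have m: "(\<lambda>t. norm (w t) ^ q) \<in> borel_measurable (lebesgue_on {0..})"
        using c.ordinary_measurable[OF that] by measurable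
      show ?thesis
        by (rule absolutely_integrable_bounded[OF m, where B="D ^ q"])
           (use c.ordinaryD(1)[OF that] D(2) in \<open>auto intro: power_mono\<close>)
    qed
    then show ?thesis
      by (auto simp: controls_def c.ordinary_def)
  qed
  ultimately have adm: "c.admissible = controls q A"
    by blast
  have eq: "discounted_value q A f l \<delta> x = c.discounted \<delta> x" for \<delta> x
    unfolding discounted_value_def c.discounted_def adm
  proof (rule INF_cong[OF refl])
    fix w
    show "(\<integral>\<^sup>+t\<in>{0..}. ennreal (exp (- \<delta> * t) * l (c.state w x t) (w t)) \<partial>lebesgue) = c.cost \<delta> x w"
      unfolding c.cost_def by (rule nn_integral_cong) (auto simp: clock indicator_def)
  qed
  show ?thesis
    unfolding eq using bounded by (intro c.discounted_tendsto) (simp add: eq)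
qed

theorem theorem6p2:
  fixes A :: "(real ^ 'm) set"
    and f f_inf :: "real ^ 'n \<Rightarrow> real ^ 'm \<Rightarrow> real ^ 'n"
    and l l_inf :: "real ^ 'n \<Rightarrow> real ^ 'm \<Rightarrow> real"
    and p q :: nat and M :: real
  assumes A: "compact A \<or>
      (\<not> bounded A \<and> convex A \<and> closed A \<and> cone A \<and> A \<noteq> {0} \<and> 0 \<in> A)"
    and f_cont: "continuous_on (UNIV \<times> A) (\<lambda>(x, a). f x a)"
    and l_cont: "continuous_on (UNIV \<times> A) (\<lambda>(x, a). l x a)"
    and pq: "1 \<le> p" "p \<le> q"
    and f_lipschitz: "\<And>R. R > 0 \<Longrightarrow> \<exists>L>0. \<forall>a\<in>A. \<forall>x1 x2. norm x1 \<le> R \<and> norm x2 \<le> R \<longrightarrow>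
      norm (f x1 a - f x2 a) \<le> L * (1 + norm a ^ p) * norm (x1 - x2)"
    and l_lipschitz: "\<And>R. R > 0 \<Longrightarrow> \<exists>L>0. \<forall>a\<in>A. \<forall>x1 x2. norm x1 \<le> R \<and> norm x2 \<le> R \<longrightarrow>
      \<bar>l x1 a - l x2 a\<bar> \<le> L * (1 + norm a ^ q) * norm (x1 - x2)"
    and l_bound: "\<And>R. R > 0 \<Longrightarrow> \<exists>M\<^sub>R>0. \<forall>a\<in>A. \<forall>x. norm x \<le> R \<longrightarrow>
      0 \<le> l x a \<and> l x a \<le> M\<^sub>R * (1 + norm a ^ q)"
    and M: "M > 0"
    and f_growth: "\<And>x a. a \<in> A \<Longrightarrow> norm (f x a) \<le> M * (1 + norm a ^ p) * (1 + norm x)"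
    and l_coercive: "\<not> bounded A \<Longrightarrow>
      \<exists>C\<^sub>1\<ge>0. \<exists>C\<^sub>2>0. \<forall>x. \<forall>a\<in>A. l x a \<ge> C\<^sub>2 * norm a ^ q - C\<^sub>1"
    and f_recession: "\<not> bounded A \<Longrightarrow> recession q A f f_inf"
    and l_recession: "\<not> bounded A \<Longrightarrow> recession q A l l_inf"
    and discounted_bounded:
      "\<And>\<delta>. \<delta> > 0 \<Longrightarrow> \<exists>K::real. \<forall>x. discounted_value q A f l \<delta> x \<le> ennreal K"
  shows "\<forall>x. ((\<lambda>\<delta>. discounted_value q A f l \<delta> x) \<longlongrightarrow>
      relaxed_infinite_horizon_value q A f l f_inf l_inf x) (at_right 0)"
proof
  fix x
  have l_nonneg: "0 \<le> l x a" if "a \<in> A" for x a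
  proof -
    \<comment> \<open>The local bounds on \<open>l\<close> are stated for positive radii; this one
      is positive even for \<open>x = 0\<close> and covers \<open>x\<close>.\<close>
    have "norm x + 1 > 0"
      by (simp add: add_nonneg_pos)
    from l_bound[OF this] show ?thesis
      using that by force
  qed
  show "((\<lambda>\<delta>. discounted_value q A f l \<delta> x) \<longlongrightarrow>
      relaxed_infinite_horizon_value q A f l f_inf l_inf x) (at_right 0)"
  proof (cases "bounded A")
    case True
    then have "compact A" using A by blast
    then show ?thesis
      using True
        discounted_value_tendsto_compact[OF _ f_cont l_cont f_lipschitz l_nonneg M f_growth discounted_bounded]
      by (simp add: relaxed_infinite_horizon_value_def)
  next
    case False
    then have "closed A" "cone A"
      using A compact_imp_bounded by blast+
    obtain C\<^sub>1 C\<^sub>2 where C: "C\<^sub>1 \<ge> 0" "C\<^sub>2 > 0" "\<And>x a. a \<in> A \<Longrightarrow> C\<^sub>2 * norm a ^ q - C\<^sub>1 \<le> l x a"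
      using l_coercive[OF False] by metis
    interpret u: unbounded_problem A f f_inf l l_inf p q M C\<^sub>1 C\<^sub>2
      by (rule unbounded_problem.intro) (fact \<open>closed A\<close> \<open>cone A\<close> f_cont l_cont pq f_lipschitz l_nonneg M
        f_growth C f_recession[OF False] l_recession[OF False])+
    show ?thesis
      unfolding relaxed_infinite_horizon_value_def u.discounted_value_eq using False discounted_bounded
      by (simp add: u.discounted_value_eq u.discounted_tendsto)
  qed
qed

end
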